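(* Consider the stochastic bilevel problem and the algorithm VRBO described in the context. Suppose the strong convexity assumption, the Lipschitz assumptions and the bounded variance assumption (with constants $\mu,M,L,\tau,\rho,\sigma$) hold. Let $$\alpha=\frac{1}{20L_m^3},\quad \beta=\frac{2}{13L_Q},\quad \eta<\frac1L,\quad S_2\ge2\Big(\frac L\mu+1\Big)L\beta,\quad m=\frac{16}{\mu\beta}-1,\quad q=\frac{\mu L\beta S_2}{\mu+L},$$ where $L_m=\max\{L_Q,L_\Phi\}$. Choose $S_1=\mathcal O(\epsilon^{-1})$, $S_2=\mathcal O(\epsilon^{-0.5})$, $Q=\mathcal O(\log(\frac{1}{\epsilon^{0.5}}))$, $K=\mathcal O(\epsilon^{-1})$. Then VRBO finds an $\epsilon$-stationary point of $\Phi$ with gradient complexity $\widetilde{\mathcal O}(\epsilon^{-1.5})$ and Hessian-vector complexity $\widetilde{\mathcal O}(\epsilon^{-1.5})$.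
   Context: Problem. $F(x,y;\xi)$ and $G(x,y;\zeta)$, $x\in\mathbb R^{n_x}$, $y\in\mathbb R^{n_y}$, are real-valued functions ($F$ differentiable, $G$ twice differentiable in $(x,y)$) depending on random samples $\xi,\zeta$; $f(x,y)=\mathbb E_\xi F(x,y;\xi)$, $g(x,y)=\mathbb E_\zeta G(x,y;\zeta)$, $y^*(x)=\arg\min_y g(x,y)$, $\Phi(x)=f(x,y^*(x))$ (to be minimized), $z=(x,y)$. Strong convexity assumption: $G(x,\cdot;\zeta)$ is $\mu$-strongly convex for all $x,\zeta$. Lipschitz assumptions: for all $\xi,\zeta$, as functions of $z$, $F(\cdot;\xi)$ is $M$-Lipschitz, $\nabla F(\cdot;\xi)$ and $\nabla G(\cdot;\zeta)$ are $L$-Lipschitz, $\nabla_x\nabla_yG(\cdot;\zeta)$ is $\tau$-Lipschitz, $\nabla_y^2G(\cdot;\zeta)$ is $\rho$-Lipschitz. Bounded variance assumption: $\mathbb E_\zeta\|\nabla G(z;\zeta)-\nabla g(z)\|^2\le\sigma^2$ for all $z$. A point $\bar x$ is $\epsilon$-stationary for $\Phi$ if $\|\nabla\Phi(\bar x)\|^2\le\epsilon$; for the (random) output of a stochastic algorithm this is understood in expectation, $\mathbb E\|\nabla\Phi(\bar x)\|^2\le\epsilon$, with $\bar x$ selected among the iterates (e.g. uniformly at random). Gradient complexity: total number of evaluations of sample gradients of $F(\cdot;\xi)$ and $G(\cdot;\zeta)$. Hessian-vector complexity: total number of products $\nabla_y^2G(\cdot;\zeta)v$. $\widetilde{\mathcal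 O}$ omits $\log\frac1\epsilon$ factors. Hypergradient estimator. For $\eta>0$, $Q\in\mathbb N$ and a batch $\mathcal S=\{\zeta_i^j\,(j=1,\dots,Q),\xi_i,\zeta_i: i=1,\dots,s\}$ of independent samples, $$\widehat\nabla\Phi(x,y;\mathcal S)=\frac1s\sum_{i=1}^s\Big(\nabla_xF(x,y;\xi_i)-\nabla_x\nabla_yG(x,y;\zeta_i)\,\eta\sum_{r=-1}^{Q-1}\prod_{j=Q-r}^{Q}(I-\eta\nabla_y^2G(x,y;\zeta_i^j))\nabla_yF(x,y;\xi_i)\Big)$$ (empty product $=I$). $\nabla_yG(x,y;\mathcal S)$ is the average of $\nabla_yG(x,y;\cdot)$ over the batch. Algorithm VRBO (stepsizes $\alpha,\beta>0$, batch sizes $S_1,S_2$, period $q$, inner length $m$). From $x_0,y_0$, for $k=0,1,\dots,K$: if $k\equiv0$ mod $q$, draw a fresh batch $\mathcal S_1$ of size $S_1$ and set $u_k=\nabla_yG(x_k,y_k;\mathcal S_1)$, $v_k=\widehat\nabla\Phi(x_k,y_k;\mathcal S_1)$; otherwise $u_k=\widetilde u_{k-1,m+1}$, $v_k=\widetilde v_{k-1,m+1}$. Set $x_{k+1}=x_k-\alpha v_k$; $\widetilde x_{k,-1}=x_k$, $\widetilde y_{k,-1}=y_k$, $\widetilde x_{k,0}=x_{k+1}$, $\widetilde y_{k,0}=y_k$, $\widetilde v_{k,-1}=v_k$, $\widetilde u_{k,-1}=u_k$. For $t=0,\dots,m+1$: draw a fresh batch $\mathcal S_2$ of size $S_2$,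 set $\widetilde v_{k,t}=\widetilde v_{k,t-1}+\widehat\nabla\Phi(\widetilde x_{k,t},\widetilde y_{k,t};\mathcal S_2)-\widehat\nabla\Phi(\widetilde x_{k,t-1},\widetilde y_{k,t-1};\mathcal S_2)$, $\widetilde u_{k,t}=\widetilde u_{k,t-1}+\nabla_yG(\widetilde x_{k,t},\widetilde y_{k,t};\mathcal S_2)-\nabla_yG(\widetilde x_{k,t-1},\widetilde y_{k,t-1};\mathcal S_2)$, $\widetilde x_{k,t+1}=\widetilde x_{k,t}$, $\widetilde y_{k,t+1}=\widetilde y_{k,t}-\beta\widetilde u_{k,t}$. Finally $y_{k+1}=\widetilde y_{k,m+1}$. (Integer rounding of $m,q$ is ignored.) Constants. $L_\Phi=L+\frac{2L^2+\tau M^2}{\mu}+\frac{\rho LM+L^3+\tau ML}{\mu^2}+\frac{\rho L^2M}{\mu^3}$; $L_Q>0$ with $L_Q^2=2L^2+4\tau^2\eta^2M^2(Q+1)^2+8L^4\eta^2(Q+1)^2+2L^2\eta^4M^2\rho^2Q^2(Q+1)^2$.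
   Formalization: K is of order L_m^3/ε instead of ε^{-1}, since L_m grows (polylogarithmically) with Q and the claim fails with K = O(ε^{-1}) literally; Φ is assumed bounded below, since it fails for linear Φ. *)

theory Defs
  imports "HOL-Probability.Probability" "HOL-Library.Landau_Symbols"
begin

section \<open>Gradients and Hessian blocks\<close>

definition gradient :: "('a::real_inner \<Rightarrow> real) \<Rightarrow> 'a \<Rightarrow> 'a" where
  "gradient h z = (THE D. GDERIV h z :> D)"

definition grad_x :: "('a::euclidean_space \<times> 'b::euclidean_space \<Rightarrow> real) \<Rightarrow> 'a \<times> 'b \<Rightarrow> 'a" where
  "grad_x h z = gradient (\<lambda>x. h (x, snd z)) (fst z)"

definition grad_y :: "('a::euclidean_space \<times> 'b::euclidean_space \<Rightarrow> real) \<Rightarrow> 'a \<times> 'b \<Rightarrow> 'b" where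
  "grad_y h z = gradient (\<lambda>y. h (fst z, y)) (snd z)"

(* The matrix with entries d^2 h / (dx_i dy_j), as an operator from the y-space to the x-space:
   the transpose of the Jacobian of grad_y h in x. *)
definition hess_xy ::
  "('a::euclidean_space \<times> 'b::euclidean_space \<Rightarrow> real) \<Rightarrow> 'a \<times> 'b \<Rightarrow> 'b \<Rightarrow>\<^sub>L 'a" where
  "hess_xy h z = Blinfun (adjoint (frechet_derivative (\<lambda>x. grad_y h (x, snd z)) (at (fst z))))"

definition hess_yy ::
  "('a::euclidean_space \<times> 'b::euclidean_space \<Rightarrow> real) \<Rightarrow> 'a \<times> 'b \<Rightarrow> 'b \<Rightarrow>\<^sub>L 'b" where
  "hess_yy h z = Blinfun (frechet_derivative (\<lambda>y. grad_y h (fst z, y)) (at (snd z)))"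

definition strongly_convex :: "real \<Rightarrow> ('b::real_normed_vector \<Rightarrow> real) \<Rightarrow> bool" where
  "strongly_convex \<mu> h \<longleftrightarrow> (\<forall>y y'. \<forall>t\<in>{0..1}.
     h (t *\<^sub>R y + (1 - t) *\<^sub>R y') \<le> t * h y + (1 - t) * h y' - \<mu> / 2 * t * (1 - t) * (norm (y - y'))\<^sup>2)"


section \<open>The stochastic bilevel problem\<close>

definition mean_fun :: "'s measure \<Rightarrow> ('s \<Rightarrow> 'z \<Rightarrow> real) \<Rightarrow> 'z \<Rightarrow> real" where
  "mean_fun D H z = (\<integral>s. H s z \<partial>D)"

definition ystar :: "('a \<times> 'b \<Rightarrow> real) \<Rightarrow> 'a \<Rightarrow> 'b" where
  "ystar g x = (ARG_MIN (\<lambda>y. g (x, y)) y. True)"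

definition Phi :: "('a \<times> 'b \<Rightarrow> real) \<Rightarrow> ('a \<times> 'b \<Rightarrow> real) \<Rightarrow> 'a \<Rightarrow> real" where
  "Phi f g x = f (x, ystar g x)"

locale stochastic_bilevel =
  fixes \<mu> M L \<tau> \<rho> \<sigma> :: real
    and Dxi :: "'xi measure" and Dzeta :: "'zeta measure"
    and F :: "'xi \<Rightarrow> 'a::euclidean_space \<times> 'b::euclidean_space \<Rightarrow> real"
    and G :: "'zeta \<Rightarrow> 'a \<times> 'b \<Rightarrow> real"
  assumes prob_xi: "prob_space Dxi"
    and prob_zeta: "prob_space Dzeta"
    and F_integrable: "\<And>z. integrable Dxi (\<lambda>\<xi>. F \<xi> z)"
    and G_integrable: "\<And>z. integrable Dzeta (\<lambda>\<zeta>. G \<zeta> z)"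
    and F_differentiable: "\<And>\<xi> z. \<xi> \<in> space Dxi \<Longrightarrow> F \<xi> differentiable (at z)"
    and G_differentiable: "\<And>\<zeta> z. \<zeta> \<in> space Dzeta \<Longrightarrow> G \<zeta> differentiable (at z)"
    and G_twice_differentiable:
      "\<And>\<zeta> z. \<zeta> \<in> space Dzeta \<Longrightarrow> gradient (G \<zeta>) differentiable (at z)"
    and G_strongly_convex:
      "\<And>\<zeta> x. \<zeta> \<in> space Dzeta \<Longrightarrow> strongly_convex \<mu> (\<lambda>y. G \<zeta> (x, y))"
    and F_lipschitz: "\<And>\<xi>. \<xi> \<in> space Dxi \<Longrightarrow> M-lipschitz_on UNIV (F \<xi>)"
    and grad_F_lipschitz: "\<And>\<xi>. \<xi> \<in> space Dxi \<Longrightarrow> L-lipschitz_on UNIV (gradient (F \<xi>))"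
    and grad_G_lipschitz: "\<And>\<zeta>. \<zeta> \<in> space Dzeta \<Longrightarrow> L-lipschitz_on UNIV (gradient (G \<zeta>))"
    and hess_xy_lipschitz: "\<And>\<zeta>. \<zeta> \<in> space Dzeta \<Longrightarrow> \<tau>-lipschitz_on UNIV (hess_xy (G \<zeta>))"
    and hess_yy_lipschitz: "\<And>\<zeta>. \<zeta> \<in> space Dzeta \<Longrightarrow> \<rho>-lipschitz_on UNIV (hess_yy (G \<zeta>))"
    and variance_integrable:
      "\<And>z. integrable Dzeta (\<lambda>\<zeta>. (norm (gradient (G \<zeta>) z - gradient (mean_fun Dzeta G) z))\<^sup>2)"
    and variance_bound:
      "\<And>z. (\<integral>\<zeta>. (norm (gradient (G \<zeta>) z - gradient (mean_fun Dzeta G) z))\<^sup>2 \<partial>Dzeta) \<le> \<sigma>\<^sup>2"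

(* Differentiability and integrability are required explicitly because both the gradient and the
   Bochner integral are total functions. *)
definition eps_stationary_in_expectation ::
  "real \<Rightarrow> ('a::euclidean_space \<Rightarrow> real) \<Rightarrow> 'w measure \<Rightarrow> ('w \<Rightarrow> 'a) \<Rightarrow> bool" where
  "eps_stationary_in_expectation \<epsilon> \<Phi> W X \<longleftrightarrow>
     (\<forall>x. \<Phi> differentiable (at x)) \<and>
     integrable W (\<lambda>w. (norm (gradient \<Phi> (X w)))\<^sup>2) \<and>
     (\<integral>w. (norm (gradient \<Phi> (X w)))\<^sup>2 \<partial>W) \<le> \<epsilon>"


section \<open>Batch estimators\<close>

(* A batch of size s is given by \<xi>s i and \<zeta>s i j for i = 1..s, where \<zeta>s i 0 is the sample \<zeta>_i
   and \<zeta>s i j, for j = 1..Q, is the sample \<zeta>_i^j. *)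

(* The ordered product (I - \<eta> H a) (I - \<eta> H (a+1)) ... (I - \<eta> H b), applied to v. *)
definition neumann_prod ::
  "real \<Rightarrow> (nat \<Rightarrow> 'b::real_normed_vector \<Rightarrow>\<^sub>L 'b) \<Rightarrow> nat \<Rightarrow> nat \<Rightarrow> 'b \<Rightarrow> 'b" where
  "neumann_prod \<eta> H a b v = foldr (\<lambda>j w. w - \<eta> *\<^sub>R blinfun_apply (H j) w) [a..<Suc b] v"

(* The summation index r below runs over 0..Q; it is the conventional index -1..Q-1 plus one. *)
definition hypergrad_est ::
  "('xi \<Rightarrow> 'a::euclidean_space \<times> 'b::euclidean_space \<Rightarrow> real) \<Rightarrow> ('zeta \<Rightarrow> 'a \<times> 'b \<Rightarrow> real) \<Rightarrow>
   real \<Rightarrow> nat \<Rightarrow> nat \<Rightarrow> (nat \<Rightarrow> 'xi) \<Rightarrow> (nat \<Rightarrow> nat \<Rightarrow> 'zeta) \<Rightarrow> 'a \<times> 'b \<Rightarrow> 'a" where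
  "hypergrad_est F G \<eta> Q s \<xi>s \<zeta>s z = (1 / real s) *\<^sub>R (\<Sum>i=1..s.
     grad_x (F (\<xi>s i)) z
     - blinfun_apply (hess_xy (G (\<zeta>s i 0)) z)
         (\<eta> *\<^sub>R (\<Sum>r=0..Q. neumann_prod \<eta> (\<lambda>j. hess_yy (G (\<zeta>s i j)) z) (Q + 1 - r) Q
                            (grad_y (F (\<xi>s i)) z))))"

definition grad_y_est ::
  "('zeta \<Rightarrow> 'a::euclidean_space \<times> 'b::euclidean_space \<Rightarrow> real) \<Rightarrow>
   nat \<Rightarrow> (nat \<Rightarrow> nat \<Rightarrow> 'zeta) \<Rightarrow> 'a \<times> 'b \<Rightarrow> 'b" where
  "grad_y_est G s \<zeta>s z = (1 / real s) *\<^sub>R (\<Sum>i=1..s. grad_y (G (\<zeta>s i 0)) z)"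

(* Each summand of the truncated Neumann series is obtained from the previous one by one
   Hessian-vector product, so the whole series costs Q such products per i. *)
lemma neumann_prod_0: "neumann_prod \<eta> H (Q + 1) Q v = v"
  by (simp add: neumann_prod_def)

lemma neumann_prod_step:
  assumes "r < Q"
  shows "neumann_prod \<eta> H (Q + 1 - Suc r) Q v =
    (let w = neumann_prod \<eta> H (Q + 1 - r) Q v in w - \<eta> *\<^sub>R blinfun_apply (H (Q - r)) w)"
proof -
  have "[Q - r..<Suc Q] = (Q - r) # [Suc Q - r..<Suc Q]"
    using assms by (simp add: upt_conv_Cons Suc_diff_le del: upt_Suc)
  then show ?thesis
    by (simp add: neumann_prod_def Let_def del: upt_Suc)
qed


section \<open>VRBO\<close>

record vrbo_params =
  par_alpha :: real
  par_beta :: real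
  par_eta :: real
  par_Q :: nat
  par_S1 :: nat
  par_S2 :: nat
  par_q :: nat
  par_m :: nat

(* All samples ever drawn. Batch b of outer iteration k is the large batch if b = 0, and the
   batch of inner iteration t if b = Suc t; its samples are xi (k, b, i) and zeta (k, b, i, j). *)
type_synonym ('xi, 'zeta) samples = "(nat \<times> nat \<times> nat \<Rightarrow> 'xi) \<times> (nat \<times> nat \<times> nat \<times> nat \<Rightarrow> 'zeta)"

definition sample_space :: "'xi measure \<Rightarrow> 'zeta measure \<Rightarrow> ('xi, 'zeta) samples measure" where
  "sample_space Dxi Dzeta = (\<Pi>\<^sub>M _\<in>UNIV. Dxi) \<Otimes>\<^sub>M (\<Pi>\<^sub>M _\<in>UNIV. Dzeta)"

definition batch_hypergrad ::
  "vrbo_params \<Rightarrow> ('xi \<Rightarrow> 'a::euclidean_space \<times> 'b::euclidean_space \<Rightarrow> real) \<Rightarrow>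
   ('zeta \<Rightarrow> 'a \<times> 'b \<Rightarrow> real) \<Rightarrow> ('xi, 'zeta) samples \<Rightarrow> nat \<Rightarrow> nat \<Rightarrow> nat \<Rightarrow> 'a \<times> 'b \<Rightarrow> 'a" where
  "batch_hypergrad p F G \<omega> k b s =
     hypergrad_est F G (par_eta p) (par_Q p) s (\<lambda>i. fst \<omega> (k, b, i)) (\<lambda>i j. snd \<omega> (k, b, i, j))"

definition batch_grad_y ::
  "('zeta \<Rightarrow> 'a::euclidean_space \<times> 'b::euclidean_space \<Rightarrow> real) \<Rightarrow> ('xi, 'zeta) samples \<Rightarrow>
   nat \<Rightarrow> nat \<Rightarrow> nat \<Rightarrow> 'a \<times> 'b \<Rightarrow> 'b" where
  "batch_grad_y G \<omega> k b s = grad_y_est G s (\<lambda>i j. snd \<omega> (k, b, i, j))"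

(* State before inner iteration t: the points with inner indices t-1 and t, and the estimators
   with inner index t-1. *)
record ('a, 'b) inner_state =
  z_prev :: "'a \<times> 'b"
  z_cur :: "'a \<times> 'b"
  u_in :: 'b
  v_in :: 'a

definition inner_step ::
  "vrbo_params \<Rightarrow> ('xi \<Rightarrow> 'a::euclidean_space \<times> 'b::euclidean_space \<Rightarrow> real) \<Rightarrow>
   ('zeta \<Rightarrow> 'a \<times> 'b \<Rightarrow> real) \<Rightarrow> ('xi, 'zeta) samples \<Rightarrow> nat \<Rightarrow> nat \<Rightarrow>
   ('a, 'b) inner_state \<Rightarrow> ('a, 'b) inner_state" where
  "inner_step p F G \<omega> k t st =
    (let v' = v_in st + batch_hypergrad p F G \<omega> k (Suc t) (par_S2 p) (z_cur st)
                      - batch_hypergrad p F G \<omega> k (Suc t) (par_S2 p) (z_prev st);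
         u' = u_in st + batch_grad_y G \<omega> k (Suc t) (par_S2 p) (z_cur st)
                      - batch_grad_y G \<omega> k (Suc t) (par_S2 p) (z_prev st)
     in \<lparr> z_prev = z_cur st,
          z_cur = (fst (z_cur st), snd (z_cur st) - par_beta p *\<^sub>R u'),
          u_in = u', v_in = v' \<rparr>)"

primrec inner_loop ::
  "vrbo_params \<Rightarrow> ('xi \<Rightarrow> 'a::euclidean_space \<times> 'b::euclidean_space \<Rightarrow> real) \<Rightarrow>
   ('zeta \<Rightarrow> 'a \<times> 'b \<Rightarrow> real) \<Rightarrow> ('xi, 'zeta) samples \<Rightarrow> nat \<Rightarrow>
   ('a, 'b) inner_state \<Rightarrow> nat \<Rightarrow> ('a, 'b) inner_state" where
  "inner_loop p F G \<omega> k st 0 = st"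
| "inner_loop p F G \<omega> k st (Suc t) = inner_step p F G \<omega> k t (inner_loop p F G \<omega> k st t)"

(* State before outer iteration k: the point (x_k, y_k) and the estimators u, v left over from the
   last inner iteration m+1 of outer iteration k-1. *)
record ('a, 'b) outer_state =
  z_out :: "'a \<times> 'b"
  u_out :: 'b
  v_out :: 'a

definition outer_step ::
  "vrbo_params \<Rightarrow> ('xi \<Rightarrow> 'a::euclidean_space \<times> 'b::euclidean_space \<Rightarrow> real) \<Rightarrow>
   ('zeta \<Rightarrow> 'a \<times> 'b \<Rightarrow> real) \<Rightarrow> ('xi, 'zeta) samples \<Rightarrow> nat \<Rightarrow>
   ('a, 'b) outer_state \<Rightarrow> ('a, 'b) outer_state" where
  "outer_step p F G \<omega> k st =
    (let z = z_out st;
         u = (if k mod par_q p = 0 then batch_grad_y G \<omega> k 0 (par_S1 p) z else u_out st);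
         v = (if k mod par_q p = 0 then batch_hypergrad p F G \<omega> k 0 (par_S1 p) z else v_out st);
         fin = inner_loop p F G \<omega> k
           \<lparr> z_prev = z, z_cur = (fst z - par_alpha p *\<^sub>R v, snd z), u_in = u, v_in = v \<rparr>
           (par_m p + 2)
     in \<lparr> z_out = z_prev fin, u_out = u_in fin, v_out = v_in fin \<rparr>)"

(* The initial values of u and v are irrelevant, since iteration 0 draws a large batch. *)
primrec vrbo ::
  "vrbo_params \<Rightarrow> ('xi \<Rightarrow> 'a::euclidean_space \<times> 'b::euclidean_space \<Rightarrow> real) \<Rightarrow>
   ('zeta \<Rightarrow> 'a \<times> 'b \<Rightarrow> real) \<Rightarrow> 'a \<times> 'b \<Rightarrow> ('xi, 'zeta) samples \<Rightarrow> nat \<Rightarrow>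
   ('a, 'b) outer_state" where
  "vrbo p F G z0 \<omega> 0 = \<lparr> z_out = z0, u_out = 0, v_out = 0 \<rparr>"
| "vrbo p F G z0 \<omega> (Suc k) = outer_step p F G \<omega> k (vrbo p F G z0 \<omega> k)"

(* The output is x_k for an index k uniform on 0..K and independent of the samples. *)
definition output_space ::
  "'xi measure \<Rightarrow> 'zeta measure \<Rightarrow> nat \<Rightarrow> (('xi, 'zeta) samples \<times> nat) measure" where
  "output_space Dxi Dzeta K = sample_space Dxi Dzeta \<Otimes>\<^sub>M uniform_count_measure {0..K}"

definition vrbo_output ::
  "vrbo_params \<Rightarrow> ('xi \<Rightarrow> 'a::euclidean_space \<times> 'b::euclidean_space \<Rightarrow> real) \<Rightarrow>
   ('zeta \<Rightarrow> 'a \<times> 'b \<Rightarrow> real) \<Rightarrow> 'a \<times> 'b \<Rightarrow> ('xi, 'zeta) samples \<times> nat \<Rightarrow> 'a" where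
  "vrbo_output p F G z0 w = fst (z_out (vrbo p F G z0 (fst w) (snd w)))"


section \<open>Complexity\<close>

(* For a batch of size s, hypergrad_est uses the 2 s partial gradients grad_x F, grad_y F (counted
   separately), and grad_y_est uses s gradients of G. Every inner iteration evaluates both at two
   points. *)
definition gradient_complexity :: "vrbo_params \<Rightarrow> nat \<Rightarrow> nat" where
  "gradient_complexity p K = (\<Sum>k=0..K.
     (if k mod par_q p = 0 then 2 * par_S1 p + par_S1 p else 0) +
     (\<Sum>t=0..par_m p + 1. 2 * (2 * par_S2 p + par_S2 p)))"

(* Only products with hess_yy are counted; products with hess_xy are not. *)
definition hessian_vector_complexity :: "vrbo_params \<Rightarrow> nat \<Rightarrow> nat" where
  "hessian_vector_complexity p K = (\<Sum>k=0..K.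
     (if k mod par_q p = 0 then par_Q p * par_S1 p else 0) +
     (\<Sum>t=0..par_m p + 1. 2 * (par_Q p * par_S2 p)))"

definition soft_O :: "(real \<Rightarrow> real) \<Rightarrow> (real \<Rightarrow> real) set" where
  "soft_O h = (\<Union>n::nat. O[at_right 0](\<lambda>\<epsilon>. h \<epsilon> * ln (1 / \<epsilon>) ^ n))"


section \<open>Constants\<close>

definition L_Phi :: "real \<Rightarrow> real \<Rightarrow> real \<Rightarrow> real \<Rightarrow> real \<Rightarrow> real" where
  "L_Phi \<mu> M L \<tau> \<rho> = L + (2 * L\<^sup>2 + \<tau> * M\<^sup>2) / \<mu> + (\<rho> * L * M + L ^ 3 + \<tau> * M * L) / \<mu>\<^sup>2
     + \<rho> * L\<^sup>2 * M / \<mu> ^ 3"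

(* L_Q depends on the truncation depth Q: with \<eta> fixed and Q of order ln (1 / \<epsilon>), L_Q is of
   polylogarithmic order in 1 / \<epsilon>, and so is the inverse of a stepsize 1 / (20 * L_Q ^ 3). *)
definition L_Q :: "real \<Rightarrow> real \<Rightarrow> real \<Rightarrow> real \<Rightarrow> real \<Rightarrow> nat \<Rightarrow> real" where
  "L_Q M L \<tau> \<rho> \<eta> Q = sqrt (2 * L\<^sup>2 + 4 * \<tau>\<^sup>2 * \<eta>\<^sup>2 * M\<^sup>2 * (real Q + 1)\<^sup>2
     + 8 * L ^ 4 * \<eta>\<^sup>2 * (real Q + 1)\<^sup>2
     + 2 * L\<^sup>2 * \<eta> ^ 4 * M\<^sup>2 * \<rho>\<^sup>2 * (real Q)\<^sup>2 * (real Q + 1)\<^sup>2)"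

end

theory Submission
  imports Defs "HOL-Real_Asymp.Real_Asymp"
begin

text \<open>Taking \<open>Q = Q\<^sub>0 + O(log (1/\<epsilon>))\<close> with a large constant \<open>Q\<^sub>0\<close> makes \<open>L\<^sub>Q\<close>, and with it
  \<open>1/\<alpha>\<close> and \<open>1/\<beta>\<close>, larger than any constant of the problem, whereas the actual Lipschitz constant of the
  hypergradient estimator stays bounded in \<open>Q\<close>, because the factors of the Neumann series contract.

  Along every sample path the map \<open>y \<mapsto> y - \<beta> \<nabla>\<^sub>yG\<close> is a contraction, so each inner step shrinks the squared
  norm of the recursive gradient \<open>u\<close> by \<open>1 - \<beta>\<mu>\<close>; since \<open>\<beta>\<mu>(m + 1) \<ge> 16\<close>, one inner loop makes it
  negligible. In expectation, the errors of \<open>u\<close> and \<open>v\<close> grow per inner step by at most a constant times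
  \<open>1/S\<^sub>2\<close> times the squared movement of the iterate: the fresh batch is independent of the past, which is used
  in the form that resampling its coordinates preserves the law of all samples. Summed over an epoch, the growth
  is a multiple \<open>q/S\<^sub>2 = O(\<beta>)\<close> of the movement. All of this is absorbed in the descent inequality for \<open>\<Phi>\<close>,
  which leaves errors of order \<open>1/(\<alpha>K)\<close>, \<open>1/S\<^sub>1\<close> and the squared bias of the truncated Neumann series.\<close>

section \<open>Gradients of smooth and strongly convex functions\<close>

text \<open>The estimates form a circle: the gap between \<open>v\<close> and the gradient of
  \<open>Phi\<close> depends on \<open>u\<close> through the distance of y to \<open>ystar\<close>;
  the size of \<open>u\<close> after a refresh depends on its accumulated error; that error depends
  on the movement of the iterates; the movement depends on \<open>u\<close> and \<open>v\<close>.
  Summed over the run, the circle closes because \<beta> and \<alpha> are small: the squares of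
  \<open>u\<close> reappear with a factor at most 1/2 and move to the left side, and the remaining
  squares of \<open>v\<close> are paid by the negative term in |v|^2 of the descent inequality. Two
  regularity facts come first. The Neumann factors contract by 1 - \<eta>\<mu> only because the
  Hessian in y is symmetric, which is derived from its Lipschitz continuity. The gradient of
  \<open>Phi\<close> is obtained from a quadratic Taylor remainder, so \<open>ystar\<close> is used
  only as a Lipschitz map and is never differentiated. The price of a growing \<open>L_Q\<close> is
  that 1/\<alpha>, and with it the number of iterations, gains powers of log (1/\<epsilon>), which
  the soft-O notation hides.\<close>

lemma gradient_eqI:
  fixes h :: "'c::euclidean_space \<Rightarrow> real"
  assumes "(h has_derivative (\<lambda>a. a \<bullet> D)) (at z)"
  shows "gradient h z = D"
  unfolding gradient_def
proof (rule the_equality)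
  show "GDERIV h z :> D" using assms by (simp add: gderiv_def)
next
  fix E assume "GDERIV h z :> E"
  then have "(\<lambda>a. a \<bullet> E) = (\<lambda>a. a \<bullet> D)"
    using has_derivative_unique[OF _ assms] by (simp add: gderiv_def)
  then show "E = D"
    by (metis inner_commute vector_eq_rdot)
qed

lemma has_derivative_gradient:
  fixes h :: "'c::euclidean_space \<Rightarrow> real"
  assumes "h differentiable (at z)"
  shows "(h has_derivative (\<lambda>a. a \<bullet> gradient h z)) (at z)"
proof -
  obtain D where D: "(h has_derivative D) (at z)"
    using assms by (auto simp: differentiable_def)
  have lin: "linear D" using D by (simp add: has_derivative_linear)
  have eq: "D = (\<lambda>a. a \<bullet> adjoint D 1)"
    using adjoint_works[OF lin, of _ 1] by auto
  have "(h has_derivative (\<lambda>a. a \<bullet> adjoint D 1)) (at z)"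
    by (rule has_derivative_eq_rhs[OF D eq])
  with gradient_eqI[OF this] show ?thesis by simp
qed

text \<open>The derivative is taken along the sequence 1/(n+1), so it is a pointwise limit of
  countably many difference quotients. This form transfers both inequalities and measurability in
  the sample to derivatives.\<close>

lemma directional_limit:
  fixes f :: "'c::real_normed_vector \<Rightarrow> 'd::real_normed_vector"
  assumes D: "(f has_derivative D) (at z)"
  shows "(\<lambda>n. real (Suc n) *\<^sub>R (f (z + (1 / real (Suc n)) *\<^sub>R a) - f z)) \<longlonglongrightarrow> D a"
proof -
  have l: "linear D" using D has_derivative_linear by blast
  let ?t = "\<lambda>n. 1 / real (Suc n)" and ?h = "\<lambda>n. (1 / real (Suc n)) *\<^sub>R a"
  show ?thesis
  proof (cases "a = 0")
    case True
    then show ?thesis using linear_0[OF l] by simp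
  next
    case False
    have t0: "?t \<longlonglongrightarrow> 0" by (rule LIMSEQ_Suc[OF lim_1_over_n])
    have "?h \<longlonglongrightarrow> 0 *\<^sub>R a" by (intro tendsto_intros t0)
    then have "filterlim ?h (at 0) sequentially"
      using False by (simp add: filterlim_at)
    moreover have "((\<lambda>h. norm (f (z + h) - f z - D h) / norm h) \<longlongrightarrow> 0) (at 0)"
      using D by (simp add: has_derivative_at)
    ultimately have "(\<lambda>n. norm (f (z + ?h n) - f z - D (?h n)) / norm (?h n)) \<longlonglongrightarrow> 0"
      by (rule filterlim_compose[rotated])
    from tendsto_mult_right[OF this, of "norm a"]
    have lim: "(\<lambda>n. norm a * (norm (f (z + ?h n) - f z - D (?h n)) / norm (?h n))) \<longlonglongrightarrow> 0"
      by (simp add: mult.commute)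
    have "norm (real (Suc n) *\<^sub>R (f (z + ?h n) - f z) - D a)
        = norm a * (norm (f (z + ?h n) - f z - D (?h n)) / norm (?h n))" for n
    proof -
      have "real (Suc n) *\<^sub>R (f (z + ?h n) - f z) - D a
          = real (Suc n) *\<^sub>R (f (z + ?h n) - f z - D (?h n))"
        by (simp add: linear_cmul[OF l] scaleR_diff_right del: of_nat_Suc)
      then have "norm (real (Suc n) *\<^sub>R (f (z + ?h n) - f z) - D a)
          = real (Suc n) * norm (f (z + ?h n) - f z - D (?h n))"
        by (simp del: of_nat_Suc)
      then show ?thesis using False by (simp del: of_nat_Suc)
    qed
    then have "(\<lambda>n. norm (real (Suc n) *\<^sub>R (f (z + ?h n) - f z) - D a)) \<longlonglongrightarrow> 0"
      using lim by simp
    then show ?thesis by (simp add: tendsto_norm_zero_iff LIM_zero_iff)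
  qed
qed

lemma lipschitz_derivative_bound:
  fixes f :: "'c::real_normed_vector \<Rightarrow> 'd::real_normed_vector"
  assumes D: "(f has_derivative D) (at z)" and L: "C-lipschitz_on UNIV f"
  shows "norm (D a) \<le> C * norm a"
proof (rule Lim_bounded[OF tendsto_norm[OF directional_limit[OF D, of a]], where M = 0])
  show "\<forall>n\<ge>0. norm (real (Suc n) *\<^sub>R (f (z + (1 / real (Suc n)) *\<^sub>R a) - f z)) \<le> C * norm a"
  proof (intro allI impI)
    fix n
    have "norm (f (z + (1 / real (Suc n)) *\<^sub>R a) - f z) \<le> C * norm ((1 / real (Suc n)) *\<^sub>R a)"
      using lipschitz_onD[OF L, of "z + (1 / real (Suc n)) *\<^sub>R a" z] by (simp add: dist_norm)
    then show "norm (real (Suc n) *\<^sub>R (f (z + (1 / real (Suc n)) *\<^sub>R a) - f z)) \<le> C * norm a"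
      unfolding norm_scaleR by (simp add: field_simps)
  qed
qed

text \<open>The linearized mean value inequality on the ball of radius \<open>norm a\<close>
  suffices here. It gives \<open>C\<close> where an integral remainder would give
  \<open>C / 2\<close>; the lost factor stays in all later Taylor bounds.\<close>

lemma taylor_lipschitz:
  fixes f :: "'c::real_normed_vector \<Rightarrow> 'd::real_normed_vector"
  assumes D: "\<And>z. (f has_derivative f' z) (at z)"
    and L: "\<And>z z' a. norm (f' z a - f' z' a) \<le> C * norm (z - z') * norm a" and C: "0 \<le> C"
  shows "norm (f (z + a) - f z - f' z a) \<le> C * (norm a)\<^sup>2"
proof -
  have "norm (f (z + a) - f z - f' z ((z + a) - z)) \<le> norm ((z + a) - z) * (C * norm a)"
  proof (rule differentiable_bound_linearization[where S = "cball z (norm a)"])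
    fix t :: real assume "t \<in> {0..1}"
    then show "z + t *\<^sub>R (z + a - z) \<in> cball z (norm a)"
      by (simp add: dist_norm mult_left_le_one_le)
  next
    fix x assume x: "x \<in> cball z (norm a)"
    show "(f has_derivative f' x) (at x within cball z (norm a))"
      using D has_derivative_at_withinI by blast
    show "onorm (f' x - f' z) \<le> C * norm a"
    proof (rule onorm_bound)
      fix b
      have "norm (f' x b - f' z b) \<le> C * norm (x - z) * norm b" by (rule L)
      also have "\<dots> \<le> C * norm a * norm b"
        using x C by (intro mult_right_mono mult_left_mono) (auto simp: dist_norm norm_minus_commute)
      finally show "norm ((f' x - f' z) b) \<le> C * norm a * norm b" by simp
    qed (use C in auto)
  qed auto
  then show ?thesis by (simp add: power2_eq_square mult_ac)
qed

text \<open>A quadratic remainder is more than differentiability requires, but it survives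
  integration over the samples and composition with the merely Lipschitz map
  \<open>ystar\<close>.\<close>

lemma has_derivative_quadratic_boundI:
  fixes f :: "'c::real_normed_vector \<Rightarrow> 'd::real_normed_vector"
  assumes "bounded_linear D" and B: "\<And>a. norm (f (z + a) - f z - D a) \<le> C * (norm a)\<^sup>2"
  shows "(f has_derivative D) (at z)"
  unfolding has_derivative_at
proof (intro conjI assms(1))
  have "((\<lambda>a. C * norm a) \<longlongrightarrow> 0) (at 0)"
    by (auto intro!: tendsto_eq_intros)
  then show "(\<lambda>h. norm (f (z + h) - f z - D h) / norm h) \<midarrow>0\<rightarrow> 0"
  proof (rule Lim_null_comparison[rotated])
    show "\<forall>\<^sub>F a in at 0. norm (norm (f (z + a) - f z - D a) / norm a) \<le> C * norm a"
      using B by (auto simp: eventually_at_filter divide_simps power2_eq_square mult_ac intro!: always_eventually)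
  qed
qed

text \<open>Convexity along the segment from \<open>y\<close> to \<open>y'\<close>, divided by the
  parameter t = 1/(n+1): in the limit the quotient becomes the directional derivative and the
  modulus term loses its factor 1 - t.\<close>

lemma strongly_convex_gradient:
  fixes h :: "'c::euclidean_space \<Rightarrow> real"
  assumes sc: "strongly_convex \<mu> h" and D: "h differentiable (at y)"
  shows "h y + (y' - y) \<bullet> gradient h y + \<mu> / 2 * (norm (y' - y))\<^sup>2 \<le> h y'"
proof -
  let ?q = "\<mu> / 2 * (norm (y' - y))\<^sup>2"
  let ?t = "\<lambda>n. 1 / real (Suc n)"
  have lim: "(\<lambda>n. real (Suc n) *\<^sub>R (h (y + ?t n *\<^sub>R (y' - y)) - h y)) \<longlonglongrightarrow> (y' - y) \<bullet> gradient h y"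
    by (rule directional_limit[OF has_derivative_gradient[OF D]])
  have lim2: "(\<lambda>n. h y' - h y - (1 - ?t n) * ?q) \<longlonglongrightarrow> h y' - h y - (1 - 0) * ?q"
    by (intro tendsto_intros LIMSEQ_Suc[OF lim_1_over_n])
  have le: "real (Suc n) *\<^sub>R (h (y + ?t n *\<^sub>R (y' - y)) - h y) \<le> h y' - h y - (1 - ?t n) * ?q" for n
  proof -
    have eq: "y + ?t n *\<^sub>R (y' - y) = ?t n *\<^sub>R y' + (1 - ?t n) *\<^sub>R y"
      by (simp add: algebra_simps)
    have "h (y + ?t n *\<^sub>R (y' - y)) \<le> ?t n * h y' + (1 - ?t n) * h y - ?t n * ((1 - ?t n) * ?q)"
      unfolding eq using sc[unfolded strongly_convex_def, rule_format, of "?t n" y' y]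
      by (simp add: mult_ac)
    then have "h (y + ?t n *\<^sub>R (y' - y)) - h y \<le> ?t n * (h y' - h y - (1 - ?t n) * ?q)"
      by (simp add: algebra_simps)
    then have "real (Suc n) * (h (y + ?t n *\<^sub>R (y' - y)) - h y)
        \<le> real (Suc n) * (?t n * (h y' - h y - (1 - ?t n) * ?q))"
      by (intro mult_left_mono) auto
    then show ?thesis by simp
  qed
  have "(y' - y) \<bullet> gradient h y \<le> h y' - h y - (1 - 0) * ?q"
    by (rule LIMSEQ_le[OF lim lim2]) (use le in auto)
  then show ?thesis by simp
qed

lemma strongly_convex_monotone:
  fixes h :: "'c::euclidean_space \<Rightarrow> real"
  assumes sc: "strongly_convex \<mu> h" and D: "\<And>y. h differentiable (at y)"
  shows "\<mu> * (norm (y - y'))\<^sup>2 \<le> (gradient h y - gradient h y') \<bullet> (y - y')"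
proof -
  have "(y' - y) \<bullet> gradient h y = - (gradient h y \<bullet> (y - y'))"
    by (simp add: inner_diff_right inner_diff_left inner_commute[of _ "gradient h y"])
  moreover have "(y - y') \<bullet> gradient h y' = gradient h y' \<bullet> (y - y')" by (rule inner_commute)
  ultimately show ?thesis
    using strongly_convex_gradient[OF sc D, of y' y] strongly_convex_gradient[OF sc D, of y y']
    unfolding norm_minus_commute[of y' y] inner_diff_left[of "gradient h y"] by linarith
qed

text \<open>Here \<open>a\<close> stands for a difference of two points and \<open>b\<close> for the
  difference of the gradients there. Expanding the square gives the gain 2\<beta>\<mu>, and
  \<beta>L^2 \<le> \<mu> lets the term \<beta>^2 |b|^2 consume at most half of it.\<close>

lemma gradient_step_contraction:
  fixes a b :: "'c::real_inner"
  assumes mono: "\<mu> * (norm a)\<^sup>2 \<le> b \<bullet> a" and lip: "norm b \<le> L * norm a"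
    and \<beta>: "0 \<le> \<beta>" "\<beta> * L\<^sup>2 \<le> \<mu>"
  shows "(norm (a - \<beta> *\<^sub>R b))\<^sup>2 \<le> (1 - \<beta> * \<mu>) * (norm a)\<^sup>2"
proof -
  have "(norm b)\<^sup>2 \<le> (L * norm a)\<^sup>2" by (rule power_mono[OF lip]) simp
  then have "\<beta>\<^sup>2 * (norm b)\<^sup>2 \<le> \<beta> * (\<beta> * L\<^sup>2) * (norm a)\<^sup>2"
    using mult_left_mono[of "(norm b)\<^sup>2" "(L * norm a)\<^sup>2" "\<beta>\<^sup>2"]
    by (simp add: power2_eq_square mult_ac)
  also have "\<dots> \<le> \<beta> * \<mu> * (norm a)\<^sup>2"
    using \<beta> by (intro mult_right_mono mult_left_mono) auto
  finally have "\<beta>\<^sup>2 * (norm b)\<^sup>2 \<le> \<beta> * \<mu> * (norm a)\<^sup>2" .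
  moreover have "(norm (a - \<beta> *\<^sub>R b))\<^sup>2 = (norm a)\<^sup>2 - 2 * \<beta> * (b \<bullet> a) + \<beta>\<^sup>2 * (norm b)\<^sup>2"
    unfolding power2_norm_eq_inner
    by (simp add: inner_diff_left inner_diff_right inner_commute power2_eq_square algebra_simps)
  moreover have "\<beta> * (\<mu> * (norm a)\<^sup>2) \<le> \<beta> * (b \<bullet> a)"
    using mono \<beta> by (intro mult_left_mono) auto
  ultimately show ?thesis by (simp add: algebra_simps)
qed

text \<open>The second difference of \<open>h\<close> in the directions \<open>a\<close> and
  \<open>b\<close> agrees with \<open>H a \<bullet> b\<close> up to third order.\<close>
lemma hessian_symmetric:
  fixes h :: "'c::euclidean_space \<Rightarrow> real"
  assumes D: "\<And>y. (h has_derivative (\<lambda>a. a \<bullet> g y)) (at y)"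
    and D2: "\<And>y. (g has_derivative H y) (at y)"
    and L: "\<And>y y' a. norm (H y a - H y' a) \<le> C * norm (y - y') * norm a" and C: "0 \<le> C"
  shows "H y a \<bullet> b = a \<bullet> H y b"
proof -
  define \<Delta> where "\<Delta> a b = h (y + a + b) - h (y + a) - h (y + b) + h y" for a b
  have bound: "\<bar>\<Delta> a b - H y a \<bullet> b\<bar> \<le> C * ((norm a)\<^sup>2 * norm b + norm a * (norm b)\<^sup>2)" for a b
  proof -
    \<comment> \<open>\<open>?\<phi> 1 - ?\<phi> 0\<close> is the second difference minus the
      bilinear form. Its derivative compares one increment of \<open>g\<close> in direction
      \<open>a\<close> with \<open>H y a\<close>, which is Taylor's bound plus the Lipschitz bound
      on \<open>H\<close>.\<close>
    let ?\<phi> = "\<lambda>t. h (y + a + t *\<^sub>R b) - h (y + t *\<^sub>R b) - t * (H y a \<bullet> b)"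
    have der: "(?\<phi> has_derivative (\<lambda>s. s * ((g (y + a + t *\<^sub>R b) - g (y + t *\<^sub>R b) - H y a) \<bullet> b))) (at t within {0..1})" for t
      by (rule derivative_eq_intros has_derivative_compose[OF _ D] | simp add: algebra_simps inner_diff_left inner_commute)+
    have "norm (?\<phi> 1 - ?\<phi> 0) \<le> (C * ((norm a)\<^sup>2 * norm b + norm a * (norm b)\<^sup>2)) * norm (1 - 0 :: real)"
    proof (rule differentiable_bound[OF _ der])
      fix t :: real assume t: "t \<in> {0..1}"
      have t1: "norm (g (y + t *\<^sub>R b + a) - g (y + t *\<^sub>R b) - H (y + t *\<^sub>R b) a) \<le> C * (norm a)\<^sup>2"
        by (rule taylor_lipschitz[OF D2 L C])
      have "norm (H (y + t *\<^sub>R b) a - H y a) \<le> C * norm (t *\<^sub>R b) * norm a"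
        using L[of "y + t *\<^sub>R b" a y] by simp
      also have "\<dots> \<le> C * norm b * norm a"
        using t C by (intro mult_right_mono mult_left_mono) (auto simp: mult_left_le_one_le)
      finally have t2: "norm (H (y + t *\<^sub>R b) a - H y a) \<le> C * norm b * norm a" .
      have "norm (g (y + a + t *\<^sub>R b) - g (y + t *\<^sub>R b) - H y a) \<le> C * (norm a)\<^sup>2 + C * norm b * norm a"
        using norm_triangle_mono[OF t1 t2] by (simp add: algebra_simps)
      then have "\<bar>(g (y + a + t *\<^sub>R b) - g (y + t *\<^sub>R b) - H y a) \<bullet> b\<bar>
          \<le> (C * (norm a)\<^sup>2 + C * norm b * norm a) * norm b" (is "\<bar>?X\<bar> \<le> _")
        by (meson Cauchy_Schwarz_ineq2 mult_right_mono norm_ge_zero order_trans)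
      also have "\<dots> = C * ((norm a)\<^sup>2 * norm b + norm a * (norm b)\<^sup>2)"
        by (simp add: power2_eq_square algebra_simps)
      finally have X: "\<bar>?X\<bar> \<le> C * ((norm a)\<^sup>2 * norm b + norm a * (norm b)\<^sup>2)" .
      show "onorm (\<lambda>s. s * ?X) \<le> C * ((norm a)\<^sup>2 * norm b + norm a * (norm b)\<^sup>2)"
      proof (rule onorm_bound)
        show "norm (s * ?X) \<le> C * ((norm a)\<^sup>2 * norm b + norm a * (norm b)\<^sup>2) * norm s" for s
          using mult_left_mono[OF X abs_ge_zero[of s]]
          by (simp only: real_norm_def abs_mult mult.commute[of _ "\<bar>s\<bar>"])
      qed (use C in auto)
    qed auto
    then show ?thesis by (simp add: \<Delta>_def algebra_simps)
  qed
  have sym: "\<bar>H y a \<bullet> b - H y b \<bullet> a\<bar> \<le> 2 * (C * ((norm a)\<^sup>2 * norm b + norm a * (norm b)\<^sup>2))" for a b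
  proof -
    have "\<Delta> b a = \<Delta> a b" by (simp add: \<Delta>_def algebra_simps)
    then show ?thesis using bound[of a b] bound[of b a] unfolding abs_le_iff by (simp add: mult.commute[of "norm b"] mult.commute[of "norm a"] add.commute)
  qed
  have lin: "linear (H y)" by (rule has_derivative_linear[OF D2])
  \<comment> \<open>Scaling both directions by s multiplies the asymmetry \<open>?c\<close> by s^2
    but its bound by s^3, so s = 1/(n+1) tending to 0 forces \<open>?c\<close> to vanish.\<close>
  let ?c = "\<bar>H y a \<bullet> b - H y b \<bullet> a\<bar>" and ?B = "2 * (C * ((norm a)\<^sup>2 * norm b + norm a * (norm b)\<^sup>2))"
  have "?c * real (Suc n) \<le> ?B" for n
  proof -
    define s where "s = 1 / real (Suc n)"
    have s: "0 < s" by (simp add: s_def)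
    have "s\<^sup>2 * ?c = \<bar>H y (s *\<^sub>R a) \<bullet> (s *\<^sub>R b) - H y (s *\<^sub>R b) \<bullet> (s *\<^sub>R a)\<bar>"
    proof -
      have e: "\<bar>s * (s * P) - s * (s * R)\<bar> = s\<^sup>2 * \<bar>P - R\<bar>" for P R :: real
        by (metis abs_mult abs_power2 mult.assoc power2_eq_square right_diff_distrib)
      show ?thesis by (simp add: linear_cmul[OF lin] e)
    qed
    also have "\<dots> \<le> 2 * (C * ((norm (s *\<^sub>R a))\<^sup>2 * norm (s *\<^sub>R b) + norm (s *\<^sub>R a) * (norm (s *\<^sub>R b))\<^sup>2))"
      by (rule sym)
    also have "\<dots> = s\<^sup>2 * (s * ?B)"
      using s by (simp add: power2_eq_square algebra_simps)
    finally have "?c \<le> s * ?B"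
      using s by (metis mult_le_cancel_left_pos zero_less_power)
    then have "?c * real (Suc n) \<le> s * ?B * real (Suc n)" by (rule mult_right_mono) simp
    also have "\<dots> = ?B" by (simp add: s_def)
    finally show ?thesis .
  qed
  note scaled = this
  have "?c \<le> 0"
  proof (rule ccontr)
    assume "\<not> ?c \<le> 0"
    then obtain n where "?B < real n * ?c"
      using reals_Archimedean3[of ?c] by (auto simp: not_le)
    moreover have "real n * ?c \<le> real (Suc n) * ?c" by (intro mult_right_mono) auto
    ultimately show False using scaled[of n] by (simp add: mult.commute)
  qed
  then show ?thesis by (simp add: inner_commute)
qed

text \<open>A Cauchy-Schwarz argument for the quadratic form of \<open>T\<close> in place of a
  spectral decomposition: the polynomial in t given by the form at
  \<open>a - t *\<^sub>R T a\<close> is nonnegative and is evaluated at one suitable t.\<close>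

lemma psd_norm_bound:
  fixes T :: "'c::euclidean_space \<Rightarrow> 'c"
  assumes lin: "linear T" and sym: "\<And>a b. T a \<bullet> b = a \<bullet> T b"
    and nn: "\<And>a. 0 \<le> T a \<bullet> a" and le: "\<And>a. T a \<bullet> a \<le> c * (norm a)\<^sup>2"
  shows "norm (T a) \<le> c * norm a"
proof (cases "T a = 0")
  case True
  have "0 \<le> c * (norm a)\<^sup>2" using nn le order_trans by blast
  then show ?thesis using True by (cases "a = 0") (auto simp: zero_le_mult_iff)
next
  case False
  let ?u = "T a \<bullet> a" and ?w = "T (T a) \<bullet> T a" and ?n = "(norm (T a))\<^sup>2"
  have n: "0 < ?n" using False by simp
  have a: "0 < norm a" using False linear_0[OF lin] by auto
  have c: "0 \<le> c" using nn[of a] le[of a] a by (smt (verit) zero_le_mult_iff zero_le_power2 zero_less_power2)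
  have quad: "0 \<le> ?u - 2 * t * ?n + t\<^sup>2 * ?w" for t
  proof -
    have "T (a - t *\<^sub>R T a) \<bullet> (a - t *\<^sub>R T a) = ?u - 2 * t * ?n + t\<^sup>2 * ?w"
      using sym[of "T a" a] dot_square_norm[of "T a"]
      by (simp add: linear_diff[OF lin] linear_cmul[OF lin] inner_diff_left inner_diff_right
          power2_norm_eq_inner power2_eq_square inner_commute algebra_simps)
    then show ?thesis using nn[of "a - t *\<^sub>R T a"] by simp
  qed
  have w: "?w \<le> c * ?n" using le[of "T a"] by simp
  have cpos: "0 < c"
  proof (rule ccontr)
    assume "\<not> 0 < c"
    then have "c = 0" using c by simp
    then have "?u \<le> 0" "?w \<le> 0" using le[of a] w by auto
    then show False using quad[of 1] n by simp
  qed
  \<comment> \<open>The value t = 1/c minimizes the polynomial once \<open>?w\<close> is replaced by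
    its upper bound \<open>c * ?n\<close>.\<close>
  have "2 * (1 / c) * ?n - (1 / c)\<^sup>2 * ?w \<le> ?u" using quad[of "1 / c"] by linarith
  moreover have "(1 / c)\<^sup>2 * ?w \<le> (1 / c)\<^sup>2 * (c * ?n)" using w by (intro mult_left_mono) auto
  moreover have "(1 / c)\<^sup>2 * (c * ?n) = 1 / c * ?n" using cpos by (simp add: power2_eq_square)
  ultimately have "1 / c * ?n \<le> ?u" by linarith
  then have "?n \<le> c * ?u" using cpos by (simp add: field_simps)
  also have "\<dots> \<le> c * (c * (norm a)\<^sup>2)" using le c by (intro mult_left_mono) auto
  finally have "?n \<le> (c * norm a)\<^sup>2" by (simp add: power2_eq_square mult_ac)
  then show ?thesis by (rule power2_le_imp_le) (use c in auto)
qed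

section \<open>Sample functions and their expectations\<close>

lemma has_derivative_slice:
  fixes f :: "'a::real_normed_vector \<times> 'b::real_normed_vector \<Rightarrow> 'c::real_normed_vector"
  assumes "(f has_derivative D) (at (x, y))"
  shows "((\<lambda>x. f (x, y)) has_derivative (\<lambda>a. D (a, 0))) (at x)"
    and "((\<lambda>y. f (x, y)) has_derivative (\<lambda>b. D (0, b))) (at y)"
  using has_derivative_compose[OF has_derivative_Pair[OF has_derivative_ident has_derivative_const] assms]
    has_derivative_compose[OF has_derivative_Pair[OF has_derivative_const has_derivative_ident] assms]
  by auto

lemma borel_measurable_fst_snd:
  "fst \<in> borel_measurable (borel :: ('a::topological_space \<times> 'b::topological_space) measure)"
  "snd \<in> borel_measurable (borel :: ('a::topological_space \<times> 'b::topological_space) measure)"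
  by (intro borel_measurable_continuous_onI continuous_intros)+

lemma grad_x_eq_fst_gradient:
  fixes h :: "'a::euclidean_space \<times> 'b::euclidean_space \<Rightarrow> real"
  assumes "h differentiable (at z)"
  shows "grad_x h z = fst (gradient h z)"
  unfolding grad_x_def
proof (rule gradient_eqI)
  have h: "(h has_derivative (\<lambda>a. a \<bullet> gradient h z)) (at (fst z, snd z))"
    using has_derivative_gradient[OF assms] by simp
  have "((\<lambda>x. h (x, snd z)) has_derivative (\<lambda>a. (a, 0) \<bullet> gradient h z)) (at (fst z))"
    by (rule has_derivative_slice(1)[OF h])
  then show "((\<lambda>x. h (x, snd z)) has_derivative (\<lambda>a. a \<bullet> fst (gradient h z))) (at (fst z))"
    by (simp add: inner_prod_def)
qed

lemma grad_y_eq_snd_gradient: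
  fixes h :: "'a::euclidean_space \<times> 'b::euclidean_space \<Rightarrow> real"
  assumes "h differentiable (at z)"
  shows "grad_y h z = snd (gradient h z)"
  unfolding grad_y_def
proof (rule gradient_eqI)
  have h: "(h has_derivative (\<lambda>a. a \<bullet> gradient h z)) (at (fst z, snd z))"
    using has_derivative_gradient[OF assms] by simp
  have "((\<lambda>y. h (fst z, y)) has_derivative (\<lambda>a. (0, a) \<bullet> gradient h z)) (at (snd z))"
    by (rule has_derivative_slice(2)[OF h])
  then show "((\<lambda>y. h (fst z, y)) has_derivative (\<lambda>a. a \<bullet> snd (gradient h z))) (at (snd z))"
    by (simp add: inner_prod_def)
qed

text \<open>The full derivative of \<open>grad_y h\<close>, assembled from the two Hessian blocks.
  The adjoint appears because \<open>hess_xy\<close> maps the y-space to the x-space.\<close>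

definition grad_y_deriv ::
  "('a::euclidean_space \<times> 'b::euclidean_space \<Rightarrow> real) \<Rightarrow> 'a \<times> 'b \<Rightarrow> 'a \<times> 'b \<Rightarrow> 'b" where
  "grad_y_deriv h z c = adjoint (blinfun_apply (hess_xy h z)) (fst c) + blinfun_apply (hess_yy h z) (snd c)"

lemma grad_y_deriv_inner:
  "grad_y_deriv h z c \<bullet> w = fst c \<bullet> blinfun_apply (hess_xy h z) w + blinfun_apply (hess_yy h z) (snd c) \<bullet> w"
  by (simp add: grad_y_deriv_def inner_add_left adjoint_clauses blinfun.bounded_linear_right bounded_linear.linear)

text \<open>The Hessian blocks are total functions made from \<open>frechet_derivative\<close> and
  \<open>Blinfun\<close>. Where \<open>gradient h\<close> is differentiable they are restrictions of
  one genuine derivative to the coordinate subspaces, and linearity puts them together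
  again.\<close>

lemma grad_y_has_derivative:
  fixes h :: "'a::euclidean_space \<times> 'b::euclidean_space \<Rightarrow> real"
  assumes D: "\<And>z. h differentiable (at z)" and D2: "gradient h differentiable (at z)"
  shows "(grad_y h has_derivative grad_y_deriv h z) (at z)"
proof -
  let ?D = "frechet_derivative (gradient h) (at z)"
  have d: "(gradient h has_derivative ?D) (at z)"
    using D2 frechet_derivative_works by blast
  have eq: "grad_y h = (\<lambda>z. snd (gradient h z))"
    using D by (auto simp: grad_y_eq_snd_gradient)
  have gy: "(grad_y h has_derivative (\<lambda>a. snd (?D a))) (at (fst z, snd z))"
    unfolding eq using d by (auto intro!: derivative_eq_intros)
  have dx: "((\<lambda>x. grad_y h (x, snd z)) has_derivative (\<lambda>a. snd (?D (a, 0)))) (at (fst z))"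
    by (rule has_derivative_slice(1)[OF gy])
  have dy: "((\<lambda>y. grad_y h (fst z, y)) has_derivative (\<lambda>a. snd (?D (0, a)))) (at (snd z))"
    by (rule has_derivative_slice(2)[OF gy])
  have lin: "linear (\<lambda>a. snd (?D (a, 0)))" by (rule has_derivative_linear[OF dx])
  have xy: "blinfun_apply (hess_xy h z) = adjoint (\<lambda>a. snd (?D (a, 0)))"
    unfolding hess_xy_def frechet_derivative_at[OF dx, symmetric]
    by (rule bounded_linear_Blinfun_apply) (simp add: adjoint_linear[OF lin] linear_conv_bounded_linear[symmetric])
  have yy: "blinfun_apply (hess_yy h z) = (\<lambda>a. snd (?D (0, a)))"
    unfolding hess_yy_def frechet_derivative_at[OF dy, symmetric]
    by (rule bounded_linear_Blinfun_apply) (rule has_derivative_bounded_linear[OF dy])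
  have linD: "linear ?D" by (rule has_derivative_linear[OF d])
  have "grad_y_deriv h z c = snd (?D c)" for c
    using linear_add[OF linD, of "(fst c, 0)" "(0, snd c)"]
    by (simp add: grad_y_deriv_def xy yy adjoint_adjoint[OF lin])
  then have "grad_y_deriv h z = (\<lambda>c. snd (?D c))" by (rule ext)
  with gy show ?thesis by simp
qed

lemma norm_le_by_inner:
  fixes v :: "'c::real_inner"
  assumes "\<And>w. v \<bullet> w \<le> C * norm w" and "0 \<le> C"
  shows "norm v \<le> C"
  using assms(1)[of v] assms(2) by (cases "v = 0") (auto simp: dot_square_norm power2_eq_square)

lemma (in prob_space) expectation_taylor:
  fixes h :: "'a \<Rightarrow> 'c::euclidean_space \<Rightarrow> 'd::euclidean_space"
  assumes int: "\<And>z. integrable M (\<lambda>s. h s z)"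
    and intD: "\<And>a. integrable M (\<lambda>s. D s a)"
    and bound: "\<And>s a. s \<in> space M \<Longrightarrow> norm (h s (z + a) - h s z - D s a) \<le> C * (norm a)\<^sup>2"
  shows "norm ((\<integral>s. h s (z + a) \<partial>M) - (\<integral>s. h s z \<partial>M) - (\<integral>s. D s a \<partial>M)) \<le> C * (norm a)\<^sup>2"
proof -
  have "norm (\<integral>s. h s (z + a) - h s z - D s a \<partial>M) \<le> (\<integral>s. norm (h s (z + a) - h s z - D s a) \<partial>M)"
    by (rule integral_norm_bound)
  also have "\<dots> \<le> (\<integral>s. C * (norm a)\<^sup>2 \<partial>M)"
    by (intro integral_mono integrable_norm Bochner_Integration.integrable_diff int intD) (auto intro: bound)
  finally show ?thesis
    by (simp add: int intD prob_space)
qed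

text \<open>Differentiation under the expectation without dominated convergence: the remainder is
  quadratic with the same constant for every sample, so it stays quadratic after
  integration.\<close>

lemma (in prob_space) has_derivative_expectation:
  fixes h :: "'a \<Rightarrow> 'c::euclidean_space \<Rightarrow> 'd::euclidean_space"
  assumes int: "\<And>z. integrable M (\<lambda>s. h s z)"
    and intD: "\<And>a. integrable M (\<lambda>s. D s a)"
    and lin: "\<And>s. s \<in> space M \<Longrightarrow> linear (D s)"
    and bound: "\<And>s a. s \<in> space M \<Longrightarrow> norm (h s (z + a) - h s z - D s a) \<le> C * (norm a)\<^sup>2"
  shows "((\<lambda>z. \<integral>s. h s z \<partial>M) has_derivative (\<lambda>a. \<integral>s. D s a \<partial>M)) (at z)"
proof (rule has_derivative_quadratic_boundI)
  have "linear (\<lambda>a. \<integral>s. D s a \<partial>M)"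
  proof (rule linearI)
    show "(\<integral>s. D s (a + b) \<partial>M) = (\<integral>s. D s a \<partial>M) + (\<integral>s. D s b \<partial>M)" for a b
      unfolding Bochner_Integration.integral_add[OF intD intD, symmetric]
      by (rule Bochner_Integration.integral_cong) (auto simp: linear_add[OF lin])
    show "(\<integral>s. D s (r *\<^sub>R a) \<partial>M) = r *\<^sub>R (\<integral>s. D s a \<partial>M)" for r a
      unfolding integral_scaleR_right[symmetric]
      by (rule Bochner_Integration.integral_cong) (auto simp: linear_cmul[OF lin])
  qed
  then show "bounded_linear (\<lambda>a. \<integral>s. D s a \<partial>M)" by (simp add: linear_conv_bounded_linear)
qed (rule expectation_taylor[OF int intD bound])

lemma borel_measurable_derivative:
  fixes h :: "'s \<Rightarrow> 'c::real_normed_vector \<Rightarrow> 'd::{real_normed_vector, second_countable_topology}"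
  assumes "\<And>z. (\<lambda>s. h s z) \<in> borel_measurable D"
    and "\<And>s. s \<in> space D \<Longrightarrow> (h s has_derivative h' s) (at z)"
  shows "(\<lambda>s. h' s a) \<in> borel_measurable D"
  by (rule borel_measurable_LIMSEQ_metric[OF _ directional_limit[OF assms(2)]])
    (intro borel_measurable_scaleR borel_measurable_diff borel_measurable_const assms(1))

lemma norm_fst_snd_le: "norm (fst c) \<le> norm c" "norm (snd c) \<le> norm c"
  using norm_fst_le[of "fst c" "snd c"] norm_snd_le[of "snd c" "fst c"] by auto

section \<open>Pathwise bounds for the sample functions\<close>

context stochastic_bilevel
begin

lemma sample_nonempty: "\<exists>\<xi>. \<xi> \<in> space Dxi" "\<exists>\<zeta>. \<zeta> \<in> space Dzeta"
  using prob_space.not_empty[OF prob_xi] prob_space.not_empty[OF prob_zeta] by auto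

lemma constants_nonneg: "0 \<le> M" "0 \<le> L" "0 \<le> \<tau>" "0 \<le> \<rho>"
  using sample_nonempty F_lipschitz grad_F_lipschitz hess_xy_lipschitz hess_yy_lipschitz
  by (meson lipschitz_on_nonneg)+

lemma F_deriv: "\<xi> \<in> space Dxi \<Longrightarrow> (F \<xi> has_derivative (\<lambda>a. a \<bullet> gradient (F \<xi>) z)) (at z)"
  by (rule has_derivative_gradient) (rule F_differentiable)

lemma G_deriv: "\<zeta> \<in> space Dzeta \<Longrightarrow> (G \<zeta> has_derivative (\<lambda>a. a \<bullet> gradient (G \<zeta>) z)) (at z)"
  by (rule has_derivative_gradient) (rule G_differentiable)

lemma grad_F_bound: "\<xi> \<in> space Dxi \<Longrightarrow> norm (gradient (F \<xi>) z) \<le> M"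
  using lipschitz_derivative_bound[OF F_deriv F_lipschitz] 
  by (intro norm_le_by_inner) (metis abs_le_D1 inner_commute real_norm_def, rule constants_nonneg)

lemma grad_F_parts:
  assumes "\<xi> \<in> space Dxi"
  shows "grad_x (F \<xi>) z = fst (gradient (F \<xi>) z)" "grad_y (F \<xi>) z = snd (gradient (F \<xi>) z)"
  by (intro grad_x_eq_fst_gradient grad_y_eq_snd_gradient F_differentiable assms)+

lemma partial_F_bound:
  assumes "\<xi> \<in> space Dxi"
  shows "norm (grad_x (F \<xi>) z) \<le> M" "norm (grad_y (F \<xi>) z) \<le> M"
  using grad_F_bound[OF assms, of z] norm_fst_snd_le[of "gradient (F \<xi>) z"] 
  by (auto simp: grad_F_parts[OF assms])

lemma partial_F_lipschitz:
  assumes "\<xi> \<in> space Dxi"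
  shows "norm (grad_x (F \<xi>) z - grad_x (F \<xi>) z') \<le> L * norm (z - z')"
    "norm (grad_y (F \<xi>) z - grad_y (F \<xi>) z') \<le> L * norm (z - z')"
  using lipschitz_onD[OF grad_F_lipschitz[OF assms], of z z'] norm_fst_snd_le[of "gradient (F \<xi>) z - gradient (F \<xi>) z'"] 
  by (auto simp: grad_F_parts[OF assms] dist_norm)

lemma grad_y_G: "\<zeta> \<in> space Dzeta \<Longrightarrow> grad_y (G \<zeta>) z = snd (gradient (G \<zeta>) z)"
  by (rule grad_y_eq_snd_gradient) (rule G_differentiable)

lemma grad_y_G_lipschitz:
  assumes "\<zeta> \<in> space Dzeta"
  shows "norm (grad_y (G \<zeta>) z - grad_y (G \<zeta>) z') \<le> L * norm (z - z')"
  using lipschitz_onD[OF grad_G_lipschitz[OF assms], of z z'] norm_fst_snd_le(2)[of "gradient (G \<zeta>) z - gradient (G \<zeta>) z'"] 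
  by (auto simp: grad_y_G[OF assms] dist_norm)

lemma grad_y_G_deriv: "\<zeta> \<in> space Dzeta \<Longrightarrow> (grad_y (G \<zeta>) has_derivative grad_y_deriv (G \<zeta>) z) (at z)"
  by (rule grad_y_has_derivative) (auto intro: G_differentiable G_twice_differentiable)

lemma grad_y_deriv_bound:
  assumes "\<zeta> \<in> space Dzeta"
  shows "norm (grad_y_deriv (G \<zeta>) z c) \<le> L * norm c"
proof -
  have "L-lipschitz_on UNIV (grad_y (G \<zeta>))"
    using grad_y_G_lipschitz[OF assms] constants_nonneg by (intro lipschitz_onI) (auto simp: dist_norm)
  then show ?thesis by (rule lipschitz_derivative_bound[OF grad_y_G_deriv[OF assms]])
qed

lemma hess_yy_eq: "blinfun_apply (hess_yy h z) b = grad_y_deriv h z (0, b)"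
  by (simp add: grad_y_deriv_def linear_0 adjoint_linear blinfun.bounded_linear_right bounded_linear.linear)

lemma hess_bound:
  assumes "\<zeta> \<in> space Dzeta"
  shows "norm (blinfun_apply (hess_yy (G \<zeta>) z) b) \<le> L * norm b"
    and "norm (blinfun_apply (hess_xy (G \<zeta>) z) b) \<le> L * norm b"
proof -
  show "norm (blinfun_apply (hess_yy (G \<zeta>) z) b) \<le> L * norm b"
    unfolding hess_yy_eq using grad_y_deriv_bound[OF assms, of z "(0, b)"] by simp
  show "norm (blinfun_apply (hess_xy (G \<zeta>) z) b) \<le> L * norm b"
  proof (rule norm_le_by_inner)
    fix w
    have "blinfun_apply (hess_xy (G \<zeta>) z) b \<bullet> w = grad_y_deriv (G \<zeta>) z (w, 0) \<bullet> b"
      by (simp add: grad_y_deriv_inner blinfun.zero_right inner_commute[of w])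
    also have "\<dots> \<le> norm (grad_y_deriv (G \<zeta>) z (w, 0)) * norm b" by (rule norm_cauchy_schwarz)
    also have "\<dots> \<le> L * norm w * norm b"
      using grad_y_deriv_bound[OF assms, of z "(w, 0)"] by (intro mult_right_mono) auto
    finally show "blinfun_apply (hess_xy (G \<zeta>) z) b \<bullet> w \<le> L * norm b * norm w" by (simp add: mult_ac)
  qed (use constants_nonneg in auto)
qed

lemma hess_lipschitz:
  assumes "\<zeta> \<in> space Dzeta"
  shows "norm (blinfun_apply (hess_yy (G \<zeta>) z) b - blinfun_apply (hess_yy (G \<zeta>) z') b) \<le> \<rho> * norm (z - z') * norm b"
    and "norm (blinfun_apply (hess_xy (G \<zeta>) z) b - blinfun_apply (hess_xy (G \<zeta>) z') b) \<le> \<tau> * norm (z - z') * norm b"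
proof -
  have "norm (blinfun_apply (hess_yy (G \<zeta>) z - hess_yy (G \<zeta>) z') b) \<le> norm (hess_yy (G \<zeta>) z - hess_yy (G \<zeta>) z') * norm b"
    by (rule norm_blinfun)
  also have "\<dots> \<le> \<rho> * norm (z - z') * norm b"
    using lipschitz_onD[OF hess_yy_lipschitz[OF assms], of z z'] by (intro mult_right_mono) (auto simp: dist_norm)
  finally show "norm (blinfun_apply (hess_yy (G \<zeta>) z) b - blinfun_apply (hess_yy (G \<zeta>) z') b) \<le> \<rho> * norm (z - z') * norm b"
    by (simp add: blinfun.diff_left)
  have "norm (blinfun_apply (hess_xy (G \<zeta>) z - hess_xy (G \<zeta>) z') b) \<le> norm (hess_xy (G \<zeta>) z - hess_xy (G \<zeta>) z') * norm b"
    by (rule norm_blinfun)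
  also have "\<dots> \<le> \<tau> * norm (z - z') * norm b"
    using lipschitz_onD[OF hess_xy_lipschitz[OF assms], of z z'] by (intro mult_right_mono) (auto simp: dist_norm)
  finally show "norm (blinfun_apply (hess_xy (G \<zeta>) z) b - blinfun_apply (hess_xy (G \<zeta>) z') b) \<le> \<tau> * norm (z - z') * norm b"
    by (simp add: blinfun.diff_left)
qed

lemma grad_y_deriv_lipschitz:
  assumes "\<zeta> \<in> space Dzeta"
  shows "norm (grad_y_deriv (G \<zeta>) z c - grad_y_deriv (G \<zeta>) z' c) \<le> (\<tau> + \<rho>) * norm (z - z') * norm c"
proof (rule norm_le_by_inner)
  fix w
  have "(grad_y_deriv (G \<zeta>) z c - grad_y_deriv (G \<zeta>) z' c) \<bullet> w
      = fst c \<bullet> (blinfun_apply (hess_xy (G \<zeta>) z) w - blinfun_apply (hess_xy (G \<zeta>) z') w)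
      + (blinfun_apply (hess_yy (G \<zeta>) z) (snd c) - blinfun_apply (hess_yy (G \<zeta>) z') (snd c)) \<bullet> w"
    by (simp add: inner_diff_left inner_diff_right grad_y_deriv_inner)
  also have "\<dots> \<le> norm (fst c) * (\<tau> * norm (z - z') * norm w) + (\<rho> * norm (z - z') * norm (snd c)) * norm w"
    by (intro add_mono order_trans[OF norm_cauchy_schwarz] mult_left_mono mult_right_mono hess_lipschitz assms) auto
  also have "\<dots> \<le> norm c * (\<tau> * norm (z - z') * norm w) + (\<rho> * norm (z - z') * norm c) * norm w"
    using norm_fst_snd_le[of c] constants_nonneg
    by (intro add_mono mult_left_mono mult_right_mono) auto
  finally show "(grad_y_deriv (G \<zeta>) z c - grad_y_deriv (G \<zeta>) z' c) \<bullet> w \<le> (\<tau> + \<rho>) * norm (z - z') * norm c * norm w"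
    by (simp add: algebra_simps)
qed (use constants_nonneg in auto)

lemma grad_y_G_taylor:
  assumes "\<zeta> \<in> space Dzeta"
  shows "norm (grad_y (G \<zeta>) (z + c) - grad_y (G \<zeta>) z - grad_y_deriv (G \<zeta>) z c) \<le> (\<tau> + \<rho>) * (norm c)\<^sup>2"
  using constants_nonneg
  by (intro taylor_lipschitz grad_y_G_deriv grad_y_deriv_lipschitz assms) auto

lemma G_partial_y:
  assumes "\<zeta> \<in> space Dzeta"
  shows "(\<lambda>y. G \<zeta> (x, y)) differentiable (at y)" "gradient (\<lambda>y. G \<zeta> (x, y)) y = grad_y (G \<zeta>) (x, y)"
proof -
  have "((\<lambda>y. G \<zeta> (x, y)) has_derivative (\<lambda>a. (0, a) \<bullet> gradient (G \<zeta>) (x, y))) (at y)"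
    by (rule has_derivative_slice(2)[OF G_deriv[OF assms]])
  then show "(\<lambda>y. G \<zeta> (x, y)) differentiable (at y)" by (rule differentiableI)
qed (simp add: grad_y_def)

lemma grad_y_G_monotone:
  assumes "\<zeta> \<in> space Dzeta"
  shows "\<mu> * (norm (y - y'))\<^sup>2 \<le> (grad_y (G \<zeta>) (x, y) - grad_y (G \<zeta>) (x, y')) \<bullet> (y - y')"
  using strongly_convex_monotone[OF G_strongly_convex[OF assms] G_partial_y(1)[OF assms], of y y' x]
  by (simp add: G_partial_y(2)[OF assms])

lemma grad_y_G_inequality:
  assumes "\<zeta> \<in> space Dzeta"
  shows "G \<zeta> (x, y) + (y' - y) \<bullet> grad_y (G \<zeta>) (x, y) + \<mu> / 2 * (norm (y' - y))\<^sup>2 \<le> G \<zeta> (x, y')"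
  using strongly_convex_gradient[OF G_strongly_convex[OF assms] G_partial_y(1)[OF assms], of x y y']
  by (simp add: G_partial_y(2)[OF assms])

lemma hess_yy_coercive:
  assumes "\<zeta> \<in> space Dzeta"
  shows "\<mu> * (norm b)\<^sup>2 \<le> blinfun_apply (hess_yy (G \<zeta>) z) b \<bullet> b"
proof -
  let ?s = "\<lambda>n. 1 / real (Suc n)"
  let ?d = "\<lambda>n. grad_y (G \<zeta>) (z + ?s n *\<^sub>R (0, b)) - grad_y (G \<zeta>) z"
  have "(\<lambda>n. (real (Suc n) *\<^sub>R ?d n) \<bullet> b) \<longlonglongrightarrow> grad_y_deriv (G \<zeta>) z (0, b) \<bullet> b"
    by (intro tendsto_intros directional_limit grad_y_G_deriv assms)
  then show ?thesis unfolding hess_yy_eq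
  proof (rule LIMSEQ_le_const, intro exI[of _ 0] allI impI)
    fix n
    have "\<mu> * (norm (?s n *\<^sub>R b))\<^sup>2 \<le> ?d n \<bullet> (?s n *\<^sub>R b)"
      using grad_y_G_monotone[OF assms, of "snd z + ?s n *\<^sub>R b" "snd z" "fst z"]
      by (cases z) simp
    then have "(real (Suc n))\<^sup>2 * (\<mu> * (norm (?s n *\<^sub>R b))\<^sup>2) \<le> (real (Suc n))\<^sup>2 * (?d n \<bullet> (?s n *\<^sub>R b))"
      by (intro mult_left_mono) auto
    then show "\<mu> * (norm b)\<^sup>2 \<le> (real (Suc n) *\<^sub>R ?d n) \<bullet> b"
      unfolding inner_scaleR_left by (simp add: power2_eq_square field_simps del: of_nat_Suc)
  qed
qed

text \<open>On a basis vector of the y-space, which is never the zero space, the Hessian form of any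
  one sample lies between \<mu> and L.\<close>

lemma mu_le_L: "\<mu> \<le> L"
proof -
  obtain \<zeta> where z: "\<zeta> \<in> space Dzeta" using sample_nonempty by blast
  obtain b :: 'b where b: "b \<in> Basis" by fastforce
  have "\<mu> * (norm b)\<^sup>2 \<le> blinfun_apply (hess_yy (G \<zeta>) (0, 0)) b \<bullet> b" by (rule hess_yy_coercive[OF z])
  also have "\<dots> \<le> norm (blinfun_apply (hess_yy (G \<zeta>) (0, 0)) b) * norm b" by (rule norm_cauchy_schwarz)
  also have "\<dots> \<le> L * norm b * norm b" by (intro mult_right_mono hess_bound z) auto
  finally show ?thesis using b by simp
qed

text \<open>Only the slice at fixed x enters; there \<open>hess_yy\<close> is the derivative of the
  gradient and Lipschitz in y, as \<open>hessian_symmetric\<close> requires.\<close>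

lemma hess_yy_symmetric:
  assumes z: "\<zeta> \<in> space Dzeta"
  shows "blinfun_apply (hess_yy (G \<zeta>) z) a \<bullet> b = a \<bullet> blinfun_apply (hess_yy (G \<zeta>) z) b"
proof -
  have D: "((\<lambda>y. G \<zeta> (fst z, y)) has_derivative (\<lambda>a. a \<bullet> grad_y (G \<zeta>) (fst z, y))) (at y)" for y
    using has_derivative_gradient[OF G_partial_y(1)[OF assms]] by (simp add: G_partial_y(2)[OF assms])
  have D2: "((\<lambda>y. grad_y (G \<zeta>) (fst z, y)) has_derivative blinfun_apply (hess_yy (G \<zeta>) (fst z, y))) (at y)" for y
    unfolding hess_yy_eq
    by (rule has_derivative_slice(2)[OF grad_y_G_deriv[OF assms]])
  have "blinfun_apply (hess_yy (G \<zeta>) (fst z, snd z)) a \<bullet> b = a \<bullet> blinfun_apply (hess_yy (G \<zeta>) (fst z, snd z)) b"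
  proof (rule hessian_symmetric[where H = "\<lambda>y. blinfun_apply (hess_yy (G \<zeta>) (fst z, y))", OF D D2])
    show "norm (blinfun_apply (hess_yy (G \<zeta>) (fst z, y)) a - blinfun_apply (hess_yy (G \<zeta>) (fst z, y')) a) \<le> \<rho> * norm (y - y') * norm a" for y y' a
      using hess_lipschitz(1)[OF assms, of "(fst z, y)" a "(fst z, y')"] by simp
  qed (rule constants_nonneg)
  then show ?thesis by simp
qed

text \<open>Since \<eta>L \<le> 1, the symmetric operator I - \<eta>H is positive semidefinite, so
  its norm is governed by its quadratic form, which coercivity bounds by 1 - \<eta>\<mu>. All
  uniformity in the truncation depth rests on this factor.\<close>

lemma hess_step_bound:
  assumes z: "\<zeta> \<in> space Dzeta" and \<eta>: "0 \<le> \<eta>" "\<eta> * L \<le> 1"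
  shows "norm (b - \<eta> *\<^sub>R blinfun_apply (hess_yy (G \<zeta>) z) b) \<le> (1 - \<eta> * \<mu>) * norm b"
proof (rule psd_norm_bound[where T = "\<lambda>b. b - \<eta> *\<^sub>R blinfun_apply (hess_yy (G \<zeta>) z) b"])
  let ?H = "blinfun_apply (hess_yy (G \<zeta>) z)"
  show "linear (\<lambda>b. b - \<eta> *\<^sub>R ?H b)"
    by (rule linearI) (simp_all add: blinfun.add_right blinfun.scaleR_right algebra_simps)
  show "(a - \<eta> *\<^sub>R ?H a) \<bullet> b = a \<bullet> (b - \<eta> *\<^sub>R ?H b)" for a b
    using hess_yy_symmetric[OF z, of z a b] by (simp add: inner_diff_left inner_diff_right)
  show "(a - \<eta> *\<^sub>R ?H a) \<bullet> a \<le> (1 - \<eta> * \<mu>) * (norm a)\<^sup>2" for a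
    using mult_left_mono[OF hess_yy_coercive[OF z, of a z] \<eta>(1)]
    by (simp add: inner_diff_left power2_norm_eq_inner algebra_simps)
  show "0 \<le> (a - \<eta> *\<^sub>R ?H a) \<bullet> a" for a
  proof -
    have "?H a \<bullet> a \<le> L * norm a * norm a"
      by (rule order_trans[OF norm_cauchy_schwarz]) (intro mult_right_mono hess_bound z norm_ge_zero)
    then have "\<eta> * (?H a \<bullet> a) \<le> \<eta> * (L * norm a * norm a)" using \<eta> by (intro mult_left_mono)
    also have "\<dots> \<le> 1 * (norm a * norm a)" unfolding mult.assoc[symmetric]
      using \<eta> by (intro mult_right_mono) auto
    finally show ?thesis by (simp add: inner_diff_left power2_norm_eq_inner dot_square_norm power2_eq_square)
  qed
qed

section \<open>Measurability of the sample derivatives\<close>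

lemma F_measurable: "(\<lambda>\<xi>. F \<xi> z) \<in> borel_measurable Dxi" and G_measurable: "(\<lambda>\<zeta>. G \<zeta> z) \<in> borel_measurable Dzeta"
  using F_integrable G_integrable by auto

lemma grad_F_measurable: "(\<lambda>\<xi>. gradient (F \<xi>) z) \<in> borel_measurable Dxi"
  unfolding borel_measurable_euclidean_space[of "\<lambda>\<xi>. gradient (F \<xi>) z"]
  using borel_measurable_derivative[OF F_measurable F_deriv] by (simp add: inner_commute)

lemma grad_G_measurable: "(\<lambda>\<zeta>. gradient (G \<zeta>) z) \<in> borel_measurable Dzeta"
  unfolding borel_measurable_euclidean_space[of "\<lambda>\<zeta>. gradient (G \<zeta>) z"]
  using borel_measurable_derivative[OF G_measurable G_deriv] by (simp add: inner_commute)

lemma partial_measurable: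
  "(\<lambda>\<xi>. grad_x (F \<xi>) z) \<in> borel_measurable Dxi"
  "(\<lambda>\<xi>. grad_y (F \<xi>) z) \<in> borel_measurable Dxi"
  "(\<lambda>\<zeta>. grad_y (G \<zeta>) z) \<in> borel_measurable Dzeta"
  using measurable_compose[OF grad_F_measurable[of z] borel_measurable_fst_snd(1)]
    measurable_compose[OF grad_F_measurable[of z] borel_measurable_fst_snd(2)]
    measurable_compose[OF grad_G_measurable[of z] borel_measurable_fst_snd(2)]
  by (simp_all add: grad_F_parts grad_y_G cong: measurable_cong_simp)

lemma grad_y_deriv_measurable: "(\<lambda>\<zeta>. grad_y_deriv (G \<zeta>) z c) \<in> borel_measurable Dzeta"
  by (rule borel_measurable_derivative[OF partial_measurable(3) grad_y_G_deriv])

lemma hess_measurable: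
  "(\<lambda>\<zeta>. blinfun_apply (hess_yy (G \<zeta>) z) b) \<in> borel_measurable Dzeta"
  "(\<lambda>\<zeta>. blinfun_apply (hess_xy (G \<zeta>) z) b) \<in> borel_measurable Dzeta"
proof -
  show "(\<lambda>\<zeta>. blinfun_apply (hess_yy (G \<zeta>) z) b) \<in> borel_measurable Dzeta"
    unfolding hess_yy_eq by (rule grad_y_deriv_measurable)
  have "blinfun_apply (hess_xy (G \<zeta>) z) b \<bullet> w = grad_y_deriv (G \<zeta>) z (w, 0) \<bullet> b" for w \<zeta>
    by (simp add: grad_y_deriv_inner blinfun.zero_right inner_commute[of w])
  then show "(\<lambda>\<zeta>. blinfun_apply (hess_xy (G \<zeta>) z) b) \<in> borel_measurable Dzeta"
    unfolding borel_measurable_euclidean_space[of "\<lambda>\<zeta>. blinfun_apply (hess_xy (G \<zeta>) z) b"]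
    using grad_y_deriv_measurable by (simp add: borel_measurable_inner)
qed

end

section \<open>Resampling coordinates of a product space\<close>

text \<open>Estimators are evaluated at iterates that are themselves random. A function measurable
  in the sample and continuous in the point admits such an argument: simple approximations of
  \<open>c\<close> take only finitely many values, and continuity passes to the limit.\<close>

lemma caratheodory_measurable:
  fixes h :: "'s \<Rightarrow> 'c::{metric_space, second_countable_topology} \<Rightarrow> 'd::metric_space"
  assumes h: "\<And>z. (\<lambda>s. h s z) \<in> borel_measurable N" and cont: "\<And>s. s \<in> space N \<Longrightarrow> continuous_on UNIV (h s)"
    and p: "p \<in> measurable K N" and c: "c \<in> borel_measurable K"
  shows "(\<lambda>x. h (p x) (c x)) \<in> borel_measurable K"
proof -
  obtain S where S: "\<And>i. simple_function K (S i)" "\<And>x. x \<in> space K \<Longrightarrow> (\<lambda>i. S i x) \<longlonglongrightarrow> c x"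
    using borel_measurable_implies_sequence_metric[OF c] by blast
  show ?thesis
  proof (rule borel_measurable_LIMSEQ_metric)
    show "(\<lambda>x. h (p x) (S i x)) \<in> borel_measurable K" for i
    proof (rule measurable_compose_countable'[of "S i ` space K" "\<lambda>z x. h (p x) z"])
      show "S i \<in> K \<rightarrow>\<^sub>M count_space (S i ` space K)"
        using simple_functionD[OF S(1)[of i]] by (auto simp: measurable_count_space_eq2)
      show "countable (S i ` space K)" using simple_functionD(1)[OF S(1)] by (rule countable_finite)
    qed (rule measurable_compose[OF p h])
    show "(\<lambda>i. h (p x) (S i x)) \<longlonglongrightarrow> h (p x) (c x)" if "x \<in> space K" for x
      using cont[OF measurable_space[OF p that]]
      by (intro isCont_tendsto_compose[OF _ S(2)[OF that]]) (simp add: continuous_on_eq_continuous_at)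
  qed
qed

text \<open>Independence is expressed through this map: a quantity does not depend on the
  coordinates in \<open>A\<close> if its value at \<open>mix A x y\<close> is that at
  \<open>x\<close>, and depends on nothing else if it is that at \<open>y\<close>. This replaces
  sub-sigma-algebras and conditional expectations.\<close>

definition mix :: "'i set \<Rightarrow> ('i \<Rightarrow> 's) \<Rightarrow> ('i \<Rightarrow> 's) \<Rightarrow> 'i \<Rightarrow> 's" where
  "mix A x y = (\<lambda>i. if i \<in> A then y i else x i)"

lemma mix_measurable:
  "(\<lambda>p. mix A (fst p) (snd p)) \<in> (\<Pi>\<^sub>M _\<in>UNIV. D) \<Otimes>\<^sub>M (\<Pi>\<^sub>M _\<in>UNIV. D) \<rightarrow>\<^sub>M (\<Pi>\<^sub>M _\<in>UNIV. D)"
  unfolding mix_def by (rule measurable_PiM_single') (auto simp: space_pair_measure space_PiM PiE_iff)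

text \<open>It suffices to test cylinders over finite \<open>J\<close>. The preimage of such a
  cylinder is a rectangle, with the constraints from \<open>J - A\<close> on the first copy and
  those from \<open>J \<inter> A\<close> on the second, so its measure is the full product.\<close>

lemma distr_mix:
  assumes D: "prob_space D"
  shows "distr ((\<Pi>\<^sub>M _\<in>UNIV. D) \<Otimes>\<^sub>M (\<Pi>\<^sub>M _\<in>UNIV. D)) (\<Pi>\<^sub>M _\<in>UNIV. D) (\<lambda>p. mix A (fst p) (snd p)) = (\<Pi>\<^sub>M _\<in>(UNIV :: 'i set). D)"
    (is "distr (?P \<Otimes>\<^sub>M ?P) _ ?m = _")
proof -
  interpret product_prob_space "\<lambda>_::'i. D" UNIV
    by (intro product_prob_spaceI D)
  interpret P: prob_space ?P by (rule prob_space_PiM) (rule D)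
  show ?thesis
  proof (rule PiM_eq)
    fix J :: "'i set" and E assume J: "finite J" "J \<subseteq> UNIV" and E: "\<And>j. j \<in> J \<Longrightarrow> E j \<in> sets D"
    let ?emb = "\<lambda>J. prod_emb UNIV (\<lambda>_. D) J (\<Pi>\<^sub>E j\<in>J. E j)"
    have emb: "?emb K \<in> sets ?P" "emeasure ?P (?emb K) = (\<Prod>j\<in>K. emeasure D (E j))" if "K \<subseteq> J" for K
      using that J E by (auto intro!: sets_PiM_I emeasure_PiM_emb dest: finite_subset)
    have "emeasure (distr (?P \<Otimes>\<^sub>M ?P) ?P ?m) (?emb J) = emeasure (?P \<Otimes>\<^sub>M ?P) (?m -` ?emb J \<inter> space (?P \<Otimes>\<^sub>M ?P))"
      by (rule emeasure_distr[OF mix_measurable emb(1)]) simp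
    also have "?m -` ?emb J \<inter> space (?P \<Otimes>\<^sub>M ?P) = ?emb (J - A) \<times> ?emb (J \<inter> A)"
      by (auto simp: prod_emb_def mix_def space_pair_measure space_PiM PiE_iff split: if_splits)
    also have "emeasure (?P \<Otimes>\<^sub>M ?P) \<dots> = emeasure ?P (?emb (J - A)) * emeasure ?P (?emb (J \<inter> A))"
      by (rule P.emeasure_pair_measure_Times) (auto intro: emb)
    also have "\<dots> = (\<Prod>j\<in>J - A. emeasure D (E j)) * (\<Prod>j\<in>J \<inter> A. emeasure D (E j))"
      by (simp add: emb)
    also have "\<dots> = (\<Prod>j\<in>J. emeasure D (E j))"
      using J(1) by (simp add: prod.Int_Diff[of J _ A] mult.commute)
    finally show "emeasure (distr (?P \<Otimes>\<^sub>M ?P) ?P ?m) (?emb J) = (\<Prod>j\<in>J. emeasure D (E j))" .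
  qed simp
qed

lemma nn_integral_mix:
  assumes D: "prob_space D" and h: "h \<in> borel_measurable (\<Pi>\<^sub>M _\<in>(UNIV::'i set). D)"
  shows "(\<integral>\<^sup>+x. h x \<partial>(\<Pi>\<^sub>M _\<in>UNIV. D)) = (\<integral>\<^sup>+x. \<integral>\<^sup>+x'. h (mix A x x') \<partial>(\<Pi>\<^sub>M _\<in>UNIV. D) \<partial>(\<Pi>\<^sub>M _\<in>UNIV. D))"
proof -
  interpret X: prob_space "\<Pi>\<^sub>M _\<in>(UNIV::'i set). D" by (rule prob_space_PiM) (rule D)
  have "(\<integral>\<^sup>+x. h x \<partial>(\<Pi>\<^sub>M _\<in>UNIV. D)) = (\<integral>\<^sup>+p. h (mix A (fst p) (snd p)) \<partial>((\<Pi>\<^sub>M _\<in>UNIV. D) \<Otimes>\<^sub>M (\<Pi>\<^sub>M _\<in>UNIV. D)))"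
    by (subst distr_mix[OF D, of A, symmetric]) (rule nn_integral_distr[OF mix_measurable], simp add: h)
  also have "\<dots> = (\<integral>\<^sup>+x. \<integral>\<^sup>+x'. h (mix A x x') \<partial>(\<Pi>\<^sub>M _\<in>UNIV. D) \<partial>(\<Pi>\<^sub>M _\<in>UNIV. D))"
    using X.nn_integral_fst[OF measurable_compose[OF mix_measurable h]] by simp
  finally show ?thesis .
qed

section \<open>Independence and second moments in the sample space\<close>

locale sampling =
  fixes Dxi :: "'xi measure" and Dzeta :: "'zeta measure"
  assumes prob_Dxi: "prob_space Dxi" and prob_Dzeta: "prob_space Dzeta"
begin

abbreviation "\<Omega> \<equiv> sample_space Dxi Dzeta"

definition mix2 :: "(nat \<times> nat \<times> nat) set \<Rightarrow> (nat \<times> nat \<times> nat \<times> nat) set \<Rightarrow>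
    ('xi, 'zeta) samples \<Rightarrow> ('xi, 'zeta) samples \<Rightarrow> ('xi, 'zeta) samples" where
  "mix2 A B \<omega> \<omega>' = (mix A (fst \<omega>) (fst \<omega>'), mix B (snd \<omega>) (snd \<omega>'))"

lemma prob_space_\<Omega>: "prob_space \<Omega>"
proof -
  interpret X: prob_space "\<Pi>\<^sub>M _\<in>UNIV :: (nat \<times> nat \<times> nat) set. Dxi" by (rule prob_space_PiM) (rule prob_Dxi)
  interpret Z: prob_space "\<Pi>\<^sub>M _\<in>UNIV :: (nat \<times> nat \<times> nat \<times> nat) set. Dzeta" by (rule prob_space_PiM) (rule prob_Dzeta)
  interpret XZ: pair_prob_space "\<Pi>\<^sub>M _\<in>UNIV :: (nat \<times> nat \<times> nat) set. Dxi" "\<Pi>\<^sub>M _\<in>UNIV :: (nat \<times> nat \<times> nat \<times> nat) set. Dzeta" ..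
  show ?thesis unfolding sample_space_def by (rule XZ.prob_space_axioms)
qed

sublocale P: prob_space \<Omega> by (rule prob_space_\<Omega>)
sublocale PP: pair_prob_space \<Omega> \<Omega> ..

lemma mix2_measurable: "(\<lambda>p. mix2 A B (fst p) (snd p)) \<in> \<Omega> \<Otimes>\<^sub>M \<Omega> \<rightarrow>\<^sub>M \<Omega>"
proof -
  have 1: "(\<lambda>p. (fst (fst p), fst (snd p))) \<in> \<Omega> \<Otimes>\<^sub>M \<Omega> \<rightarrow>\<^sub>M (\<Pi>\<^sub>M _\<in>UNIV. Dxi) \<Otimes>\<^sub>M (\<Pi>\<^sub>M _\<in>UNIV. Dxi)"
    unfolding sample_space_def by measurable
  have 2: "(\<lambda>p. (snd (fst p), snd (snd p))) \<in> \<Omega> \<Otimes>\<^sub>M \<Omega> \<rightarrow>\<^sub>M (\<Pi>\<^sub>M _\<in>UNIV. Dzeta) \<Otimes>\<^sub>M (\<Pi>\<^sub>M _\<in>UNIV. Dzeta)"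
    unfolding sample_space_def by measurable
  show ?thesis
    using measurable_compose[OF 1 mix_measurable[of A]] measurable_compose[OF 2 mix_measurable[of B]]
    unfolding mix2_def sample_space_def by (intro measurable_Pair) simp_all
qed

text \<open>Resampling is invariant on each of the two factors separately. In the iterated integral
  over x, z, x', z' the middle two variables have to be exchanged before each copy stands next to
  its original.\<close>

lemma distr_mix2: "distr (\<Omega> \<Otimes>\<^sub>M \<Omega>) \<Omega> (\<lambda>p. mix2 A B (fst p) (snd p)) = \<Omega>"
proof (rule measure_eqI)
  let ?X = "\<Pi>\<^sub>M _\<in>UNIV :: (nat \<times> nat \<times> nat) set. Dxi" and ?Z = "\<Pi>\<^sub>M _\<in>UNIV :: (nat \<times> nat \<times> nat \<times> nat) set. Dzeta"
  interpret X: prob_space ?X by (rule prob_space_PiM) (rule prob_Dxi)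
  interpret Z: prob_space ?Z by (rule prob_space_PiM) (rule prob_Dzeta)
  interpret XZ: pair_prob_space ?X ?Z ..
  fix S assume "S \<in> sets (distr (\<Omega> \<Otimes>\<^sub>M \<Omega>) \<Omega> (\<lambda>p. mix2 A B (fst p) (snd p)))"
  then have S: "S \<in> sets \<Omega>" by simp
  let ?I = "indicator S :: _ \<Rightarrow> ennreal"
  have I: "?I \<in> borel_measurable (?X \<Otimes>\<^sub>M ?Z)" using S by (simp add: sample_space_def)
  have mX: "(\<lambda>q. mix A (f q) (g q)) \<in> N \<rightarrow>\<^sub>M ?X" if "f \<in> N \<rightarrow>\<^sub>M ?X" "g \<in> N \<rightarrow>\<^sub>M ?X" for f g and N :: "'n measure"
    using measurable_compose[OF measurable_Pair[OF that] mix_measurable[of A]] by simp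
  have mZ: "(\<lambda>q. mix B (f q) (g q)) \<in> N \<rightarrow>\<^sub>M ?Z" if "f \<in> N \<rightarrow>\<^sub>M ?Z" "g \<in> N \<rightarrow>\<^sub>M ?Z" for f g and N :: "'n measure"
    using measurable_compose[OF measurable_Pair[OF that] mix_measurable[of B]] by simp
  have mI: "(\<lambda>q. ?I (f q, g q)) \<in> borel_measurable N" if "f \<in> N \<rightarrow>\<^sub>M ?X" "g \<in> N \<rightarrow>\<^sub>M ?Z" for f g and N :: "'n measure"
    using measurable_compose[OF measurable_Pair[OF that] I] by simp
  have "emeasure (distr (\<Omega> \<Otimes>\<^sub>M \<Omega>) \<Omega> (\<lambda>p. mix2 A B (fst p) (snd p))) S
      = (\<integral>\<^sup>+p. ?I (mix2 A B (fst p) (snd p)) \<partial>(\<Omega> \<Otimes>\<^sub>M \<Omega>))"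
    using S by (subst nn_integral_distr[OF mix2_measurable, symmetric]) auto
  also have "\<dots> = (\<integral>\<^sup>+\<omega>. \<integral>\<^sup>+\<omega>'. ?I (mix2 A B \<omega> \<omega>') \<partial>\<Omega> \<partial>\<Omega>)"
    using S by (subst P.nn_integral_fst[symmetric]) (auto intro: measurable_compose[OF mix2_measurable])
  also have "\<dots> = (\<integral>\<^sup>+\<omega>. \<integral>\<^sup>+x'. \<integral>\<^sup>+z'. ?I (mix A (fst \<omega>) x', mix B (snd \<omega>) z') \<partial>?Z \<partial>?X \<partial>\<Omega>)"
  proof (rule nn_integral_cong)
    fix \<omega> assume "\<omega> \<in> space \<Omega>"
    then have "fst \<omega> \<in> space ?X" "snd \<omega> \<in> space ?Z" by (auto simp: sample_space_def space_pair_measure)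
    then have "(\<lambda>q. ?I (mix A (fst \<omega>) (fst q), mix B (snd \<omega>) (snd q))) \<in> borel_measurable (?X \<Otimes>\<^sub>M ?Z)"
      by (intro mI mX mZ measurable_const measurable_fst measurable_snd)
    from Z.nn_integral_fst[OF this]
    show "(\<integral>\<^sup>+\<omega>'. ?I (mix2 A B \<omega> \<omega>') \<partial>\<Omega>) = (\<integral>\<^sup>+x'. \<integral>\<^sup>+z'. ?I (mix A (fst \<omega>) x', mix B (snd \<omega>) z') \<partial>?Z \<partial>?X)"
      by (simp add: mix2_def sample_space_def)
  qed
  also have "\<dots> = (\<integral>\<^sup>+x. \<integral>\<^sup>+z. \<integral>\<^sup>+x'. \<integral>\<^sup>+z'. ?I (mix A x x', mix B z z') \<partial>?Z \<partial>?X \<partial>?Z \<partial>?X)"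
  proof -
    have "(\<lambda>q. ?I (mix A (fst (fst (fst q))) (snd (fst q)), mix B (snd (fst (fst q))) (snd q)))
        \<in> borel_measurable (((?X \<Otimes>\<^sub>M ?Z) \<Otimes>\<^sub>M ?X) \<Otimes>\<^sub>M ?Z)"
      by (intro mI mX mZ) measurable
    from Z.borel_measurable_nn_integral_fst[OF this]
    have "(\<lambda>q. \<integral>\<^sup>+z'. ?I (mix A (fst (fst q)) (snd q), mix B (snd (fst q)) z') \<partial>?Z) \<in> borel_measurable ((?X \<Otimes>\<^sub>M ?Z) \<Otimes>\<^sub>M ?X)"
      by simp
    from X.borel_measurable_nn_integral_fst[OF this]
    have "(\<lambda>q. \<integral>\<^sup>+x'. \<integral>\<^sup>+z'. ?I (mix A (fst q) x', mix B (snd q) z') \<partial>?Z \<partial>?X) \<in> borel_measurable (?X \<Otimes>\<^sub>M ?Z)"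
      by simp
    from Z.nn_integral_fst[OF this] show ?thesis by (simp add: sample_space_def)
  qed
  also have "\<dots> = (\<integral>\<^sup>+x. \<integral>\<^sup>+x'. \<integral>\<^sup>+z. \<integral>\<^sup>+z'. ?I (mix A x x', mix B z z') \<partial>?Z \<partial>?Z \<partial>?X \<partial>?X)"
  proof (rule nn_integral_cong)
    fix x assume x: "x \<in> space ?X"
    have "(\<lambda>q. ?I (mix A x (fst (fst q)), mix B (snd (fst q)) (snd q))) \<in> borel_measurable ((?X \<Otimes>\<^sub>M ?Z) \<Otimes>\<^sub>M ?Z)"
      using x by (intro mI mX mZ) measurable
    from Z.borel_measurable_nn_integral_fst[OF this]
    have "(\<lambda>q. \<integral>\<^sup>+z'. ?I (mix A x (fst q), mix B (snd q) z') \<partial>?Z) \<in> borel_measurable (?X \<Otimes>\<^sub>M ?Z)"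
      by simp
    from XZ.Fubini[OF this]
    show "(\<integral>\<^sup>+z. \<integral>\<^sup>+x'. \<integral>\<^sup>+z'. ?I (mix A x x', mix B z z') \<partial>?Z \<partial>?X \<partial>?Z)
        = (\<integral>\<^sup>+x'. \<integral>\<^sup>+z. \<integral>\<^sup>+z'. ?I (mix A x x', mix B z z') \<partial>?Z \<partial>?Z \<partial>?X)"
      by simp
  qed
  also have "\<dots> = (\<integral>\<^sup>+x. \<integral>\<^sup>+x'. \<integral>\<^sup>+z. ?I (mix A x x', z) \<partial>?Z \<partial>?X \<partial>?X)"
  proof (rule nn_integral_cong, rule nn_integral_cong)
    fix x x' assume "x \<in> space ?X" "x' \<in> space ?X"
    then have "mix A x x' \<in> space ?X" by (auto simp: mix_def space_PiM PiE_iff)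
    then have "(\<lambda>z. ?I (mix A x x', z)) \<in> borel_measurable ?Z" by (intro mI) auto
    from nn_integral_mix[OF prob_Dzeta this]
    show "(\<integral>\<^sup>+z. \<integral>\<^sup>+z'. ?I (mix A x x', mix B z z') \<partial>?Z \<partial>?Z) = (\<integral>\<^sup>+z. ?I (mix A x x', z) \<partial>?Z)" by simp
  qed
  also have "\<dots> = (\<integral>\<^sup>+x. \<integral>\<^sup>+z. ?I (x, z) \<partial>?Z \<partial>?X)"
    using nn_integral_mix[OF prob_Dxi Z.borel_measurable_nn_integral_fst[OF I], of A] by simp
  also have "\<dots> = emeasure \<Omega> S"
    using Z.nn_integral_fst[OF I] S by (simp add: sample_space_def)
  finally show "emeasure (distr (\<Omega> \<Otimes>\<^sub>M \<Omega>) \<Omega> (\<lambda>p. mix2 A B (fst p) (snd p))) S = emeasure \<Omega> S" .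
qed simp

text \<open>The inner integral plays the role of the conditional expectation given all coordinates
  outside \<open>A\<close> and \<open>B\<close>.\<close>

lemma expectation_mix:
  fixes X :: "_ \<Rightarrow> 'c::{banach, second_countable_topology}"
  assumes X: "integrable \<Omega> X"
  shows "integrable (\<Omega> \<Otimes>\<^sub>M \<Omega>) (\<lambda>p. X (mix2 A B (fst p) (snd p)))"
    and "(\<integral>\<omega>. X \<omega> \<partial>\<Omega>) = (\<integral>\<omega>. \<integral>\<omega>'. X (mix2 A B \<omega> \<omega>') \<partial>\<Omega> \<partial>\<Omega>)"
    and "integrable \<Omega> (\<lambda>\<omega>. \<integral>\<omega>'. X (mix2 A B \<omega> \<omega>') \<partial>\<Omega>)"
proof -
  have m: "X \<in> borel_measurable \<Omega>" using X by auto
  show i: "integrable (\<Omega> \<Otimes>\<^sub>M \<Omega>) (\<lambda>p. X (mix2 A B (fst p) (snd p)))"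
    using X integrable_distr[OF mix2_measurable, of A B X] by (simp add: distr_mix2)
  have "(\<integral>\<omega>. X \<omega> \<partial>\<Omega>) = (\<integral>\<omega>. X \<omega> \<partial>distr (\<Omega> \<Otimes>\<^sub>M \<Omega>) \<Omega> (\<lambda>p. mix2 A B (fst p) (snd p)))"
    by (simp add: distr_mix2)
  also have "\<dots> = (\<integral>p. X (mix2 A B (fst p) (snd p)) \<partial>(\<Omega> \<Otimes>\<^sub>M \<Omega>))"
    by (rule integral_distr[OF mix2_measurable m])
  also have "\<dots> = (\<integral>\<omega>. \<integral>\<omega>'. X (mix2 A B \<omega> \<omega>') \<partial>\<Omega> \<partial>\<Omega>)"
    using PP.integral_fst'[OF i] by simp
  finally show "(\<integral>\<omega>. X \<omega> \<partial>\<Omega>) = (\<integral>\<omega>. \<integral>\<omega>'. X (mix2 A B \<omega> \<omega>') \<partial>\<Omega> \<partial>\<Omega>)" .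
  show "integrable \<Omega> (\<lambda>\<omega>. \<integral>\<omega>'. X (mix2 A B \<omega> \<omega>') \<partial>\<Omega>)"
    using PP.integrable_fst'[OF i] by simp
qed

lemma inner_integrable:
  fixes X Y :: "_ \<Rightarrow> 'c::euclidean_space"
  assumes "X \<in> borel_measurable \<Omega>" "Y \<in> borel_measurable \<Omega>"
    and "integrable \<Omega> (\<lambda>\<omega>. (norm (X \<omega>))\<^sup>2)" "integrable \<Omega> (\<lambda>\<omega>. (norm (Y \<omega>))\<^sup>2)"
  shows "integrable \<Omega> (\<lambda>\<omega>. X \<omega> \<bullet> Y \<omega>)"
proof (rule Bochner_Integration.integrable_bound)
  show "integrable \<Omega> (\<lambda>\<omega>. (norm (X \<omega>))\<^sup>2 + (norm (Y \<omega>))\<^sup>2)"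
    using assms by (intro Bochner_Integration.integrable_add)
  show "AE \<omega> in \<Omega>. norm (X \<omega> \<bullet> Y \<omega>) \<le> norm ((norm (X \<omega>))\<^sup>2 + (norm (Y \<omega>))\<^sup>2)"
  proof (rule AE_I2)
    fix \<omega>
    have "norm (X \<omega> \<bullet> Y \<omega>) \<le> norm (X \<omega>) * norm (Y \<omega>)" by (simp add: Cauchy_Schwarz_ineq2)
    also have "\<dots> \<le> (norm (X \<omega>))\<^sup>2 + (norm (Y \<omega>))\<^sup>2"
      using sum_squares_bound[of "norm (X \<omega>)" "norm (Y \<omega>)"] zero_le_power2[of "norm (X \<omega>)"] zero_le_power2[of "norm (Y \<omega>)"]
        mult_nonneg_nonneg[OF norm_ge_zero[of "X \<omega>"] norm_ge_zero[of "Y \<omega>"]] by linarith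
    finally show "norm (X \<omega> \<bullet> Y \<omega>) \<le> norm ((norm (X \<omega>))\<^sup>2 + (norm (Y \<omega>))\<^sup>2)" by simp
  qed
  show "(\<lambda>\<omega>. X \<omega> \<bullet> Y \<omega>) \<in> borel_measurable \<Omega>" using assms by (intro borel_measurable_inner)
qed

lemma square_integrable_imp_integrable_norm:
  fixes X :: "_ \<Rightarrow> 'c::euclidean_space"
  assumes "X \<in> borel_measurable \<Omega>" "integrable \<Omega> (\<lambda>\<omega>. (norm (X \<omega>))\<^sup>2)"
  shows "integrable \<Omega> X"
  using P.square_integrable_imp_integrable[of "\<lambda>\<omega>. norm (X \<omega>)"] assms by (auto simp: integrable_norm_iff)

lemma expectation_inner_indep:
  fixes X Y :: "_ \<Rightarrow> 'c::euclidean_space"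
  assumes m: "X \<in> borel_measurable \<Omega>" "Y \<in> borel_measurable \<Omega>"
    and i: "integrable \<Omega> (\<lambda>\<omega>. (norm (X \<omega>))\<^sup>2)" "integrable \<Omega> (\<lambda>\<omega>. (norm (Y \<omega>))\<^sup>2)"
    and X: "\<And>\<omega> \<omega>'. X (mix2 A B \<omega> \<omega>') = X \<omega>" and Y: "\<And>\<omega> \<omega>'. Y (mix2 A B \<omega> \<omega>') = Y \<omega>'"
  shows "(\<integral>\<omega>. X \<omega> \<bullet> Y \<omega> \<partial>\<Omega>) = (\<integral>\<omega>. X \<omega> \<partial>\<Omega>) \<bullet> (\<integral>\<omega>. Y \<omega> \<partial>\<Omega>)"
proof -
  have iX: "integrable \<Omega> X" and iY: "integrable \<Omega> Y"
    using m i by (auto intro: square_integrable_imp_integrable_norm)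
  have "(\<integral>\<omega>. X \<omega> \<bullet> Y \<omega> \<partial>\<Omega>) = (\<integral>\<omega>. \<integral>\<omega>'. X \<omega> \<bullet> Y \<omega>' \<partial>\<Omega> \<partial>\<Omega>)"
    using expectation_mix(2)[OF inner_integrable[OF m i], of A B] by (simp add: X Y)
  then show ?thesis by (simp add: iX iY)
qed

text \<open>Sample i owns the coordinates \<open>A i\<close> and \<open>B i\<close>. Resampling them
  leaves every other sample unchanged, so the cross terms of the expanded square have mean zero and
  only s of the s^2 terms remain.\<close>

lemma minibatch_variance:
  fixes Y :: "nat \<Rightarrow> _ \<Rightarrow> 'c::euclidean_space"
  assumes m: "\<And>i. Y i \<in> borel_measurable \<Omega>" and sq: "\<And>i. integrable \<Omega> (\<lambda>\<omega>. (norm (Y i \<omega>))\<^sup>2)"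
    and mean: "\<And>i. (\<integral>\<omega>. Y i \<omega> \<partial>\<Omega>) = 0" and var: "\<And>i. (\<integral>\<omega>. (norm (Y i \<omega>))\<^sup>2 \<partial>\<Omega>) \<le> V"
    and dep: "\<And>i \<omega> \<omega>'. Y i (mix2 (A i) (B i) \<omega> \<omega>') = Y i \<omega>'"
    and indep: "\<And>i j \<omega> \<omega>'. i \<noteq> j \<Longrightarrow> Y j (mix2 (A i) (B i) \<omega> \<omega>') = Y j \<omega>"
    and s: "0 < s"
  shows "integrable \<Omega> (\<lambda>\<omega>. (norm ((1 / real s) *\<^sub>R (\<Sum>i=1..s. Y i \<omega>)))\<^sup>2)"
    and "(\<integral>\<omega>. (norm ((1 / real s) *\<^sub>R (\<Sum>i=1..s. Y i \<omega>)))\<^sup>2 \<partial>\<Omega>) \<le> V / real s"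
proof -
  have eq: "(norm ((1 / real s) *\<^sub>R (\<Sum>i=1..s. Y i \<omega>)))\<^sup>2 = (1 / real s)\<^sup>2 * (\<Sum>i=1..s. \<Sum>j=1..s. Y i \<omega> \<bullet> Y j \<omega>)" for \<omega>
    unfolding power2_norm_eq_inner
    by (simp only: inner_scaleR_left inner_scaleR_right inner_sum_left inner_sum_right
        power2_eq_square mult.assoc) (simp add: sum_distrib_left inner_commute)
  have int: "integrable \<Omega> (\<lambda>\<omega>. Y i \<omega> \<bullet> Y j \<omega>)" for i j
    by (rule inner_integrable[OF m m sq sq])
  show "integrable \<Omega> (\<lambda>\<omega>. (norm ((1 / real s) *\<^sub>R (\<Sum>i=1..s. Y i \<omega>)))\<^sup>2)"
    unfolding eq by (intro integrable_mult_right Bochner_Integration.integrable_sum int)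
  have cross: "(\<integral>\<omega>. Y i \<omega> \<bullet> Y j \<omega> \<partial>\<Omega>) \<le> (if i = j then V else 0)" for i j
  proof (cases "i = j")
    case True
    then show ?thesis using var[of i] by (simp add: power2_norm_eq_inner)
  next
    case False
    have "(\<integral>\<omega>. Y j \<omega> \<bullet> Y i \<omega> \<partial>\<Omega>) = (\<integral>\<omega>. Y j \<omega> \<partial>\<Omega>) \<bullet> (\<integral>\<omega>. Y i \<omega> \<partial>\<Omega>)"
      by (rule expectation_inner_indep[OF m m sq sq indep[OF False] dep])
    then show ?thesis using False by (simp add: mean inner_commute)
  qed
  have "(\<integral>\<omega>. (norm ((1 / real s) *\<^sub>R (\<Sum>i=1..s. Y i \<omega>)))\<^sup>2 \<partial>\<Omega>)
      = (1 / real s)\<^sup>2 * (\<Sum>i=1..s. \<Sum>j=1..s. \<integral>\<omega>. Y i \<omega> \<bullet> Y j \<omega> \<partial>\<Omega>)"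
    unfolding eq by (simp add: int)
  also have "\<dots> \<le> (1 / real s)\<^sup>2 * (\<Sum>i=1..s. \<Sum>j=1..s. if i = j then V else 0)"
    by (intro mult_left_mono sum_mono cross) auto
  also have "\<dots> = V / real s" using s by (simp add: power2_eq_square)
  finally show "(\<integral>\<omega>. (norm ((1 / real s) *\<^sub>R (\<Sum>i=1..s. Y i \<omega>)))\<^sup>2 \<partial>\<Omega>) \<le> V / real s" .
qed

text \<open>Conditionally on everything outside the fresh batch, the batch average has mean zero and is
  orthogonal to \<open>a\<close>.\<close>
lemma fresh_batch_variance:
  fixes a :: "_ \<Rightarrow> 'c::euclidean_space" and N :: "_ \<Rightarrow> _ \<Rightarrow> 'c"
  assumes sq: "integrable \<Omega> (\<lambda>\<omega>. (norm (a \<omega> + N \<omega> (c \<omega>)))\<^sup>2)"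
    and sqa: "integrable \<Omega> (\<lambda>\<omega>. (norm (a \<omega>))\<^sup>2)" and V: "integrable \<Omega> (\<lambda>\<omega>. V (c \<omega>))"
    and a: "\<And>\<omega> \<omega>'. a (mix2 A B \<omega> \<omega>') = a \<omega>" and c: "\<And>\<omega> \<omega>'. c (mix2 A B \<omega> \<omega>') = c \<omega>"
    and N: "\<And>\<omega> \<omega>' p. N (mix2 A B \<omega> \<omega>') p = N \<omega>' p"
    and mN: "\<And>p. (\<lambda>\<omega>. N \<omega> p) \<in> borel_measurable \<Omega>" and sqN: "\<And>p. integrable \<Omega> (\<lambda>\<omega>. (norm (N \<omega> p))\<^sup>2)"
    and mean: "\<And>p. (\<integral>\<omega>. N \<omega> p \<partial>\<Omega>) = 0" and var: "\<And>p. (\<integral>\<omega>. (norm (N \<omega> p))\<^sup>2 \<partial>\<Omega>) \<le> V p"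
  shows "(\<integral>\<omega>. (norm (a \<omega> + N \<omega> (c \<omega>)))\<^sup>2 \<partial>\<Omega>) \<le> (\<integral>\<omega>. (norm (a \<omega>))\<^sup>2 \<partial>\<Omega>) + (\<integral>\<omega>. V (c \<omega>) \<partial>\<Omega>)"
proof -
  have "(\<integral>\<omega>. (norm (a \<omega> + N \<omega> (c \<omega>)))\<^sup>2 \<partial>\<Omega>) = (\<integral>\<omega>. \<integral>\<omega>'. (norm (a \<omega> + N \<omega>' (c \<omega>)))\<^sup>2 \<partial>\<Omega> \<partial>\<Omega>)"
    using expectation_mix(2)[OF sq, of A B] by (simp add: a c N)
  also have "\<dots> \<le> (\<integral>\<omega>. (norm (a \<omega>))\<^sup>2 + V (c \<omega>) \<partial>\<Omega>)"
  proof (rule integral_mono)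
    show "integrable \<Omega> (\<lambda>\<omega>. \<integral>\<omega>'. (norm (a \<omega> + N \<omega>' (c \<omega>)))\<^sup>2 \<partial>\<Omega>)"
      using expectation_mix(3)[OF sq, of A B] by (simp add: a c N)
    fix \<omega>
    have iN: "integrable \<Omega> (\<lambda>\<omega>'. N \<omega>' (c \<omega>))"
      by (rule square_integrable_imp_integrable_norm[OF mN sqN])
    have "(\<integral>\<omega>'. (norm (a \<omega> + N \<omega>' (c \<omega>)))\<^sup>2 \<partial>\<Omega>)
        = (\<integral>\<omega>'. (norm (a \<omega>))\<^sup>2 + 2 * (a \<omega> \<bullet> N \<omega>' (c \<omega>)) + (norm (N \<omega>' (c \<omega>)))\<^sup>2 \<partial>\<Omega>)"
      by (rule Bochner_Integration.integral_cong)
        (simp_all add: power2_norm_eq_inner inner_add_left inner_add_right inner_commute)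
    also have "\<dots> = (norm (a \<omega>))\<^sup>2 + (\<integral>\<omega>'. (norm (N \<omega>' (c \<omega>)))\<^sup>2 \<partial>\<Omega>)"
      using iN sqN[of "c \<omega>"] by (simp add: mean P.prob_space)
    finally show "(\<integral>\<omega>'. (norm (a \<omega> + N \<omega>' (c \<omega>)))\<^sup>2 \<partial>\<Omega>) \<le> (norm (a \<omega>))\<^sup>2 + V (c \<omega>)"
      using var[of "c \<omega>"] by simp
  qed (use sqa V in auto)
  also have "\<dots> = (\<integral>\<omega>. (norm (a \<omega>))\<^sup>2 \<partial>\<Omega>) + (\<integral>\<omega>. V (c \<omega>) \<partial>\<Omega>)"
    using sqa V by simp
  finally show ?thesis .
qed

lemma coordinate_measurable: "(\<lambda>\<omega>. fst \<omega> i) \<in> \<Omega> \<rightarrow>\<^sub>M Dxi" "(\<lambda>\<omega>. snd \<omega> j) \<in> \<Omega> \<rightarrow>\<^sub>M Dzeta"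
  unfolding sample_space_def by measurable

lemma coordinate_space: "\<omega> \<in> space \<Omega> \<Longrightarrow> fst \<omega> i \<in> space Dxi" "\<omega> \<in> space \<Omega> \<Longrightarrow> snd \<omega> j \<in> space Dzeta"
  using measurable_space coordinate_measurable by fast+

lemma distr_coordinate: "distr \<Omega> Dxi (\<lambda>\<omega>. fst \<omega> i) = Dxi" "distr \<Omega> Dzeta (\<lambda>\<omega>. snd \<omega> j) = Dzeta"
proof -
  let ?X = "\<Pi>\<^sub>M _\<in>UNIV :: (nat \<times> nat \<times> nat) set. Dxi" and ?Z = "\<Pi>\<^sub>M _\<in>UNIV :: (nat \<times> nat \<times> nat \<times> nat) set. Dzeta"
  interpret X: prob_space ?X by (rule prob_space_PiM) (rule prob_Dxi)
  interpret Z: prob_space ?Z by (rule prob_space_PiM) (rule prob_Dzeta)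
  interpret XZ: pair_prob_space ?X ?Z ..
  have "distr (distr \<Omega> ?X fst) Dxi (\<lambda>x. x i) = Dxi"
    unfolding sample_space_def Z.distr_pair_fst by (rule distr_PiM_component) (auto intro: prob_Dxi)
  then show "distr \<Omega> Dxi (\<lambda>\<omega>. fst \<omega> i) = Dxi"
    by (subst (asm) distr_distr) (simp_all add: sample_space_def comp_def)
  have "distr \<Omega> ?Z snd = ?Z"
  proof (rule measure_eqI)
    fix A assume "A \<in> sets (distr \<Omega> ?Z snd)"
    then have A: "A \<in> sets ?Z" by simp
    have "emeasure (distr \<Omega> ?Z snd) A = emeasure (?X \<Otimes>\<^sub>M ?Z) (space ?X \<times> A)"
      using sets.sets_into_space[OF A]
      by (subst emeasure_distr) (auto simp: sample_space_def A space_pair_measure intro!: arg_cong2[where f = emeasure])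
    then show "emeasure (distr \<Omega> ?Z snd) A = emeasure ?Z A"
      by (simp add: Z.emeasure_pair_measure_Times A X.emeasure_space_1 del: space_PiM)
  qed simp
  then have "distr (distr \<Omega> ?Z snd) Dzeta (\<lambda>x. x j) = Dzeta"
    using distr_PiM_component[of UNIV "\<lambda>_. Dzeta" j] prob_Dzeta by simp
  then show "distr \<Omega> Dzeta (\<lambda>\<omega>. snd \<omega> j) = Dzeta"
    by (subst (asm) distr_distr) (simp_all add: sample_space_def comp_def)
qed

lemma expectation_coordinate:
  fixes h :: "'xi \<Rightarrow> 'c::{banach, second_countable_topology}" and k :: "'zeta \<Rightarrow> 'c"
  shows "h \<in> borel_measurable Dxi \<Longrightarrow> (\<integral>\<omega>. h (fst \<omega> i) \<partial>\<Omega>) = (\<integral>\<xi>. h \<xi> \<partial>Dxi)"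
    and "k \<in> borel_measurable Dzeta \<Longrightarrow> (\<integral>\<omega>. k (snd \<omega> j) \<partial>\<Omega>) = (\<integral>\<zeta>. k \<zeta> \<partial>Dzeta)"
    and "k \<in> borel_measurable Dzeta \<Longrightarrow> integrable Dzeta k \<Longrightarrow> integrable \<Omega> (\<lambda>\<omega>. k (snd \<omega> j))"
  using integral_distr[OF coordinate_measurable(1), of h i] integral_distr[OF coordinate_measurable(2), of k j]
    integrable_distr[OF coordinate_measurable(2), of j k]
  by (simp_all add: distr_coordinate)

text \<open>Resampling the single coordinate \<open>j\<close>, on which \<open>X\<close> does not
  depend, decouples the random operator from its argument; linearity then lets the mean pass
  through. The mean of the Neumann products follows by repeated use, one sample Hessian at a
  time.\<close>

lemma expectation_random_linear:
  fixes T :: "'zeta \<Rightarrow> 'b::euclidean_space \<Rightarrow> 'c::euclidean_space" and X :: "_ \<Rightarrow> 'b"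
  assumes lin: "\<And>\<zeta>. \<zeta> \<in> space Dzeta \<Longrightarrow> linear (T \<zeta>)" and mT: "\<And>v. (\<lambda>\<zeta>. T \<zeta> v) \<in> borel_measurable Dzeta"
    and bT: "\<And>\<zeta> v. \<zeta> \<in> space Dzeta \<Longrightarrow> norm (T \<zeta> v) \<le> C * norm v" and C: "0 \<le> C"
    and mX: "X \<in> borel_measurable \<Omega>" and bX: "\<And>\<omega>. \<omega> \<in> space \<Omega> \<Longrightarrow> norm (X \<omega>) \<le> K"
    and X: "\<And>\<omega> \<omega>'. X (mix2 {} {j} \<omega> \<omega>') = X \<omega>"
  shows "(\<lambda>\<omega>. T (snd \<omega> j) (X \<omega>)) \<in> borel_measurable \<Omega>"
    and "(\<integral>\<omega>. T (snd \<omega> j) (X \<omega>) \<partial>\<Omega>) = (\<integral>\<zeta>. T \<zeta> (\<integral>\<omega>. X \<omega> \<partial>\<Omega>) \<partial>Dzeta)"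
proof -
  interpret Z: prob_space Dzeta by (rule prob_Dzeta)
  show m: "(\<lambda>\<omega>. T (snd \<omega> j) (X \<omega>)) \<in> borel_measurable \<Omega>"
    by (rule caratheodory_measurable[OF mT _ coordinate_measurable(2) mX])
      (rule linear_continuous_on, simp add: lin linear_conv_bounded_linear[symmetric])
  have "norm (T (snd \<omega> j) (X \<omega>)) \<le> C * K" if "\<omega> \<in> space \<Omega>" for \<omega>
    using bT[OF coordinate_space(2)[OF that]] bX[OF that] C by (meson mult_left_mono order_trans)
  then have i: "integrable \<Omega> (\<lambda>\<omega>. T (snd \<omega> j) (X \<omega>))"
    by (intro P.integrable_const_bound[of _ "C * K"] m AE_I2)
  have iX: "integrable \<Omega> X" using mX bX by (intro P.integrable_const_bound[of _ K] AE_I2)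
  have iT: "integrable Dzeta (\<lambda>\<zeta>. T \<zeta> v)" for v
    by (rule Z.integrable_const_bound[of _ "C * norm v"]) (use mT bT in auto)
  define Tm where "Tm v = (\<integral>\<zeta>. T \<zeta> v \<partial>Dzeta)" for v
  have "linear Tm"
  proof (rule linearI)
    show "Tm (v + w) = Tm v + Tm w" for v w
      unfolding Tm_def Bochner_Integration.integral_add[OF iT iT, symmetric]
      by (rule Bochner_Integration.integral_cong) (auto simp: linear_add[OF lin])
    show "Tm (r *\<^sub>R v) = r *\<^sub>R Tm v" for r v
      unfolding Tm_def integral_scaleR_right[symmetric]
      by (rule Bochner_Integration.integral_cong) (auto simp: linear_cmul[OF lin])
  qed
  then have bl: "bounded_linear Tm" by (simp add: linear_conv_bounded_linear)
  have "(\<integral>\<omega>. T (snd \<omega> j) (X \<omega>) \<partial>\<Omega>) = (\<integral>\<omega>. \<integral>\<omega>'. T (snd \<omega>' j) (X \<omega>) \<partial>\<Omega> \<partial>\<Omega>)"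
    using expectation_mix(2)[OF i, of "{}" "{j}"] by (simp add: X) (simp add: mix2_def mix_def)
  also have "\<dots> = (\<integral>\<omega>. Tm (X \<omega>) \<partial>\<Omega>)"
    by (simp add: expectation_coordinate(2)[OF mT] Tm_def)
  also have "\<dots> = Tm (\<integral>\<omega>. X \<omega> \<partial>\<Omega>)" by (rule integral_bounded_linear[OF bl iX])
  finally show "(\<integral>\<omega>. T (snd \<omega> j) (X \<omega>) \<partial>\<Omega>) = (\<integral>\<zeta>. T \<zeta> (\<integral>\<omega>. X \<omega> \<partial>\<Omega>) \<partial>Dzeta)" by (simp add: Tm_def)
qed

text \<open>The sample gradients of \<open>G\<close> are only assumed to have bounded variance, so
  square integrability of the iterates has to be carried through the recursion. Measurability is
  included to make the predicate closed under the operations of the algorithm.\<close>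

definition L2 :: "(('xi, 'zeta) samples \<Rightarrow> 'c::euclidean_space) \<Rightarrow> bool" where
  "L2 X \<longleftrightarrow> X \<in> borel_measurable \<Omega> \<and> integrable \<Omega> (\<lambda>\<omega>. (norm (X \<omega>))\<^sup>2)"

lemma L2_D: "L2 X \<Longrightarrow> X \<in> borel_measurable \<Omega>" "L2 X \<Longrightarrow> integrable \<Omega> (\<lambda>\<omega>. (norm (X \<omega>))\<^sup>2)"
  by (auto simp: L2_def)

lemma L2_bound:
  fixes X :: "_ \<Rightarrow> 'c::euclidean_space" and Y :: "_ \<Rightarrow> 'd::euclidean_space"
  assumes "L2 X" "Y \<in> borel_measurable \<Omega>" "\<And>\<omega>. \<omega> \<in> space \<Omega> \<Longrightarrow> norm (Y \<omega>) \<le> C * norm (X \<omega>)"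
  shows "L2 Y"
  unfolding L2_def
proof
  show "integrable \<Omega> (\<lambda>\<omega>. (norm (Y \<omega>))\<^sup>2)"
  proof (rule Bochner_Integration.integrable_bound)
    show "integrable \<Omega> (\<lambda>\<omega>. C\<^sup>2 * (norm (X \<omega>))\<^sup>2)" using assms by (simp add: L2_def)
    show "AE \<omega> in \<Omega>. norm ((norm (Y \<omega>))\<^sup>2) \<le> norm (C\<^sup>2 * (norm (X \<omega>))\<^sup>2)"
      using assms(3) power_mono[OF _ norm_ge_zero, of _ _ 2] by (intro AE_I2) (fastforce simp: power_mult_distrib)
  qed (use assms in measurable)
qed fact

lemma L2_bounded:
  fixes Y :: "_ \<Rightarrow> 'd::euclidean_space"
  assumes "Y \<in> borel_measurable \<Omega>" "\<And>\<omega>. \<omega> \<in> space \<Omega> \<Longrightarrow> norm (Y \<omega>) \<le> C"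
  shows "L2 Y"
  by (rule L2_bound[of "\<lambda>_. 1::real"]) (use assms in \<open>auto simp: L2_def\<close>)

lemma L2_const: "L2 (\<lambda>_. c)"
  by (rule L2_bounded) auto

lemma L2_scaleR: "L2 X \<Longrightarrow> L2 (\<lambda>\<omega>. r *\<^sub>R X \<omega>)"
  by (rule L2_bound[of X _ "\<bar>r\<bar>"]) (auto simp: L2_def)

lemma L2_add:
  fixes X Y :: "_ \<Rightarrow> 'c::euclidean_space"
  assumes X: "L2 X" and Y: "L2 Y"
  shows "L2 (\<lambda>\<omega>. X \<omega> + Y \<omega>)"
  unfolding L2_def
proof
  have eq: "(norm (X \<omega> + Y \<omega>))\<^sup>2 = (norm (X \<omega>))\<^sup>2 + 2 * (X \<omega> \<bullet> Y \<omega>) + (norm (Y \<omega>))\<^sup>2" for \<omega>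
    by (simp add: power2_norm_eq_inner inner_add_left inner_add_right inner_commute)
  show "integrable \<Omega> (\<lambda>\<omega>. (norm (X \<omega> + Y \<omega>))\<^sup>2)"
    unfolding eq using X Y inner_integrable[of X Y] by (auto simp: L2_def)
qed (use assms in \<open>auto simp: L2_def\<close>)

lemma L2_diff:
  fixes X Y :: "_ \<Rightarrow> 'c::euclidean_space"
  assumes "L2 X" "L2 Y"
  shows "L2 (\<lambda>\<omega>. X \<omega> - Y \<omega>)"
  using L2_add[OF assms(1) L2_scaleR[OF assms(2), of "-1"]] by simp

lemma L2_sum:
  fixes X :: "'i \<Rightarrow> _ \<Rightarrow> 'c::euclidean_space"
  assumes "\<And>i. L2 (X i)"
  shows "L2 (\<lambda>\<omega>. \<Sum>i\<in>I. X i \<omega>)"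
  by (induction I rule: infinite_finite_induct) (auto intro: L2_const L2_add assms)

lemma L2_Pair:
  fixes X :: "_ \<Rightarrow> 'c::euclidean_space" and Y :: "_ \<Rightarrow> 'd::euclidean_space"
  assumes "L2 X" "L2 Y"
  shows "L2 (\<lambda>\<omega>. (X \<omega>, Y \<omega>))"
  using assms by (auto simp: L2_def norm_Pair)

lemma L2_fst_snd:
  fixes X :: "_ \<Rightarrow> 'c::euclidean_space \<times> 'd::euclidean_space"
  assumes "L2 X"
  shows "L2 (\<lambda>\<omega>. fst (X \<omega>))" "L2 (\<lambda>\<omega>. snd (X \<omega>))"
proof -
  have m: "X \<in> borel_measurable \<Omega>" using assms by (rule L2_D)
  show "L2 (\<lambda>\<omega>. fst (X \<omega>))"
    by (rule L2_bound[OF assms measurable_compose[OF m borel_measurable_fst_snd(1)], of 1]) (simp add: norm_fst_snd_le)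
  show "L2 (\<lambda>\<omega>. snd (X \<omega>))"
    by (rule L2_bound[OF assms measurable_compose[OF m borel_measurable_fst_snd(2)], of 1]) (simp add: norm_fst_snd_le)
qed

lemma variance_le:
  fixes X :: "_ \<Rightarrow> 'c::euclidean_space"
  assumes X: "L2 X" and d: "(\<integral>\<omega>. X \<omega> \<partial>\<Omega>) = d"
  shows "(\<integral>\<omega>. (norm (X \<omega> - d))\<^sup>2 \<partial>\<Omega>) \<le> (\<integral>\<omega>. (norm (X \<omega>))\<^sup>2 \<partial>\<Omega>)"
proof -
  have iX: "integrable \<Omega> X" using L2_D[OF X] by (rule square_integrable_imp_integrable_norm)
  have "(norm (X \<omega> - d))\<^sup>2 = (norm (X \<omega>))\<^sup>2 - 2 * (X \<omega> \<bullet> d) + (norm d)\<^sup>2" for \<omega>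
    by (simp add: power2_norm_eq_inner inner_diff_left inner_diff_right inner_commute)
  then have "(\<integral>\<omega>. (norm (X \<omega> - d))\<^sup>2 \<partial>\<Omega>) = (\<integral>\<omega>. (norm (X \<omega>))\<^sup>2 \<partial>\<Omega>) - 2 * ((\<integral>\<omega>. X \<omega> \<partial>\<Omega>) \<bullet> d) + (norm d)\<^sup>2"
    using L2_D(2)[OF X] iX by (simp add: P.prob_space)
  then show ?thesis unfolding d by (simp add: power2_norm_eq_inner)
qed

definition fresh_xi :: "nat \<Rightarrow> nat \<Rightarrow> (nat \<times> nat \<times> nat) set" where
  "fresh_xi k b = {(k, b, i) | i. True}"
definition fresh_zeta :: "nat \<Rightarrow> nat \<Rightarrow> (nat \<times> nat \<times> nat \<times> nat) set" where
  "fresh_zeta k b = {(k, b, i, j) | i j. True}"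

end

text \<open>Both estimators of the algorithm average samples that have the right mean, are Lipschitz
  along every path and have bounded variance. The batch arguments rest on these properties, so they
  are carried out once and instantiated for the hypergradient and for \<open>grad_y\<close>.\<close>

locale sample_estimator = sampling Dxi Dzeta
  for Dxi :: "'xi measure" and Dzeta :: "'zeta measure" +
  fixes Y :: "'xi \<Rightarrow> (nat \<Rightarrow> 'zeta) \<Rightarrow> 'p::euclidean_space \<Rightarrow> 'd::euclidean_space"
    and mY :: "'p \<Rightarrow> 'd" and C V :: real
  assumes Y_L2: "\<And>k b i z. L2 (\<lambda>\<omega>. Y (fst \<omega> (k, b, i)) (\<lambda>j. snd \<omega> (k, b, i, j)) z)"
    and Y_mean: "\<And>k b i z. (\<integral>\<omega>. Y (fst \<omega> (k, b, i)) (\<lambda>j. snd \<omega> (k, b, i, j)) z \<partial>\<Omega>) = mY z"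
    and Y_lipschitz: "\<And>\<xi> \<zeta>s z z'. \<xi> \<in> space Dxi \<Longrightarrow> (\<And>j. \<zeta>s j \<in> space Dzeta) \<Longrightarrow>
      norm (Y \<xi> \<zeta>s z - Y \<xi> \<zeta>s z') \<le> C * norm (z - z')"
    and Y_variance: "\<And>k b i z. (\<integral>\<omega>. (norm (Y (fst \<omega> (k, b, i)) (\<lambda>j. snd \<omega> (k, b, i, j)) z - mY z))\<^sup>2 \<partial>\<Omega>) \<le> V"
    and C_nonneg: "0 \<le> C"
begin

definition "one k b i \<omega> z = Y (fst \<omega> (k, b, i)) (\<lambda>j. snd \<omega> (k, b, i, j)) z"
definition "est k b s \<omega> z = (1 / real s) *\<^sub>R (\<Sum>i=1..s. one k b i \<omega> z)"

lemma one_L2: "L2 (\<lambda>\<omega>. one k b i \<omega> z)" and one_mean: "(\<integral>\<omega>. one k b i \<omega> z \<partial>\<Omega>) = mY z"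
  unfolding one_def by (rule Y_L2, rule Y_mean)

lemma one_integrable: "integrable \<Omega> (\<lambda>\<omega>. one k b i \<omega> z)"
  using L2_D[OF one_L2] by (rule square_integrable_imp_integrable_norm)

lemma one_lipschitz:
  "\<omega> \<in> space \<Omega> \<Longrightarrow> norm (one k b i \<omega> z - one k b i \<omega> z') \<le> C * norm (z - z')"
  unfolding one_def by (intro Y_lipschitz coordinate_space)

lemma mY_lipschitz: "norm (mY z - mY z') \<le> C * norm (z - z')"
proof -
  have "mY z - mY z' = (\<integral>\<omega>. one 0 0 0 \<omega> z - one 0 0 0 \<omega> z' \<partial>\<Omega>)"
    by (simp add: one_integrable one_mean)
  also have "norm \<dots> \<le> (\<integral>\<omega>. norm (one 0 0 0 \<omega> z - one 0 0 0 \<omega> z') \<partial>\<Omega>)"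
    by (rule integral_norm_bound)
  also have "\<dots> \<le> (\<integral>\<omega>. C * norm (z - z') \<partial>\<Omega>)"
    by (intro integral_mono integrable_norm Bochner_Integration.integrable_diff one_integrable one_lipschitz) auto
  finally show ?thesis by (simp add: P.prob_space)
qed

lemma est_lipschitz:
  assumes "\<omega> \<in> space \<Omega>"
  shows "norm (est k b s \<omega> z - est k b s \<omega> z') \<le> C * norm (z - z')"
proof -
  have "norm (\<Sum>i=1..s. one k b i \<omega> z - one k b i \<omega> z') \<le> (\<Sum>i=1..s. C * norm (z - z'))"
    by (intro sum_norm_le one_lipschitz assms)
  also have "\<dots> = real s * (C * norm (z - z'))" by simp
  finally have "1 / real s * norm (\<Sum>i=1..s. one k b i \<omega> z - one k b i \<omega> z') \<le> 1 / real s * (real s * (C * norm (z - z')))"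
    by (intro mult_left_mono) auto
  \<comment> \<open>For \<open>s = 0\<close> the factor \<open>1 / real s\<close> is 0 and the claim
    reduces to nonnegativity of the right side.\<close>
  also have "\<dots> \<le> C * norm (z - z')" using C_nonneg by (cases "s = 0") auto
  finally show ?thesis by (simp add: est_def sum_subtractf scaleR_diff_right[symmetric])
qed

lemma est_L2: "L2 (\<lambda>\<omega>. est k b s \<omega> z)"
  unfolding est_def by (intro L2_scaleR L2_sum one_L2)

lemma continuous_lipschitz:
  fixes h :: "'p \<Rightarrow> 'd"
  assumes "\<And>z z'. norm (h z - h z') \<le> C * norm (z - z')"
  shows "continuous_on UNIV h"
  by (rule lipschitz_on_continuous_on[of C]) (use assms C_nonneg in \<open>auto intro!: lipschitz_onI simp: dist_norm\<close>)

lemma mY_measurable: "mY \<in> borel_measurable borel"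
  by (intro borel_measurable_continuous_onI continuous_lipschitz mY_lipschitz)

lemma est_measurable:
  assumes "c \<in> borel_measurable \<Omega>"
  shows "(\<lambda>\<omega>. est k b s \<omega> (c \<omega>)) \<in> borel_measurable \<Omega>"
  by (rule caratheodory_measurable[where p = "\<lambda>\<omega>. \<omega>", OF L2_D(1)[OF est_L2] continuous_lipschitz _ assms])
    (auto intro: est_lipschitz)

lemma est_diff_L2:
  assumes "L2 (\<lambda>\<omega>. c \<omega> - d \<omega>)" "c \<in> borel_measurable \<Omega>" "d \<in> borel_measurable \<Omega>"
  shows "L2 (\<lambda>\<omega>. est k b s \<omega> (c \<omega>) - est k b s \<omega> (d \<omega>))"
  by (rule L2_bound[OF assms(1)]) (intro borel_measurable_diff est_measurable assms, rule est_lipschitz)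

lemma mY_diff_L2:
  assumes "L2 (\<lambda>\<omega>. c \<omega> - d \<omega>)" "c \<in> borel_measurable \<Omega>" "d \<in> borel_measurable \<Omega>"
  shows "L2 (\<lambda>\<omega>. mY (c \<omega>) - mY (d \<omega>))"
  by (rule L2_bound[OF assms(1)])
    (intro borel_measurable_diff measurable_compose[OF _ mY_measurable] assms, rule mY_lipschitz)

lemma est_at_L2:
  assumes "L2 c"
  shows "L2 (\<lambda>\<omega>. est k b s \<omega> (c \<omega>))"
proof -
  have "L2 (\<lambda>\<omega>. est k b s \<omega> (c \<omega>) - est k b s \<omega> 0)"
    using assms L2_D(1)[OF assms] by (intro est_diff_L2) auto
  from L2_add[OF this est_L2[of k b s 0]] show ?thesis by simp
qed

lemma mY_at_L2:
  assumes "L2 c"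
  shows "L2 (\<lambda>\<omega>. mY (c \<omega>))"
proof -
  have "L2 (\<lambda>\<omega>. mY (c \<omega>) - mY 0)"
    using assms L2_D(1)[OF assms] by (intro mY_diff_L2) auto
  from L2_add[OF this L2_const[of "mY 0"]] show ?thesis by simp
qed

lemma one_mix:
  "one k b i (mix2 {(k, b, i)} {(k, b, i, j) | j. True} \<omega> \<omega>') z = one k b i \<omega>' z"
  "i \<noteq> i' \<Longrightarrow> one k b i' (mix2 {(k, b, i)} {(k, b, i, j) | j. True} \<omega> \<omega>') z = one k b i' \<omega> z"
  by (simp_all add: one_def mix2_def mix_def)

lemma est_mix: "est k b s (mix2 (fresh_xi k b) (fresh_zeta k b) \<omega> \<omega>') z = est k b s \<omega>' z"
  by (simp add: est_def one_def mix2_def mix_def fresh_xi_def fresh_zeta_def)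

lemma centered_batch:
  assumes s: "0 < s"
  shows "integrable \<Omega> (\<lambda>\<omega>. (norm (est k b s \<omega> z - mY z))\<^sup>2)"
    and "(\<integral>\<omega>. (norm (est k b s \<omega> z - mY z))\<^sup>2 \<partial>\<Omega>) \<le> V / real s"
    and "(\<integral>\<omega>. est k b s \<omega> z - mY z \<partial>\<Omega>) = 0"
proof -
  let ?N = "\<lambda>i \<omega>. one k b i \<omega> z - mY z"
  have L: "L2 (?N i)" for i by (intro L2_diff one_L2 L2_const)
  have eq: "est k b s \<omega> z - mY z = (1 / real s) *\<^sub>R (\<Sum>i=1..s. ?N i \<omega>)" for \<omega>
    using s by (simp add: est_def sum_subtractf scaleR_diff_right sum_constant_scaleR)
  have var: "(\<integral>\<omega>. (norm (?N i \<omega>))\<^sup>2 \<partial>\<Omega>) \<le> V" for i unfolding one_def by (rule Y_variance)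
  have mean: "(\<integral>\<omega>. ?N i \<omega> \<partial>\<Omega>) = 0" for i by (simp add: one_integrable one_mean P.prob_space)
  have dep: "?N i (mix2 {(k, b, i)} {(k, b, i, j) | j. True} \<omega> \<omega>') = ?N i \<omega>'" for i \<omega> \<omega>'
    by (simp only: one_mix(1))
  have indep: "?N i' (mix2 {(k, b, i)} {(k, b, i, j) | j. True} \<omega> \<omega>') = ?N i' \<omega>" if "i \<noteq> i'" for i i' \<omega> \<omega>'
    by (simp only: one_mix(2)[OF that])
  note mb = minibatch_variance[of ?N, OF L2_D(1)[OF L] L2_D(2)[OF L] mean var dep indep s]
  show "integrable \<Omega> (\<lambda>\<omega>. (norm (est k b s \<omega> z - mY z))\<^sup>2)" unfolding eq by (rule mb)
  show "(\<integral>\<omega>. (norm (est k b s \<omega> z - mY z))\<^sup>2 \<partial>\<Omega>) \<le> V / real s" unfolding eq by (rule mb)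
  show "(\<integral>\<omega>. est k b s \<omega> z - mY z \<partial>\<Omega>) = 0" unfolding eq
    by (simp add: one_integrable one_mean P.prob_space)
qed

text \<open>The same samples are used at both points, so the variance is at most the second moment
  of a Lipschitz difference: it is proportional to the squared distance of the points instead of to
  \<open>V\<close>. This is the variance reduction.\<close>

lemma centered_batch_diff:
  assumes s: "0 < s"
  shows "integrable \<Omega> (\<lambda>\<omega>. (norm (est k b s \<omega> z - est k b s \<omega> z' - (mY z - mY z')))\<^sup>2)"
    and "(\<integral>\<omega>. (norm (est k b s \<omega> z - est k b s \<omega> z' - (mY z - mY z')))\<^sup>2 \<partial>\<Omega>) \<le> C\<^sup>2 * (norm (z - z'))\<^sup>2 / real s"
    and "(\<integral>\<omega>. est k b s \<omega> z - est k b s \<omega> z' - (mY z - mY z') \<partial>\<Omega>) = 0"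
proof -
  let ?D = "\<lambda>i \<omega>. one k b i \<omega> z - one k b i \<omega> z'" and ?d = "mY z - mY z'"
  let ?N = "\<lambda>i \<omega>. ?D i \<omega> - ?d"
  have LD: "L2 (?D i)" for i by (intro L2_diff one_L2)
  have L: "L2 (?N i)" for i by (intro L2_diff one_L2 L2_const)
  have eq: "est k b s \<omega> z - est k b s \<omega> z' - ?d = (1 / real s) *\<^sub>R (\<Sum>i=1..s. ?N i \<omega>)" for \<omega>
    using s by (simp add: est_def sum_subtractf scaleR_diff_right sum_constant_scaleR)
  have mD: "(\<integral>\<omega>. ?D i \<omega> \<partial>\<Omega>) = ?d" for i by (simp add: one_integrable one_mean)
  have mean: "(\<integral>\<omega>. ?N i \<omega> \<partial>\<Omega>) = 0" for i by (simp add: one_integrable one_mean P.prob_space)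
  have var: "(\<integral>\<omega>. (norm (?N i \<omega>))\<^sup>2 \<partial>\<Omega>) \<le> C\<^sup>2 * (norm (z - z'))\<^sup>2" for i
  proof -
    have "(\<integral>\<omega>. (norm (?N i \<omega>))\<^sup>2 \<partial>\<Omega>) \<le> (\<integral>\<omega>. (norm (?D i \<omega>))\<^sup>2 \<partial>\<Omega>)"
      by (rule variance_le[OF LD mD])
    also have "\<dots> \<le> (\<integral>\<omega>. C\<^sup>2 * (norm (z - z'))\<^sup>2 \<partial>\<Omega>)"
    proof (rule integral_mono[OF L2_D(2)[OF LD]])
      show "(norm (?D i \<omega>))\<^sup>2 \<le> C\<^sup>2 * (norm (z - z'))\<^sup>2" if "\<omega> \<in> space \<Omega>" for \<omega>
        using power_mono[OF one_lipschitz[OF that, of k b i z z'] norm_ge_zero, of 2] by (simp add: power_mult_distrib)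
    qed simp
    finally show ?thesis by (simp add: P.prob_space)
  qed
  have dep: "?N i (mix2 {(k, b, i)} {(k, b, i, j) | j. True} \<omega> \<omega>') = ?N i \<omega>'" for i \<omega> \<omega>'
    by (simp only: one_mix(1))
  have indep: "?N i' (mix2 {(k, b, i)} {(k, b, i, j) | j. True} \<omega> \<omega>') = ?N i' \<omega>" if "i \<noteq> i'" for i i' \<omega> \<omega>'
    by (simp only: one_mix(2)[OF that])
  note mb = minibatch_variance[of ?N, OF L2_D(1)[OF L] L2_D(2)[OF L] mean var dep indep s]
  show "integrable \<Omega> (\<lambda>\<omega>. (norm (est k b s \<omega> z - est k b s \<omega> z' - ?d))\<^sup>2)"
    unfolding eq by (rule mb)
  show "(\<integral>\<omega>. (norm (est k b s \<omega> z - est k b s \<omega> z' - ?d))\<^sup>2 \<partial>\<Omega>) \<le> C\<^sup>2 * (norm (z - z'))\<^sup>2 / real s"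
    unfolding eq by (rule mb)
  show "(\<integral>\<omega>. est k b s \<omega> z - est k b s \<omega> z' - ?d \<partial>\<Omega>) = 0" unfolding eq
    by (simp add: one_integrable one_mean P.prob_space)
qed

lemma large_batch_error:
  assumes s: "0 < s" and c: "L2 c" and fresh: "\<And>\<omega> \<omega>'. c (mix2 (fresh_xi k b) (fresh_zeta k b) \<omega> \<omega>') = c \<omega>"
  shows "(\<integral>\<omega>. (norm (est k b s \<omega> (c \<omega>) - mY (c \<omega>)))\<^sup>2 \<partial>\<Omega>) \<le> V / real s"
proof -
  have "(\<integral>\<omega>. (norm (0 + (est k b s \<omega> (c \<omega>) - mY (c \<omega>))))\<^sup>2 \<partial>\<Omega>) \<le> (\<integral>\<omega>. (norm (0::'d))\<^sup>2 \<partial>\<Omega>) + (\<integral>\<omega>. V / real s \<partial>\<Omega>)"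
  proof (rule fresh_batch_variance[where a = "\<lambda>_. 0" and N = "\<lambda>\<omega> z. est k b s \<omega> z - mY z" and c = c
        and A = "fresh_xi k b" and B = "fresh_zeta k b" and V = "\<lambda>_. V / real s"])
    show "integrable \<Omega> (\<lambda>\<omega>. (norm (0 + (est k b s \<omega> (c \<omega>) - mY (c \<omega>))))\<^sup>2)"
      using L2_D(2)[OF L2_diff[OF est_at_L2[OF c] mY_at_L2[OF c]]] by simp
    show "(\<lambda>\<omega>. est k b s \<omega> z - mY z) \<in> borel_measurable \<Omega>" for z
      by (intro L2_D L2_diff est_L2 L2_const)
  qed (use s in \<open>auto simp: est_mix fresh centered_batch\<close>)
  then show ?thesis by (simp add: P.prob_space)
qed

text \<open>The new error is the old error plus a centered increment of the fresh batch. The two are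
  orthogonal in mean, so the squares add with coefficient 1 and errors accumulate over an epoch
  without amplification.\<close>

lemma recursive_batch_error:
  assumes s: "0 < s" and v: "L2 v" and c: "L2 c" and d: "L2 d"
    and fresh: "\<And>\<omega> \<omega>'. v (mix2 (fresh_xi k b) (fresh_zeta k b) \<omega> \<omega>') = v \<omega>"
      "\<And>\<omega> \<omega>'. c (mix2 (fresh_xi k b) (fresh_zeta k b) \<omega> \<omega>') = c \<omega>"
      "\<And>\<omega> \<omega>'. d (mix2 (fresh_xi k b) (fresh_zeta k b) \<omega> \<omega>') = d \<omega>"
  shows "(\<integral>\<omega>. (norm (v \<omega> + est k b s \<omega> (c \<omega>) - est k b s \<omega> (d \<omega>) - mY (c \<omega>)))\<^sup>2 \<partial>\<Omega>)
    \<le> (\<integral>\<omega>. (norm (v \<omega> - mY (d \<omega>)))\<^sup>2 \<partial>\<Omega>) + C\<^sup>2 / real s * (\<integral>\<omega>. (norm (c \<omega> - d \<omega>))\<^sup>2 \<partial>\<Omega>)"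
proof -
  let ?a = "\<lambda>\<omega>. v \<omega> - mY (d \<omega>)"
  let ?N = "\<lambda>\<omega> p. est k b s \<omega> (fst p) - est k b s \<omega> (snd p) - (mY (fst p) - mY (snd p))"
  have eq: "v \<omega> + est k b s \<omega> (c \<omega>) - est k b s \<omega> (d \<omega>) - mY (c \<omega>) = ?a \<omega> + ?N \<omega> (c \<omega>, d \<omega>)" for \<omega> by simp
  have "(\<integral>\<omega>. (norm (?a \<omega> + ?N \<omega> (c \<omega>, d \<omega>)))\<^sup>2 \<partial>\<Omega>)
      \<le> (\<integral>\<omega>. (norm (?a \<omega>))\<^sup>2 \<partial>\<Omega>) + (\<integral>\<omega>. (\<lambda>p. C\<^sup>2 * (norm (fst p - snd p))\<^sup>2 / real s) (c \<omega>, d \<omega>) \<partial>\<Omega>)"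
  proof (rule fresh_batch_variance[where a = ?a and N = ?N and c = "\<lambda>\<omega>. (c \<omega>, d \<omega>)"
        and A = "fresh_xi k b" and B = "fresh_zeta k b" and V = "\<lambda>p. C\<^sup>2 * (norm (fst p - snd p))\<^sup>2 / real s"])
    show "integrable \<Omega> (\<lambda>\<omega>. (norm (?a \<omega> + ?N \<omega> (c \<omega>, d \<omega>)))\<^sup>2)"
      by (intro L2_D(2) L2_add L2_diff v mY_at_L2 est_at_L2 c d) (simp_all add: c d)
    show "integrable \<Omega> (\<lambda>\<omega>. (norm (?a \<omega>))\<^sup>2)"
      by (intro L2_D(2) L2_diff v mY_at_L2 d)
    show "integrable \<Omega> (\<lambda>\<omega>. (\<lambda>p. C\<^sup>2 * (norm (fst p - snd p))\<^sup>2 / real s) (c \<omega>, d \<omega>))"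
      using L2_D(2)[OF L2_diff[OF c d]] by simp
    show "(\<lambda>\<omega>. ?N \<omega> p) \<in> borel_measurable \<Omega>" for p
      by (intro L2_D(1) L2_diff est_L2 L2_const)
  qed (use s in \<open>auto simp: est_mix fresh centered_batch_diff\<close>)
  then show ?thesis unfolding eq by simp
qed

end

section \<open>Expected gradients, Hessian blocks and convexity\<close>

lemma (in prob_space) expectation_norm_le:
  fixes X :: "'a \<Rightarrow> 'd::{banach, second_countable_topology}"
  assumes "X \<in> borel_measurable M" "\<And>s. s \<in> space M \<Longrightarrow> norm (X s) \<le> C"
  shows "integrable M X" "norm (\<integral>s. X s \<partial>M) \<le> C"
proof -
  show i: "integrable M X"
    by (rule integrable_const_bound[of _ C]) (use assms in auto)
  have "norm (\<integral>s. X s \<partial>M) \<le> (\<integral>s. norm (X s) \<partial>M)" by (rule integral_norm_bound)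
  also have "\<dots> \<le> (\<integral>s. C \<partial>M)" by (intro integral_mono integrable_norm i) (auto intro: assms)
  finally show "norm (\<integral>s. X s \<partial>M) \<le> C" by (simp add: prob_space)
qed

locale vrbo_problem = stochastic_bilevel \<mu> M L \<tau> \<rho> \<sigma> Dxi Dzeta F G
  for \<mu> M L \<tau> \<rho> \<sigma> :: real and Dxi :: "'xi measure" and Dzeta :: "'zeta measure"
    and F :: "'xi \<Rightarrow> 'a::euclidean_space \<times> 'b::euclidean_space \<Rightarrow> real"
    and G :: "'zeta \<Rightarrow> 'a \<times> 'b \<Rightarrow> real" +
  fixes \<eta> :: real
  assumes mu_pos: "0 < \<mu>" and eta_pos: "0 < \<eta>" and eta_L: "\<eta> * L \<le> 1"
begin

sublocale xi: prob_space Dxi by (rule prob_xi)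
sublocale zeta: prob_space Dzeta by (rule prob_zeta)

definition "f = mean_fun Dxi F"
definition "g = mean_fun Dzeta G"
definition "mean_Fx z = (\<integral>\<xi>. grad_x (F \<xi>) z \<partial>Dxi)"
definition "mean_Fy z = (\<integral>\<xi>. grad_y (F \<xi>) z \<partial>Dxi)"
definition "mean_Gy z = (\<integral>\<zeta>. grad_y (G \<zeta>) z \<partial>Dzeta)"
definition "mean_Hyy z b = (\<integral>\<zeta>. blinfun_apply (hess_yy (G \<zeta>) z) b \<partial>Dzeta)"
definition "mean_Hxy z b = (\<integral>\<zeta>. blinfun_apply (hess_xy (G \<zeta>) z) b \<partial>Dzeta)"
definition "neumann_step z b = b - \<eta> *\<^sub>R mean_Hyy z b"

lemma L_pos: "0 < L" using mu_pos mu_le_L by simp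

lemma eta_mu: "0 < \<eta> * \<mu>" "\<eta> * \<mu> \<le> 1"
proof -
  show "0 < \<eta> * \<mu>" using mu_pos eta_pos by simp
  show "\<eta> * \<mu> \<le> 1" using eta_pos eta_L mult_left_mono[OF mu_le_L, of \<eta>] by linarith
qed

lemma integrable_gradients:
  "integrable Dxi (\<lambda>\<xi>. grad_x (F \<xi>) z)" "integrable Dxi (\<lambda>\<xi>. grad_y (F \<xi>) z)"
  "integrable Dzeta (\<lambda>\<zeta>. blinfun_apply (hess_yy (G \<zeta>) z) b)"
  "integrable Dzeta (\<lambda>\<zeta>. blinfun_apply (hess_xy (G \<zeta>) z) b)"
  by (rule xi.expectation_norm_le[OF partial_measurable(1) partial_F_bound(1)], assumption)
    (rule xi.expectation_norm_le[OF partial_measurable(2) partial_F_bound(2)], assumption,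
     rule zeta.expectation_norm_le[OF hess_measurable(1) hess_bound(1)], assumption,
     rule zeta.expectation_norm_le[OF hess_measurable(2) hess_bound(2)], assumption)

text \<open>A square integrable deviation from a fixed vector makes the gradient integrable. That
  this vector is the mean of the sample gradients is derived only afterwards, in
  \<open>gradient_g\<close>.\<close>

lemma integrable_grad_G: "integrable Dzeta (\<lambda>\<zeta>. gradient (G \<zeta>) z)"
proof -
  let ?X = "\<lambda>\<zeta>. gradient (G \<zeta>) z - gradient (mean_fun Dzeta G) z"
  have m: "?X \<in> borel_measurable Dzeta" by (intro borel_measurable_diff grad_G_measurable) auto
  have "integrable Dzeta (\<lambda>\<zeta>. norm (?X \<zeta>))"
    by (rule zeta.square_integrable_imp_integrable) (use m variance_integrable[of z] in auto)
  then have "integrable Dzeta ?X" using m integrable_norm_iff by blast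
  then have "integrable Dzeta (\<lambda>\<zeta>. ?X \<zeta> + gradient (mean_fun Dzeta G) z)"
    by (intro Bochner_Integration.integrable_add) auto
  then show ?thesis by simp
qed

lemma integrable_grad_y_G: "integrable Dzeta (\<lambda>\<zeta>. grad_y (G \<zeta>) z)"
proof -
  have "integrable Dzeta (\<lambda>\<zeta>. snd (gradient (G \<zeta>) z))"
    using integrable_grad_G by (rule integrable_snd)
  then show ?thesis using grad_y_G by (simp cong: Bochner_Integration.integrable_cong)
qed

lemma gradient_g: "gradient g z = (\<integral>\<zeta>. gradient (G \<zeta>) z \<partial>Dzeta)"
proof (rule gradient_eqI)
  have "((\<lambda>z. \<integral>\<zeta>. G \<zeta> z \<partial>Dzeta) has_derivative (\<lambda>a. \<integral>\<zeta>. a \<bullet> gradient (G \<zeta>) z \<partial>Dzeta)) (at z)"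
  proof (rule zeta.has_derivative_expectation)
    show "norm (G \<zeta> (z + a) - G \<zeta> z - a \<bullet> gradient (G \<zeta>) z) \<le> L * (norm a)\<^sup>2" if "\<zeta> \<in> space Dzeta" for \<zeta> a
    proof (rule taylor_lipschitz[OF G_deriv[OF that]])
      show "norm (a \<bullet> gradient (G \<zeta>) z - a \<bullet> gradient (G \<zeta>) z') \<le> L * norm (z - z') * norm a" for z z' a
        using lipschitz_onD[OF grad_G_lipschitz[OF that], of z z']
          order_trans[OF Cauchy_Schwarz_ineq2[of a "gradient (G \<zeta>) z - gradient (G \<zeta>) z'"]] 
        by (simp add: dist_norm inner_diff_right mult.commute[of "norm a"] mult_right_mono)
    qed (rule constants_nonneg)
    show "linear (\<lambda>a. a \<bullet> gradient (G \<zeta>) z)" for \<zeta>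
      by (simp add: bounded_linear.linear bounded_linear_inner_left)
  qed (auto intro: G_integrable integrable_grad_G)
  then show "(g has_derivative (\<lambda>a. a \<bullet> (\<integral>\<zeta>. gradient (G \<zeta>) z \<partial>Dzeta))) (at z)"
    by (simp add: integrable_grad_G g_def mean_fun_def[abs_def])
qed

lemma mean_Gy_eq: "mean_Gy z = snd (gradient g z)"
proof -
  have "mean_Gy z = (\<integral>\<zeta>. snd (gradient (G \<zeta>) z) \<partial>Dzeta)"
    unfolding mean_Gy_def by (rule Bochner_Integration.integral_cong) (auto simp: grad_y_G)
  also have "\<dots> = snd (\<integral>\<zeta>. gradient (G \<zeta>) z \<partial>Dzeta)"
    by (rule integral_snd) (rule integrable_grad_G)
  finally show ?thesis by (simp add: gradient_g)
qed

lemma f_taylor: "\<bar>f (z + c) - f z - (fst c \<bullet> mean_Fx z + snd c \<bullet> mean_Fy z)\<bar> \<le> L * (norm c)\<^sup>2"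
proof -
  have "norm ((\<integral>\<xi>. F \<xi> (z + c) \<partial>Dxi) - (\<integral>\<xi>. F \<xi> z \<partial>Dxi) - (\<integral>\<xi>. fst c \<bullet> grad_x (F \<xi>) z + snd c \<bullet> grad_y (F \<xi>) z \<partial>Dxi))
    \<le> L * (norm c)\<^sup>2"
  proof (rule xi.expectation_taylor)
    show "norm (F \<xi> (z + c) - F \<xi> z - (fst c \<bullet> grad_x (F \<xi>) z + snd c \<bullet> grad_y (F \<xi>) z)) \<le> L * (norm c)\<^sup>2"
      if "\<xi> \<in> space Dxi" for \<xi> c
    proof -
      have "norm (F \<xi> (z + c) - F \<xi> z - c \<bullet> gradient (F \<xi>) z) \<le> L * (norm c)\<^sup>2"
      proof (rule taylor_lipschitz[OF F_deriv[OF that]])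
        show "norm (a \<bullet> gradient (F \<xi>) z - a \<bullet> gradient (F \<xi>) z') \<le> L * norm (z - z') * norm a" for z z' a
          using lipschitz_onD[OF grad_F_lipschitz[OF that], of z z']
            order_trans[OF Cauchy_Schwarz_ineq2[of a "gradient (F \<xi>) z - gradient (F \<xi>) z'"]] 
          by (simp add: dist_norm inner_diff_right mult.commute[of "norm a"] mult_right_mono)
      qed (rule constants_nonneg)
      then show ?thesis by (simp add: grad_F_parts[OF that] inner_prod_def)
    qed
  qed (intro Bochner_Integration.integrable_add integrable_inner_right integrable_gradients F_integrable)+
  then show ?thesis
    by (simp add: integrable_gradients f_def mean_fun_def mean_Fx_def mean_Fy_def)
qed

lemma integrable_grad_y_deriv: "integrable Dzeta (\<lambda>\<zeta>. grad_y_deriv (G \<zeta>) z c)"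
  by (rule zeta.expectation_norm_le) (auto intro: grad_y_deriv_measurable grad_y_deriv_bound)

definition "mean_Gy_deriv z c = (\<integral>\<zeta>. grad_y_deriv (G \<zeta>) z c \<partial>Dzeta)"

lemma mean_Gy_taylor: "norm (mean_Gy (z + c) - mean_Gy z - mean_Gy_deriv z c) \<le> (\<tau> + \<rho>) * (norm c)\<^sup>2"
  unfolding mean_Gy_def mean_Gy_deriv_def
  by (rule zeta.expectation_taylor) (auto intro: integrable_grad_y_G integrable_grad_y_deriv grad_y_G_taylor)

lemma mean_Gy_deriv_inner: "mean_Gy_deriv z c \<bullet> w = fst c \<bullet> mean_Hxy z w + mean_Hyy z (snd c) \<bullet> w"
proof -
  have "mean_Gy_deriv z c \<bullet> w = (\<integral>\<zeta>. fst c \<bullet> blinfun_apply (hess_xy (G \<zeta>) z) w + blinfun_apply (hess_yy (G \<zeta>) z) (snd c) \<bullet> w \<partial>Dzeta)"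
    unfolding mean_Gy_deriv_def integral_inner_left[OF integrable_grad_y_deriv, symmetric]
    by (simp add: grad_y_deriv_inner)
  then show ?thesis by (simp add: mean_Hxy_def mean_Hyy_def integrable_gradients)
qed

lemma mean_Hyy_symmetric: "mean_Hyy z a \<bullet> b = a \<bullet> mean_Hyy z b"
proof -
  have "mean_Hyy z a \<bullet> b = (\<integral>\<zeta>. blinfun_apply (hess_yy (G \<zeta>) z) a \<bullet> b \<partial>Dzeta)"
    by (simp add: mean_Hyy_def integrable_gradients)
  also have "\<dots> = (\<integral>\<zeta>. a \<bullet> blinfun_apply (hess_yy (G \<zeta>) z) b \<partial>Dzeta)"
    by (rule Bochner_Integration.integral_cong) (auto simp: hess_yy_symmetric)
  finally show ?thesis by (simp add: mean_Hyy_def integrable_gradients)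
qed

lemma mean_Hyy_linear: "linear (mean_Hyy z)" and mean_Hxy_linear: "linear (mean_Hxy z)"
  by (rule linearI; simp add: mean_Hyy_def mean_Hxy_def integrable_gradients blinfun.add_right blinfun.scaleR_right)+

lemma mean_Hxy_bound: "norm (mean_Hxy z b) \<le> L * norm b"
  unfolding mean_Hxy_def by (rule zeta.expectation_norm_le) (auto intro: hess_measurable hess_bound)

lemma neumann_step_linear: "linear (neumann_step z)"
  unfolding neumann_step_def
  by (rule linearI) (simp_all add: linear_add[OF mean_Hyy_linear] linear_cmul[OF mean_Hyy_linear] algebra_simps)

lemma neumann_step_bound: "norm (neumann_step z b) \<le> (1 - \<eta> * \<mu>) * norm b"
proof -
  have "neumann_step z b = (\<integral>\<zeta>. b - \<eta> *\<^sub>R blinfun_apply (hess_yy (G \<zeta>) z) b \<partial>Dzeta)"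
    by (simp add: neumann_step_def mean_Hyy_def integrable_gradients zeta.prob_space)
  also have "norm \<dots> \<le> (1 - \<eta> * \<mu>) * norm b"
    using eta_pos eta_L
    by (intro zeta.expectation_norm_le borel_measurable_diff borel_measurable_scaleR hess_measurable hess_step_bound) auto
  finally show ?thesis .
qed

lemma mean_F_bound: "norm (mean_Fx z) \<le> M" "norm (mean_Fy z) \<le> M"
  unfolding mean_Fx_def mean_Fy_def
  by (rule xi.expectation_norm_le[OF partial_measurable(1) partial_F_bound(1)], assumption)
    (rule xi.expectation_norm_le[OF partial_measurable(2) partial_F_bound(2)], assumption)

lemma mean_Gy_lipschitz: "norm (mean_Gy z - mean_Gy z') \<le> L * norm (z - z')"
proof -
  have "mean_Gy z - mean_Gy z' = (\<integral>\<zeta>. grad_y (G \<zeta>) z - grad_y (G \<zeta>) z' \<partial>Dzeta)"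
    by (simp add: mean_Gy_def integrable_grad_y_G)
  also have "norm \<dots> \<le> L * norm (z - z')"
    by (intro zeta.expectation_norm_le borel_measurable_diff partial_measurable grad_y_G_lipschitz)
  finally show ?thesis .
qed

lemma mean_Gy_monotone: "\<mu> * (norm (y - y'))\<^sup>2 \<le> (mean_Gy (x, y) - mean_Gy (x, y')) \<bullet> (y - y')"
proof -
  have "(\<integral>\<zeta>. \<mu> * (norm (y - y'))\<^sup>2 \<partial>Dzeta) \<le> (\<integral>\<zeta>. (grad_y (G \<zeta>) (x, y) - grad_y (G \<zeta>) (x, y')) \<bullet> (y - y') \<partial>Dzeta)"
    by (intro integral_mono integrable_inner_left Bochner_Integration.integrable_diff integrable_grad_y_G grad_y_G_monotone zeta.integrable_const)
  then show ?thesis by (simp add: mean_Gy_def integrable_grad_y_G zeta.prob_space)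
qed

lemma g_inequality: "g (x, y) + (y' - y) \<bullet> mean_Gy (x, y) + \<mu> / 2 * (norm (y' - y))\<^sup>2 \<le> g (x, y')"
proof -
  have "(\<integral>\<zeta>. G \<zeta> (x, y) + (y' - y) \<bullet> grad_y (G \<zeta>) (x, y) + \<mu> / 2 * (norm (y' - y))\<^sup>2 \<partial>Dzeta) \<le> (\<integral>\<zeta>. G \<zeta> (x, y') \<partial>Dzeta)"
    by (intro integral_mono Bochner_Integration.integrable_add integrable_inner_right integrable_grad_y_G
        grad_y_G_inequality zeta.integrable_const G_integrable)
  then show ?thesis by (simp add: mean_Gy_def g_def mean_fun_def integrable_grad_y_G G_integrable zeta.prob_space)
qed

section \<open>The lower-level solution and the hypergradient\<close>

text \<open>A stationary point is a fixed point of the gradient step of length \<mu>/L^2, the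
  longest that \<open>gradient_step_contraction\<close> admits; its factor 1 - \<mu>^2/L^2 is below
  1, so Banach's theorem applies.\<close>

lemma ex_stationary: "\<exists>y. mean_Gy (x, y) = 0"
proof -
  define \<beta> where "\<beta> = \<mu> / L\<^sup>2"
  have \<beta>: "0 < \<beta>" "\<beta> * L\<^sup>2 = \<mu>" using mu_pos L_pos by (auto simp: \<beta>_def)
  have "\<mu>\<^sup>2 \<le> L\<^sup>2" using mu_pos mu_le_L by (intro power_mono) auto
  then have c: "0 \<le> 1 - \<beta> * \<mu>" "1 - \<beta> * \<mu> < 1"
    using \<beta> mu_pos L_pos by (auto simp: \<beta>_def power2_eq_square)
  have "\<exists>!y. y - \<beta> *\<^sub>R mean_Gy (x, y) = y"
  proof (rule banach_fix_type)
    show "0 \<le> sqrt (1 - \<beta> * \<mu>)" "sqrt (1 - \<beta> * \<mu>) < 1" using c by auto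
    show "\<forall>y y'. dist (y - \<beta> *\<^sub>R mean_Gy (x, y)) (y' - \<beta> *\<^sub>R mean_Gy (x, y')) \<le> sqrt (1 - \<beta> * \<mu>) * dist y y'"
    proof (intro allI)
      fix y y'
      let ?a = "y - y'" and ?b = "mean_Gy (x, y) - mean_Gy (x, y')"
      have "(norm (?a - \<beta> *\<^sub>R ?b))\<^sup>2 \<le> (1 - \<beta> * \<mu>) * (norm ?a)\<^sup>2"
        by (rule gradient_step_contraction[OF mean_Gy_monotone])
          (use mean_Gy_lipschitz[of "(x, y)" "(x, y')"] \<beta> in auto)
      then have "norm (?a - \<beta> *\<^sub>R ?b) \<le> sqrt (1 - \<beta> * \<mu>) * norm ?a"
        using real_sqrt_le_mono by (fastforce simp: real_sqrt_mult)
      then show "dist (y - \<beta> *\<^sub>R mean_Gy (x, y)) (y' - \<beta> *\<^sub>R mean_Gy (x, y')) \<le> sqrt (1 - \<beta> * \<mu>) * dist y y'"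
        by (simp add: dist_norm algebra_simps)
    qed
  qed
  then show ?thesis using \<beta> by auto
qed

text \<open>\<open>ystar\<close> is a chosen minimizer, so a minimizer must first be known to exist.
  Quadratic growth around the stationary point makes that point the only one.\<close>

lemma mean_Gy_ystar: "mean_Gy (x, ystar g x) = 0"
proof -
  obtain y where y: "mean_Gy (x, y) = 0" using ex_stationary by blast
  have m: "g (x, y) + \<mu> / 2 * (norm (y' - y))\<^sup>2 \<le> g (x, y')" for y'
    using g_inequality[of x y y'] y by simp
  have "is_arg_min (\<lambda>y. g (x, y)) (\<lambda>_. True) y"
    unfolding is_arg_min_linorder using m mu_pos by (smt (verit) mult_nonneg_nonneg zero_le_power2 divide_nonneg_nonneg)
  then have "is_arg_min (\<lambda>y. g (x, y)) (\<lambda>_. True) (ystar g x)"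
    unfolding ystar_def arg_min_def by (rule someI)
  then have "g (x, ystar g x) \<le> g (x, y)" by (simp add: is_arg_min_linorder)
  with m[of "ystar g x"] have "\<mu> / 2 * (norm (ystar g x - y))\<^sup>2 \<le> 0" by linarith
  then have "ystar g x = y" using mu_pos by (simp add: mult_le_0_iff)
  then show ?thesis using y by simp
qed

text \<open>Strong monotonicity against \<open>ystar\<close>, where the gradient vanishes. An
  estimate of \<open>mean_Gy\<close> thereby measures how far the inner problem is from being
  solved.\<close>

lemma ystar_dist: "\<mu> * norm (y - ystar g x) \<le> norm (mean_Gy (x, y))"
proof (cases "y = ystar g x")
  case False
  have "\<mu> * (norm (y - ystar g x))\<^sup>2 \<le> mean_Gy (x, y) \<bullet> (y - ystar g x)"
    using mean_Gy_monotone[of y "ystar g x" x] by (simp add: mean_Gy_ystar)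
  also have "\<dots> \<le> norm (mean_Gy (x, y)) * norm (y - ystar g x)" by (rule norm_cauchy_schwarz)
  finally show ?thesis using False by (simp add: power2_eq_square mult.assoc[symmetric])
qed simp

lemma ystar_lipschitz: "norm (ystar g x - ystar g x') \<le> L / \<mu> * norm (x - x')"
proof -
  have "\<mu> * norm (ystar g x - ystar g x') \<le> norm (mean_Gy (x', ystar g x) - mean_Gy (x, ystar g x))"
    using ystar_dist[of "ystar g x" x'] by (simp add: mean_Gy_ystar)
  also have "\<dots> \<le> L * norm (x - x')"
    using mean_Gy_lipschitz[of "(x', ystar g x)" "(x, ystar g x)"] by (simp add: norm_minus_commute)
  finally show ?thesis using mu_pos by (simp add: field_simps)
qed

text \<open>The Neumann iteration w = (I - \<eta>H) w + \<eta>b is a contraction, and its fixed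
  point solves H w = b.\<close>

lemma ex_linear_solution: "\<exists>w. mean_Hyy z w = mean_Fy z"
proof -
  have "\<exists>!w. neumann_step z w + \<eta> *\<^sub>R mean_Fy z = w"
  proof (rule banach_fix_type)
    show "0 \<le> 1 - \<eta> * \<mu>" "1 - \<eta> * \<mu> < 1" using eta_mu by auto
    show "\<forall>w w'. dist (neumann_step z w + \<eta> *\<^sub>R mean_Fy z) (neumann_step z w' + \<eta> *\<^sub>R mean_Fy z) \<le> (1 - \<eta> * \<mu>) * dist w w'"
      using neumann_step_bound[of z] by (simp add: dist_norm linear_diff[OF neumann_step_linear, symmetric])
  qed
  then obtain w where "neumann_step z w + \<eta> *\<^sub>R mean_Fy z = w" by blast
  then have "\<eta> *\<^sub>R mean_Hyy z w = \<eta> *\<^sub>R mean_Fy z"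
    unfolding neumann_step_def by (metis add_diff_cancel_left' diff_add_cancel diff_diff_eq2)
  then show ?thesis using eta_pos by auto
qed

text \<open>The inverse Hessian applied to the y-gradient of f, as in implicit differentiation, but
  available at every z and not only on the graph of \<open>ystar\<close>.\<close>

definition "adjoint_sol z = (SOME w. mean_Hyy z w = mean_Fy z)"

lemma adjoint_sol: "mean_Hyy z (adjoint_sol z) = mean_Fy z"
  unfolding adjoint_sol_def by (rule someI_ex) (rule ex_linear_solution)

lemma adjoint_sol_bound: "norm (adjoint_sol z) \<le> M / \<mu>"
proof -
  have "adjoint_sol z = neumann_step z (adjoint_sol z) + \<eta> *\<^sub>R mean_Fy z"
    unfolding neumann_step_def adjoint_sol by simp
  then have "norm (adjoint_sol z) = norm (neumann_step z (adjoint_sol z) + \<eta> *\<^sub>R mean_Fy z)"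
    by (rule arg_cong)
  also have "\<dots> \<le> norm (neumann_step z (adjoint_sol z)) + norm (\<eta> *\<^sub>R mean_Fy z)"
    by (rule norm_triangle_ineq)
  also have "\<dots> \<le> (1 - \<eta> * \<mu>) * norm (adjoint_sol z) + \<eta> * M"
    using mean_F_bound(2)[of z] eta_pos by (intro add_mono neumann_step_bound) auto
  finally have "\<eta> * (\<mu> * norm (adjoint_sol z)) \<le> \<eta> * M" by (simp add: algebra_simps)
  then show ?thesis using eta_pos mu_pos by (simp add: field_simps)
qed

definition "hypergrad x = (let z = (x, ystar g x) in mean_Fx z - mean_Hxy z (adjoint_sol z))"

text \<open>The mean gradient vanishes at both \<open>ystar g x\<close> and
  \<open>ystar g (x + a)\<close>, so its linearization between these two points is of order |a|^2.
  Pairing it with the adjoint solution expresses the displacement of \<open>ystar\<close>, as far as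
  f sees it, through \<open>a\<close> up to that order.\<close>

lemma Phi_has_derivative: "(Phi f g has_derivative (\<lambda>a. a \<bullet> hypergrad x)) (at x)"
proof (rule has_derivative_quadratic_boundI)
  fix a
  define z where "z = (x, ystar g x)"
  define w where "w = adjoint_sol z"
  define \<delta> where "\<delta> = ystar g (x + a) - ystar g x"
  define c where "c = (a, \<delta>)"
  define k where "k = 1 + L / \<mu>"
  have "norm c \<le> norm a + norm \<delta>" by (simp add: c_def norm_Pair_le)
  also have "\<dots> \<le> k * norm a"
    using ystar_lipschitz[of "x + a" x] by (simp add: \<delta>_def k_def algebra_simps)
  finally have "(norm c)\<^sup>2 \<le> (k * norm a)\<^sup>2" by (intro power_mono) auto
  then have c: "(norm c)\<^sup>2 \<le> k\<^sup>2 * (norm a)\<^sup>2" by (simp add: power_mult_distrib)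
  have zc: "z + c = (x + a, ystar g (x + a))" by (simp add: z_def c_def \<delta>_def)
  have r1: "\<bar>f (z + c) - f z - (a \<bullet> mean_Fx z + \<delta> \<bullet> mean_Fy z)\<bar> \<le> L * (k\<^sup>2 * (norm a)\<^sup>2)"
    using f_taylor[of z c] mult_left_mono[OF c constants_nonneg(2)] by (simp add: c_def)
  have "norm (mean_Gy_deriv z c) \<le> (\<tau> + \<rho>) * (norm c)\<^sup>2"
    using mean_Gy_taylor[of z c] unfolding zc by (simp add: z_def mean_Gy_ystar)
  also have "\<dots> \<le> (\<tau> + \<rho>) * (k\<^sup>2 * (norm a)\<^sup>2)"
    using constants_nonneg by (intro mult_left_mono c) auto
  finally have "norm (mean_Gy_deriv z c) * norm w \<le> (\<tau> + \<rho>) * (k\<^sup>2 * (norm a)\<^sup>2) * (M / \<mu>)"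
    using adjoint_sol_bound[of z] constants_nonneg by (intro mult_mono) (auto simp: w_def)
  then have r2: "\<bar>mean_Gy_deriv z c \<bullet> w\<bar> \<le> (\<tau> + \<rho>) * (k\<^sup>2 * (norm a)\<^sup>2) * (M / \<mu>)"
    by (rule order_trans[OF Cauchy_Schwarz_ineq2])
  have "\<delta> \<bullet> mean_Fy z = \<delta> \<bullet> mean_Hyy z w" by (simp add: w_def adjoint_sol)
  also have "\<dots> = mean_Gy_deriv z c \<bullet> w - a \<bullet> mean_Hxy z w"
    by (simp add: mean_Gy_deriv_inner c_def mean_Hyy_symmetric)
  finally have "Phi f g (x + a) - Phi f g x - a \<bullet> hypergrad x
      = (f (z + c) - f z - (a \<bullet> mean_Fx z + \<delta> \<bullet> mean_Fy z)) + mean_Gy_deriv z c \<bullet> w"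
    unfolding zc by (simp add: Phi_def hypergrad_def Let_def z_def[symmetric] w_def inner_diff_right)
  then show "norm (Phi f g (x + a) - Phi f g x - a \<bullet> hypergrad x) \<le> (L * k\<^sup>2 + (\<tau> + \<rho>) * k\<^sup>2 * (M / \<mu>)) * (norm a)\<^sup>2"
    using r1 r2 by (simp add: algebra_simps)
qed (rule bounded_linear_inner_left)

lemma gradient_Phi: "gradient (Phi f g) x = hypergrad x"
  by (rule gradient_eqI) (rule Phi_has_derivative)

lemma hypergrad_bound: "norm (hypergrad x) \<le> M + L * M / \<mu>"
proof -
  let ?z = "(x, ystar g x)"
  have "norm (hypergrad x) \<le> norm (mean_Fx ?z) + norm (mean_Hxy ?z (adjoint_sol ?z))"
    unfolding hypergrad_def Let_def by (rule norm_triangle_ineq4)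
  also have "\<dots> \<le> M + L * (M / \<mu>)"
    using adjoint_sol_bound[of ?z] constants_nonneg
    by (intro add_mono mean_F_bound order_trans[OF mean_Hxy_bound] mult_left_mono) auto
  finally show ?thesis by simp
qed

definition "neumann_sum Q z = \<eta> *\<^sub>R (\<Sum>r=0..Q. (neumann_step z ^^ r) (mean_Fy z))"
definition "mean_hypergrad Q z = mean_Fx z - mean_Hxy z (neumann_sum Q z)"

lemma neumann_power: "linear (neumann_step z ^^ r)" "norm ((neumann_step z ^^ r) b) \<le> (1 - \<eta> * \<mu>) ^ r * norm b"
proof -
  show "linear (neumann_step z ^^ r)"
  proof (induction r)
    case (Suc r)
    then show ?case unfolding funpow.simps by (rule linear_compose) (rule neumann_step_linear)
  qed (simp add: linear_iff)
  show "norm ((neumann_step z ^^ r) b) \<le> (1 - \<eta> * \<mu>) ^ r * norm b"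
  proof (induction r)
    case (Suc r)
    have "norm ((neumann_step z ^^ Suc r) b) \<le> (1 - \<eta> * \<mu>) * norm ((neumann_step z ^^ r) b)"
      by (simp add: neumann_step_bound)
    also have "\<dots> \<le> (1 - \<eta> * \<mu>) * ((1 - \<eta> * \<mu>) ^ r * norm b)"
      using eta_mu by (intro mult_left_mono Suc) auto
    finally show ?case by (simp add: mult_ac)
  qed simp
qed

text \<open>Because \<eta>b = w - T w for the exact solution w, the truncated series telescopes and
  leaves a single power of the contraction.\<close>

lemma neumann_sum_error: "adjoint_sol z - neumann_sum Q z = (neumann_step z ^^ Suc Q) (adjoint_sol z)"
proof -
  let ?T = "neumann_step z" and ?w = "adjoint_sol z"
  have e: "\<eta> *\<^sub>R mean_Fy z = ?w - ?T ?w" by (simp add: neumann_step_def adjoint_sol)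
  have "\<eta> *\<^sub>R (?T ^^ r) (mean_Fy z) = (?T ^^ r) ?w - (?T ^^ Suc r) ?w" for r
    unfolding linear_cmul[OF neumann_power(1), symmetric] e
    by (simp add: linear_diff[OF neumann_power(1)] funpow_swap1)
  then have "neumann_sum Q z = (\<Sum>r=0..Q. (?T ^^ r) ?w - (?T ^^ Suc r) ?w)"
    by (simp add: neumann_sum_def scaleR_sum_right)
  also have "\<dots> = ?w - (?T ^^ Suc Q) ?w"
    using sum_Suc_diff'[of 0 "Suc Q" "\<lambda>r. - (?T ^^ r) ?w"] by (simp add: atLeastLessThanSuc_atLeastAtMost del: funpow.simps)
  finally show ?thesis by simp
qed

definition "bias Q = L * M / \<mu> * (1 - \<eta> * \<mu>) ^ Suc Q"

lemma mean_hypergrad_bias: "norm (mean_hypergrad Q (x, ystar g x) - hypergrad x) \<le> bias Q"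
proof -
  let ?z = "(x, ystar g x)"
  have "mean_hypergrad Q ?z - hypergrad x = mean_Hxy ?z (adjoint_sol ?z - neumann_sum Q ?z)"
    by (simp add: mean_hypergrad_def hypergrad_def Let_def linear_diff[OF mean_Hxy_linear])
  also have "norm \<dots> \<le> L * norm (adjoint_sol ?z - neumann_sum Q ?z)" by (rule mean_Hxy_bound)
  also have "\<dots> \<le> L * ((1 - \<eta> * \<mu>) ^ Suc Q * (M / \<mu>))"
    unfolding neumann_sum_error using eta_mu constants_nonneg
    by (intro mult_left_mono order_trans[OF neumann_power(2)] adjoint_sol_bound zero_le_power) auto
  finally show ?thesis by (simp add: bias_def mult_ac)
qed

lemma bias_tendsto_0: "bias \<longlonglongrightarrow> 0"
proof -
  have "(\<lambda>Q. (1 - \<eta> * \<mu>) ^ Suc Q) \<longlonglongrightarrow> 0"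
    using eta_mu by (intro LIMSEQ_Suc LIMSEQ_realpow_zero) auto
  from tendsto_mult_left[OF this, of "L * M / \<mu>"] show ?thesis by (simp add: bias_def[abs_def])
qed

end

section \<open>The single-sample hypergradient estimator\<close>

lemma neumann_prod_rec:
  "a \<le> Q \<Longrightarrow> neumann_prod \<eta> H a Q v = neumann_prod \<eta> H (Suc a) Q v - \<eta> *\<^sub>R blinfun_apply (H a) (neumann_prod \<eta> H (Suc a) Q v)"
  "neumann_prod \<eta> H (Suc Q) Q v = v"
  by (simp_all add: neumann_prod_def upt_conv_Cons del: upt_Suc)

text \<open>The first sum bounds the Neumann series, the second its variation: a product of r
  factors changes through one factor at a time while r - 1 factors still contract. Both bounds are
  free of \<open>n\<close>, hence of the truncation depth.\<close>

lemma arith_geometric_sum_le: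
  fixes q :: real
  assumes "0 \<le> q" "q < 1"
  shows "(\<Sum>r=0..n. q ^ r) \<le> 1 / (1 - q)" "(\<Sum>r=0..n. real r * q ^ (r - 1)) \<le> 1 / (1 - q)\<^sup>2"
proof -
  show g: "(\<Sum>r=0..n. q ^ r) \<le> 1 / (1 - q)" for n
    using assms by (simp add: sum_gp0 atMost_atLeast0[symmetric] divide_right_mono)
  have "(1 - q) * (\<Sum>r=0..n. real r * q ^ (r - 1)) = (\<Sum>r<n. q ^ r) - real n * q ^ n"
  proof (induction n)
    case (Suc n)
    have "(1 - q) * (\<Sum>r=0..Suc n. real r * q ^ (r - 1))
        = (1 - q) * (\<Sum>r=0..n. real r * q ^ (r - 1)) + (1 - q) * (real (Suc n) * q ^ n)"
      by (simp add: distrib_left)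
    also have "\<dots> = (\<Sum>r<n. q ^ r) - real n * q ^ n + (1 - q) * (real (Suc n) * q ^ n)"
      unfolding Suc ..
    also have "\<dots> = (\<Sum>r<Suc n. q ^ r) - real (Suc n) * q ^ Suc n"
      by (simp add: algebra_simps)
    finally show ?case .
  qed simp
  also have "\<dots> \<le> (\<Sum>r=0..n. q ^ r)"
    using assms sum_mono2[of "{0..n}" "{..<n}" "\<lambda>r. q ^ r"]
    by (smt (verit) atLeast0AtMost atLeastAtMost_iff finite_atLeastAtMost le0 lessThan_iff less_imp_le mult_nonneg_nonneg
        of_nat_0_le_iff subsetI zero_le_power)
  also have "\<dots> \<le> 1 / (1 - q)" by (rule g)
  finally have "(\<Sum>r=0..n. real r * q ^ (r - 1)) \<le> 1 / (1 - q) / (1 - q)"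
    using assms by (subst pos_le_divide_eq) (auto simp: mult.commute)
  then show "(\<Sum>r=0..n. real r * q ^ (r - 1)) \<le> 1 / (1 - q)\<^sup>2"
    by (simp add: power2_eq_square)
qed

context vrbo_problem
begin

text \<open>The product of the last \<open>r\<close> factors, so that \<open>r\<close> counts the
  Hessian steps already applied. For r \<le> Q only the samples 1 to Q occur, which leaves sample 0
  to \<open>hess_xy\<close>.\<close>

definition "sample_neumann Q \<zeta>s z r v =
  neumann_prod \<eta> (\<lambda>j. hess_yy (G (\<zeta>s j)) z) (Suc Q - r) Q v"

definition "sample_sum Q \<xi> \<zeta>s z = \<eta> *\<^sub>R (\<Sum>r=0..Q. sample_neumann Q \<zeta>s z r (grad_y (F \<xi>) z))"

definition "sample_hypergrad Q \<xi> \<zeta>s z =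
  grad_x (F \<xi>) z - blinfun_apply (hess_xy (G (\<zeta>s 0)) z) (sample_sum Q \<xi> \<zeta>s z)"

definition "hypergrad_lip = L + \<tau> * M / \<mu> + L * (L / \<mu> + \<rho> * M / \<mu>\<^sup>2)"
definition "hypergrad_max = M + L * M / \<mu>"

lemma hypergrad_est_eq:
  "hypergrad_est F G \<eta> Q s \<xi>s \<zeta>s z = (1 / real s) *\<^sub>R (\<Sum>i=1..s. sample_hypergrad Q (\<xi>s i) (\<zeta>s i) z)"
  by (simp add: hypergrad_est_def sample_hypergrad_def sample_sum_def sample_neumann_def)

lemma sample_neumann_0: "sample_neumann Q \<zeta>s z 0 v = v"
  by (simp add: sample_neumann_def neumann_prod_rec)

lemma sample_neumann_Suc:
  "r < Suc Q \<Longrightarrow> sample_neumann Q \<zeta>s z (Suc r) v =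
    sample_neumann Q \<zeta>s z r v - \<eta> *\<^sub>R blinfun_apply (hess_yy (G (\<zeta>s (Q - r))) z) (sample_neumann Q \<zeta>s z r v)"
  using neumann_prod_rec(1)[of "Q - r" Q \<eta> "\<lambda>j. hess_yy (G (\<zeta>s j)) z" v]
  by (simp add: sample_neumann_def Suc_diff_le)

lemma sample_neumann_bound:
  assumes "\<And>j. \<zeta>s j \<in> space Dzeta" "r \<le> Suc Q"
  shows "norm (sample_neumann Q \<zeta>s z r v) \<le> (1 - \<eta> * \<mu>) ^ r * norm v"
  using assms(2)
proof (induction r)
  case (Suc r)
  have "norm (sample_neumann Q \<zeta>s z (Suc r) v) \<le> (1 - \<eta> * \<mu>) * norm (sample_neumann Q \<zeta>s z r v)"
    using Suc.prems eta_pos eta_L by (subst sample_neumann_Suc) (auto intro!: hess_step_bound assms(1))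
  also have "\<dots> \<le> (1 - \<eta> * \<mu>) * ((1 - \<eta> * \<mu>) ^ r * norm v)"
    using eta_mu Suc by (intro mult_left_mono) auto
  finally show ?case by (simp add: mult_ac)
qed (simp add: sample_neumann_0)

lemma sample_neumann_lipschitz:
  assumes s: "\<And>j. \<zeta>s j \<in> space Dzeta" and "r \<le> Suc Q"
  shows "norm (sample_neumann Q \<zeta>s z r v - sample_neumann Q \<zeta>s z' r v')
    \<le> (1 - \<eta> * \<mu>) ^ r * norm (v - v') + real r * (1 - \<eta> * \<mu>) ^ (r - 1) * (\<eta> * \<rho> * norm (z - z') * norm v')"
  using assms(2)
proof (induction r)
  case (Suc r)
  let ?q = "1 - \<eta> * \<mu>" and ?k = "\<eta> * \<rho> * norm (z - z') * norm v'"
  let ?H = "\<lambda>z. blinfun_apply (hess_yy (G (\<zeta>s (Q - r))) z)"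
  let ?p = "sample_neumann Q \<zeta>s z r v" and ?p' = "sample_neumann Q \<zeta>s z' r v'"
  \<comment> \<open>The Hessian step at z acts on the difference of the partial products and
    contracts it; the change of the Hessian acts only on the partial product at z', whose size is
    known.\<close>
  have "sample_neumann Q \<zeta>s z (Suc r) v - sample_neumann Q \<zeta>s z' (Suc r) v'
      = ((?p - ?p') - \<eta> *\<^sub>R ?H z (?p - ?p')) - \<eta> *\<^sub>R (?H z ?p' - ?H z' ?p')"
    using Suc.prems by (simp add: sample_neumann_Suc blinfun.diff_right algebra_simps)
  then have "norm (sample_neumann Q \<zeta>s z (Suc r) v - sample_neumann Q \<zeta>s z' (Suc r) v')
      \<le> norm ((?p - ?p') - \<eta> *\<^sub>R ?H z (?p - ?p')) + norm (\<eta> *\<^sub>R (?H z ?p' - ?H z' ?p'))"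
    using norm_triangle_ineq4 by metis
  also have "\<dots> \<le> ?q * norm (?p - ?p') + \<eta> * (\<rho> * norm (z - z') * (?q ^ r * norm v'))"
  proof (rule add_mono)
    show "norm ((?p - ?p') - \<eta> *\<^sub>R ?H z (?p - ?p')) \<le> ?q * norm (?p - ?p')"
      using eta_pos eta_L by (intro hess_step_bound s) auto
    have "norm (?H z ?p' - ?H z' ?p') \<le> \<rho> * norm (z - z') * norm ?p'" by (rule hess_lipschitz[OF s])
    also have "\<dots> \<le> \<rho> * norm (z - z') * (?q ^ r * norm v')"
      using Suc.prems constants_nonneg by (intro mult_left_mono sample_neumann_bound s) auto
    finally show "norm (\<eta> *\<^sub>R (?H z ?p' - ?H z' ?p')) \<le> \<eta> * (\<rho> * norm (z - z') * (?q ^ r * norm v'))"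
      using eta_pos by (simp add: mult_left_mono)
  qed
  also have "\<dots> \<le> ?q * (?q ^ r * norm (v - v') + real r * ?q ^ (r - 1) * ?k) + ?q ^ r * ?k"
    using eta_mu Suc by (intro add_mono mult_left_mono) auto
  also have "\<dots> = ?q ^ Suc r * norm (v - v') + (real r * (?q * ?q ^ (r - 1)) + ?q ^ r) * ?k"
    by (simp add: algebra_simps)
  also have "real r * (?q * ?q ^ (r - 1)) + ?q ^ r = real (Suc r) * ?q ^ (Suc r - 1)"
    by (cases r) (simp_all add: algebra_simps)
  finally show ?case .
qed (simp add: sample_neumann_0)

lemma sample_sum_bound:
  assumes "\<xi> \<in> space Dxi" and s: "\<And>j. \<zeta>s j \<in> space Dzeta"
  shows "norm (sample_sum Q \<xi> \<zeta>s z) \<le> M / \<mu>"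
proof -
  have "norm (\<Sum>r=0..Q. sample_neumann Q \<zeta>s z r (grad_y (F \<xi>) z)) \<le> (\<Sum>r=0..Q. (1 - \<eta> * \<mu>) ^ r * M)"
  proof (rule sum_norm_le)
    fix r assume "r \<in> {0..Q}"
    then have "norm (sample_neumann Q \<zeta>s z r (grad_y (F \<xi>) z)) \<le> (1 - \<eta> * \<mu>) ^ r * norm (grad_y (F \<xi>) z)"
      by (intro sample_neumann_bound s) auto
    also have "\<dots> \<le> (1 - \<eta> * \<mu>) ^ r * M"
      using eta_mu by (intro mult_left_mono partial_F_bound assms(1)) auto
    finally show "norm (sample_neumann Q \<zeta>s z r (grad_y (F \<xi>) z)) \<le> (1 - \<eta> * \<mu>) ^ r * M" .
  qed
  also have "\<dots> = (\<Sum>r=0..Q. (1 - \<eta> * \<mu>) ^ r) * M" by (simp add: sum_distrib_right)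
  also have "\<dots> \<le> 1 / (1 - (1 - \<eta> * \<mu>)) * M"
    using eta_mu constants_nonneg by (intro mult_right_mono arith_geometric_sum_le) auto
  finally have "\<eta> * norm (\<Sum>r=0..Q. sample_neumann Q \<zeta>s z r (grad_y (F \<xi>) z)) \<le> \<eta> * (1 / (\<eta> * \<mu>) * M)"
    using eta_pos by (intro mult_left_mono) auto
  then have "norm (sample_sum Q \<xi> \<zeta>s z) \<le> \<eta> * (1 / (\<eta> * \<mu>) * M)"
    using eta_pos by (simp add: sample_sum_def)
  then show ?thesis using eta_pos by simp
qed

text \<open>Summation over r produces 1/(\<eta>\<mu>) and 1/(\<eta>\<mu>)^2. The prefactor \<eta>
  and the \<eta> of the perturbed factor cancel against them, so the constant is free of \<eta> and
  of \<open>Q\<close>.\<close>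

lemma sample_sum_lipschitz:
  assumes "\<xi> \<in> space Dxi" and s: "\<And>j. \<zeta>s j \<in> space Dzeta"
  shows "norm (sample_sum Q \<xi> \<zeta>s z - sample_sum Q \<xi> \<zeta>s z') \<le> (L / \<mu> + \<rho> * M / \<mu>\<^sup>2) * norm (z - z')"
proof -
  let ?q = "1 - \<eta> * \<mu>" and ?d = "norm (z - z')"
  let ?v = "grad_y (F \<xi>)"
  have "norm (\<Sum>r=0..Q. sample_neumann Q \<zeta>s z r (?v z) - sample_neumann Q \<zeta>s z' r (?v z'))
      \<le> (\<Sum>r=0..Q. ?q ^ r * (L * ?d) + real r * ?q ^ (r - 1) * (\<eta> * \<rho> * ?d * M))"
  proof (rule sum_norm_le)
    fix r assume "r \<in> {0..Q}"
    then have "norm (sample_neumann Q \<zeta>s z r (?v z) - sample_neumann Q \<zeta>s z' r (?v z'))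
      \<le> ?q ^ r * norm (?v z - ?v z') + real r * ?q ^ (r - 1) * (\<eta> * \<rho> * ?d * norm (?v z'))"
      by (intro sample_neumann_lipschitz s) auto
    also have "\<dots> \<le> ?q ^ r * (L * ?d) + real r * ?q ^ (r - 1) * (\<eta> * \<rho> * ?d * M)"
      using eta_mu constants_nonneg eta_pos
      by (intro add_mono mult_left_mono partial_F_bound partial_F_lipschitz assms(1)) auto
    finally show "norm (sample_neumann Q \<zeta>s z r (?v z) - sample_neumann Q \<zeta>s z' r (?v z'))
      \<le> ?q ^ r * (L * ?d) + real r * ?q ^ (r - 1) * (\<eta> * \<rho> * ?d * M)" .
  qed
  also have "\<dots> = (\<Sum>r=0..Q. ?q ^ r) * (L * ?d) + (\<Sum>r=0..Q. real r * ?q ^ (r - 1)) * (\<eta> * \<rho> * ?d * M)"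
    by (simp only: sum.distrib sum_distrib_right)
  also have "\<dots> \<le> 1 / (1 - ?q) * (L * ?d) + 1 / (1 - ?q)\<^sup>2 * (\<eta> * \<rho> * ?d * M)"
    using eta_mu constants_nonneg eta_pos by (intro add_mono mult_right_mono arith_geometric_sum_le) auto
  finally have b: "norm (\<Sum>r=0..Q. sample_neumann Q \<zeta>s z r (?v z) - sample_neumann Q \<zeta>s z' r (?v z'))
      \<le> 1 / (\<eta> * \<mu>) * (L * ?d) + 1 / (\<eta> * \<mu>)\<^sup>2 * (\<eta> * \<rho> * ?d * M)" by simp
  have "norm (sample_sum Q \<xi> \<zeta>s z - sample_sum Q \<xi> \<zeta>s z')
      = \<eta> * norm (\<Sum>r=0..Q. sample_neumann Q \<zeta>s z r (?v z) - sample_neumann Q \<zeta>s z' r (?v z'))"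
    using eta_pos by (simp add: sample_sum_def sum_subtractf scaleR_diff_right[symmetric])
  also have "\<dots> \<le> \<eta> * (1 / (\<eta> * \<mu>) * (L * ?d) + 1 / (\<eta> * \<mu>)\<^sup>2 * (\<eta> * \<rho> * ?d * M))"
    using eta_pos by (intro mult_left_mono b) auto
  also have "\<dots> = (L / \<mu> + \<rho> * M / \<mu>\<^sup>2) * ?d"
    using eta_pos mu_pos by (simp add: field_simps power2_eq_square)
  finally show ?thesis .
qed

lemma sample_hypergrad_bound:
  assumes "\<xi> \<in> space Dxi" and s: "\<And>j. \<zeta>s j \<in> space Dzeta"
  shows "norm (sample_hypergrad Q \<xi> \<zeta>s z) \<le> hypergrad_max"
proof -
  have "norm (sample_hypergrad Q \<xi> \<zeta>s z) \<le> norm (grad_x (F \<xi>) z)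
      + norm (blinfun_apply (hess_xy (G (\<zeta>s 0)) z) (sample_sum Q \<xi> \<zeta>s z))"
    unfolding sample_hypergrad_def by (rule norm_triangle_ineq4)
  also have "\<dots> \<le> M + L * (M / \<mu>)"
    using constants_nonneg
    by (intro add_mono partial_F_bound order_trans[OF hess_bound(2)] mult_left_mono sample_sum_bound assms) auto
  finally show ?thesis by (simp add: hypergrad_max_def)
qed

lemma sample_hypergrad_lipschitz:
  assumes x: "\<xi> \<in> space Dxi" and s: "\<And>j. \<zeta>s j \<in> space Dzeta"
  shows "norm (sample_hypergrad Q \<xi> \<zeta>s z - sample_hypergrad Q \<xi> \<zeta>s z') \<le> hypergrad_lip * norm (z - z')"
proof -
  let ?J = "\<lambda>z. blinfun_apply (hess_xy (G (\<zeta>s 0)) z)" and ?w = "sample_sum Q \<xi> \<zeta>s" and ?d = "norm (z - z')"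
  have "sample_hypergrad Q \<xi> \<zeta>s z - sample_hypergrad Q \<xi> \<zeta>s z'
      = (grad_x (F \<xi>) z - grad_x (F \<xi>) z') - (?J z (?w z) - ?J z' (?w z)) - ?J z' (?w z - ?w z')"
    by (simp add: sample_hypergrad_def blinfun.diff_right)
  then have "norm (sample_hypergrad Q \<xi> \<zeta>s z - sample_hypergrad Q \<xi> \<zeta>s z')
      \<le> norm (grad_x (F \<xi>) z - grad_x (F \<xi>) z') + norm (?J z (?w z) - ?J z' (?w z)) + norm (?J z' (?w z - ?w z'))"
    by (simp only:) (rule order_trans[OF norm_triangle_ineq4 add_right_mono[OF norm_triangle_ineq4]])
  also have "\<dots> \<le> L * ?d + \<tau> * ?d * (M / \<mu>) + L * ((L / \<mu> + \<rho> * M / \<mu>\<^sup>2) * ?d)"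
    using constants_nonneg
    by (intro add_mono partial_F_lipschitz x order_trans[OF hess_lipschitz(2)[OF s]] mult_left_mono sample_sum_bound s
        order_trans[OF hess_bound(2)[OF s]] sample_sum_lipschitz) auto
  also have "\<dots> = hypergrad_lip * ?d" by (simp add: hypergrad_lip_def algebra_simps)
  finally show ?thesis .
qed

lemma hypergrad_constants_nonneg: "0 \<le> hypergrad_lip" "0 \<le> hypergrad_max"
  using constants_nonneg mu_pos by (auto simp: hypergrad_lip_def hypergrad_max_def intro!: add_nonneg_nonneg mult_nonneg_nonneg)

end

section \<open>Mean and variance of the estimators\<close>

context vrbo_problem
begin

sublocale sampling Dxi Dzeta
  by unfold_locales

lemma neumann_factor:
  shows "\<zeta> \<in> space Dzeta \<Longrightarrow> linear (\<lambda>v. v - \<eta> *\<^sub>R blinfun_apply (hess_yy (G \<zeta>) z) v)"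
    and "(\<lambda>\<zeta>. v - \<eta> *\<^sub>R blinfun_apply (hess_yy (G \<zeta>) z) v) \<in> borel_measurable Dzeta"
    and "\<zeta> \<in> space Dzeta \<Longrightarrow> norm (v - \<eta> *\<^sub>R blinfun_apply (hess_yy (G \<zeta>) z) v) \<le> 1 * norm v"
    and "(\<integral>\<zeta>. v - \<eta> *\<^sub>R blinfun_apply (hess_yy (G \<zeta>) z) v \<partial>Dzeta) = neumann_step z v"
proof -
  show "linear (\<lambda>v. v - \<eta> *\<^sub>R blinfun_apply (hess_yy (G \<zeta>) z) v)"
    by (rule linearI) (simp_all add: blinfun.add_right blinfun.scaleR_right algebra_simps)
  show "(\<lambda>\<zeta>. v - \<eta> *\<^sub>R blinfun_apply (hess_yy (G \<zeta>) z) v) \<in> borel_measurable Dzeta"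
    by (intro borel_measurable_diff borel_measurable_scaleR hess_measurable borel_measurable_const)
  show "norm (v - \<eta> *\<^sub>R blinfun_apply (hess_yy (G \<zeta>) z) v) \<le> 1 * norm v" if "\<zeta> \<in> space Dzeta"
  proof -
    have "norm (v - \<eta> *\<^sub>R blinfun_apply (hess_yy (G \<zeta>) z) v) \<le> (1 - \<eta> * \<mu>) * norm v"
      using eta_pos eta_L by (intro hess_step_bound that) auto
    also have "\<dots> \<le> 1 * norm v" using eta_mu by (intro mult_right_mono) auto
    finally show ?thesis .
  qed
  show "(\<integral>\<zeta>. v - \<eta> *\<^sub>R blinfun_apply (hess_yy (G \<zeta>) z) v \<partial>Dzeta) = neumann_step z v"
    by (simp add: neumann_step_def mean_Hyy_def integrable_gradients zeta.prob_space)
qed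

text \<open>After r steps the samples used are those with index above Q - r, and j' + r \<le> Q
  keeps j' out of that range.\<close>

lemma sample_neumann_mix:
  "j' + r \<le> Q \<Longrightarrow> sample_neumann Q (\<lambda>j. snd (mix2 {} {(k, b, i, j')} \<omega> \<omega>') (k, b, i, j)) z r v
    = sample_neumann Q (\<lambda>j. snd \<omega> (k, b, i, j)) z r v"
proof (induction r)
  case (Suc r)
  then have "Q - r \<noteq> j'" by simp
  then show ?case using Suc by (simp add: sample_neumann_Suc mix2_def mix_def)
qed (simp add: sample_neumann_0)

text \<open>Each step applies a factor whose sample Q - r has not occurred before, so
  \<open>expectation_random_linear\<close> replaces it by the mean step.\<close>

lemma sample_neumann_mean:
  assumes "r \<le> Q"
  shows "(\<lambda>\<omega>. sample_neumann Q (\<lambda>j. snd \<omega> (k, b, i, j)) z r (grad_y (F (fst \<omega> (k, b, i))) z)) \<in> borel_measurable \<Omega>"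
    and "(\<integral>\<omega>. sample_neumann Q (\<lambda>j. snd \<omega> (k, b, i, j)) z r (grad_y (F (fst \<omega> (k, b, i))) z) \<partial>\<Omega>)
      = (neumann_step z ^^ r) (mean_Fy z)"
  using assms
proof (induction r)
  case 0
  {
    case 1
    show ?case unfolding sample_neumann_0
      by (rule measurable_compose[OF coordinate_measurable(1) partial_measurable(2)])
  next
    case 2
    show ?case unfolding sample_neumann_0
      by (simp add: expectation_coordinate(1)[OF partial_measurable(2)] mean_Fy_def)
  }
next
  case (Suc r)
  let ?X = "\<lambda>\<omega>. sample_neumann Q (\<lambda>j. snd \<omega> (k, b, i, j)) z r (grad_y (F (fst \<omega> (k, b, i))) z)"
  let ?T = "\<lambda>\<zeta> v. v - \<eta> *\<^sub>R blinfun_apply (hess_yy (G \<zeta>) z) v"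
  have bound: "norm (?X \<omega>) \<le> M" if "\<omega> \<in> space \<Omega>" and "r \<le> Q" for \<omega>
  proof -
    have "norm (?X \<omega>) \<le> (1 - \<eta> * \<mu>) ^ r * norm (grad_y (F (fst \<omega> (k, b, i))) z)"
      using that by (intro sample_neumann_bound coordinate_space) auto
    also have "\<dots> \<le> 1 * M"
      using that eta_mu by (intro mult_mono partial_F_bound coordinate_space power_le_one) auto
    finally show ?thesis by simp
  qed
  {
    case 1
    then have r: "r \<le> Q" by simp
    have eq: "sample_neumann Q (\<lambda>j. snd \<omega> (k, b, i, j)) z (Suc r) v
      = ?T (snd \<omega> (k, b, i, Q - r)) (sample_neumann Q (\<lambda>j. snd \<omega> (k, b, i, j)) z r v)" for \<omega> v
      using 1 by (simp add: sample_neumann_Suc)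
    have mix: "?X (mix2 {} {(k, b, i, Q - r)} \<omega> \<omega>') = ?X \<omega>" for \<omega> \<omega>'
      using r by (subst sample_neumann_mix) (simp_all add: mix2_def mix_def)
    show ?case unfolding eq
      by (rule expectation_random_linear(1)[OF neumann_factor(1-3) _ Suc.IH(1)[OF r] bound[OF _ r] mix]) auto
  next
    case 2
    then have r: "r \<le> Q" by simp
    have eq: "sample_neumann Q (\<lambda>j. snd \<omega> (k, b, i, j)) z (Suc r) v
      = ?T (snd \<omega> (k, b, i, Q - r)) (sample_neumann Q (\<lambda>j. snd \<omega> (k, b, i, j)) z r v)" for \<omega> v
      using 2 by (simp add: sample_neumann_Suc)
    have mix: "?X (mix2 {} {(k, b, i, Q - r)} \<omega> \<omega>') = ?X \<omega>" for \<omega> \<omega>'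
      using r by (subst sample_neumann_mix) (simp_all add: mix2_def mix_def)
    have "(\<integral>\<omega>. ?T (snd \<omega> (k, b, i, Q - r)) (?X \<omega>) \<partial>\<Omega>) = (\<integral>\<zeta>. ?T \<zeta> (\<integral>\<omega>. ?X \<omega> \<partial>\<Omega>) \<partial>Dzeta)"
      by (rule expectation_random_linear(2)[OF neumann_factor(1-3) _ Suc.IH(1)[OF r] bound[OF _ r] mix]) auto
    then show ?case unfolding eq by (simp add: neumann_factor(4) Suc.IH(2)[OF r])
  }
qed

lemma sample_sum_mean:
  fixes k b i Q :: nat
  defines "W \<equiv> \<lambda>z \<omega>. sample_sum Q (fst \<omega> (k, b, i)) (\<lambda>j. snd \<omega> (k, b, i, j)) z"
  shows "W z \<in> borel_measurable \<Omega>" and "(\<integral>\<omega>. W z \<omega> \<partial>\<Omega>) = neumann_sum Q z"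
    and "\<omega> \<in> space \<Omega> \<Longrightarrow> norm (W z \<omega>) \<le> M / \<mu>"
    and "W z (mix2 {} {(k, b, i, 0)} \<omega> \<omega>') = W z \<omega>"
proof -
  let ?X = "\<lambda>r \<omega>. sample_neumann Q (\<lambda>j. snd \<omega> (k, b, i, j)) z r (grad_y (F (fst \<omega> (k, b, i))) z)"
  show "W z \<in> borel_measurable \<Omega>"
    unfolding W_def sample_sum_def
    by (intro borel_measurable_scaleR borel_measurable_sum borel_measurable_const sample_neumann_mean(1)) auto
  have "integrable \<Omega> (?X r)" if "r \<le> Q" for r
  proof (rule P.expectation_norm_le(1)[OF sample_neumann_mean(1)[OF that]])
    show "norm (?X r \<omega>) \<le> 1 * M" if "\<omega> \<in> space \<Omega>" for \<omega>
      using that \<open>r \<le> Q\<close> eta_mu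
      by (intro order_trans[OF sample_neumann_bound] mult_mono partial_F_bound coordinate_space power_le_one) auto
  qed
  then have "(\<integral>\<omega>. \<eta> *\<^sub>R (\<Sum>r=0..Q. ?X r \<omega>) \<partial>\<Omega>) = \<eta> *\<^sub>R (\<Sum>r=0..Q. \<integral>\<omega>. ?X r \<omega> \<partial>\<Omega>)"
    by (simp add: Bochner_Integration.integral_sum)
  also have "\<dots> = neumann_sum Q z"
    by (simp add: neumann_sum_def sample_neumann_mean(2))
  finally show "(\<integral>\<omega>. W z \<omega> \<partial>\<Omega>) = neumann_sum Q z" by (simp add: W_def sample_sum_def)
  show "norm (W z \<omega>) \<le> M / \<mu>" if "\<omega> \<in> space \<Omega>"
    unfolding W_def using that by (intro sample_sum_bound coordinate_space)
  have "?X r (mix2 {} {(k, b, i, 0)} \<omega> \<omega>') = ?X r \<omega>" if "r \<in> {0..Q}" for r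
    using that by (subst sample_neumann_mix) (simp_all add: mix2_def mix_def)
  then show "W z (mix2 {} {(k, b, i, 0)} \<omega> \<omega>') = W z \<omega>"
    unfolding W_def sample_sum_def by simp
qed

text \<open>Sample 0, which enters through \<open>hess_xy\<close>, is independent of the Neumann sum
  built from the samples 1 to Q; this gives the mean. The variance is at most the second moment, and
  a single sample estimator is bounded.\<close>

lemma hypergrad_estimator:
  "sample_estimator Dxi Dzeta (sample_hypergrad Q) (mean_hypergrad Q) hypergrad_lip (hypergrad_max\<^sup>2)"
proof
  fix k b i :: nat and z
  let ?W = "\<lambda>\<omega>. sample_sum Q (fst \<omega> (k, b, i)) (\<lambda>j. snd \<omega> (k, b, i, j)) z"
  let ?Y = "\<lambda>\<omega>. sample_hypergrad Q (fst \<omega> (k, b, i)) (\<lambda>j. snd \<omega> (k, b, i, j)) z"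
  have eq: "?Y \<omega> = grad_x (F (fst \<omega> (k, b, i))) z - blinfun_apply (hess_xy (G (snd \<omega> (k, b, i, 0))) z) (?W \<omega>)" for \<omega>
    by (simp add: sample_hypergrad_def)
  have lin: "linear (blinfun_apply (hess_xy (G \<zeta>) z))" for \<zeta>
    by (simp add: blinfun.bounded_linear_right bounded_linear.linear)
  have J: "(\<lambda>\<omega>. blinfun_apply (hess_xy (G (snd \<omega> (k, b, i, 0))) z) (?W \<omega>)) \<in> borel_measurable \<Omega>"
    "(\<integral>\<omega>. blinfun_apply (hess_xy (G (snd \<omega> (k, b, i, 0))) z) (?W \<omega>) \<partial>\<Omega>)
      = (\<integral>\<zeta>. blinfun_apply (hess_xy (G \<zeta>) z) (\<integral>\<omega>. ?W \<omega> \<partial>\<Omega>) \<partial>Dzeta)"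
    by (rule expectation_random_linear[where T = "\<lambda>\<zeta>. blinfun_apply (hess_xy (G \<zeta>) z)" and C = L and X = ?W
          and j = "(k, b, i, 0)" and K = "M / \<mu>"];
        (rule lin hess_measurable(2) constants_nonneg(2) sample_sum_mean(1) sample_sum_mean(4) |
         erule hess_bound(2) sample_sum_mean(3)))+
  have m1: "(\<lambda>\<omega>. grad_x (F (fst \<omega> (k, b, i))) z) \<in> borel_measurable \<Omega>"
    by (rule measurable_compose[OF coordinate_measurable(1) partial_measurable(1)])
  have i1: "integrable \<Omega> (\<lambda>\<omega>. grad_x (F (fst \<omega> (k, b, i))) z)"
    by (rule P.expectation_norm_le(1)[OF m1 partial_F_bound(1)[OF coordinate_space(1)]])
  have m2: "(\<lambda>\<omega>. blinfun_apply (hess_xy (G (snd \<omega> (k, b, i, 0))) z) (?W \<omega>)) \<in> borel_measurable \<Omega>"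
    by (rule J(1))
  have i2: "integrable \<Omega> (\<lambda>\<omega>. blinfun_apply (hess_xy (G (snd \<omega> (k, b, i, 0))) z) (?W \<omega>))"
  proof (rule P.expectation_norm_le(1)[OF m2])
    fix \<omega> assume w: "\<omega> \<in> space \<Omega>"
    have "norm (blinfun_apply (hess_xy (G (snd \<omega> (k, b, i, 0))) z) (?W \<omega>)) \<le> L * norm (?W \<omega>)"
      by (rule hess_bound(2)[OF coordinate_space(2)[OF w]])
    also have "\<dots> \<le> L * (M / \<mu>)"
      by (rule mult_left_mono[OF sample_sum_mean(3)[OF w] constants_nonneg(2)])
    finally show "norm (blinfun_apply (hess_xy (G (snd \<omega> (k, b, i, 0))) z) (?W \<omega>)) \<le> L * (M / \<mu>)" .
  qed
  show L2: "L2 ?Y"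
  proof (rule L2_bounded)
    show "?Y \<in> borel_measurable \<Omega>" unfolding eq using m1 m2 by (rule borel_measurable_diff)
    show "norm (?Y \<omega>) \<le> hypergrad_max" if "\<omega> \<in> space \<Omega>" for \<omega>
      using that by (intro sample_hypergrad_bound coordinate_space)
  qed
  have "(\<integral>\<omega>. ?Y \<omega> \<partial>\<Omega>) = (\<integral>\<omega>. grad_x (F (fst \<omega> (k, b, i))) z \<partial>\<Omega>)
      - (\<integral>\<omega>. blinfun_apply (hess_xy (G (snd \<omega> (k, b, i, 0))) z) (?W \<omega>) \<partial>\<Omega>)"
    unfolding eq by (rule Bochner_Integration.integral_diff[OF i1 i2])
  also have "\<dots> = mean_Fx z - mean_Hxy z (neumann_sum Q z)"
    unfolding J(2) by (simp add: expectation_coordinate(1)[OF partial_measurable(1)] mean_Fx_def mean_Hxy_def sample_sum_mean(2))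
  finally show mean: "(\<integral>\<omega>. ?Y \<omega> \<partial>\<Omega>) = mean_hypergrad Q z" by (simp add: mean_hypergrad_def)
  have "(\<integral>\<omega>. (norm (?Y \<omega> - mean_hypergrad Q z))\<^sup>2 \<partial>\<Omega>) \<le> (\<integral>\<omega>. (norm (?Y \<omega>))\<^sup>2 \<partial>\<Omega>)"
    by (rule variance_le[OF L2 mean])
  also have "\<dots> \<le> (\<integral>\<omega>. hypergrad_max\<^sup>2 \<partial>\<Omega>)"
  proof (rule integral_mono[OF L2_D(2)[OF L2]])
    show "(norm (?Y \<omega>))\<^sup>2 \<le> hypergrad_max\<^sup>2" if "\<omega> \<in> space \<Omega>" for \<omega>
      using that by (intro power_mono sample_hypergrad_bound coordinate_space norm_ge_zero)
  qed simp
  finally show "(\<integral>\<omega>. (norm (?Y \<omega> - mean_hypergrad Q z))\<^sup>2 \<partial>\<Omega>) \<le> hypergrad_max\<^sup>2"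
    by (simp add: P.prob_space)
qed (auto intro: sample_hypergrad_lipschitz hypergrad_constants_nonneg)

lemma grad_y_estimator:
  "sample_estimator Dxi Dzeta (\<lambda>\<xi> \<zeta>s. grad_y (G (\<zeta>s 0))) mean_Gy L (\<sigma>\<^sup>2)"
proof
  fix k b i :: nat and z
  let ?Y = "\<lambda>\<omega>. grad_y (G (snd \<omega> (k, b, i, 0))) z"
  have m: "?Y \<in> borel_measurable \<Omega>"
    by (rule measurable_compose[OF coordinate_measurable(2) partial_measurable(3)])
  have md: "(\<lambda>\<zeta>. (norm (grad_y (G \<zeta>) z - mean_Gy z))\<^sup>2) \<in> borel_measurable Dzeta"
    using partial_measurable(3)[of z] by measurable
  have le: "(norm (grad_y (G \<zeta>) z - mean_Gy z))\<^sup>2 \<le> (norm (gradient (G \<zeta>) z - gradient (mean_fun Dzeta G) z))\<^sup>2"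
    if "\<zeta> \<in> space Dzeta" for \<zeta>
    using power_mono[OF norm_fst_snd_le(2)[of "gradient (G \<zeta>) z - gradient (mean_fun Dzeta G) z"] norm_ge_zero, of 2]
    by (simp add: grad_y_G[OF that] mean_Gy_eq g_def)
  have int: "integrable Dzeta (\<lambda>\<zeta>. (norm (grad_y (G \<zeta>) z - mean_Gy z))\<^sup>2)"
    by (rule Bochner_Integration.integrable_bound[OF variance_integrable[of z] md]) (use le in \<open>auto intro!: AE_I2\<close>)
  have "L2 (\<lambda>\<omega>. ?Y \<omega> - mean_Gy z)"
    unfolding L2_def using m expectation_coordinate(3)[OF md int] by auto
  from L2_add[OF this L2_const[of "mean_Gy z"]] show "L2 ?Y" by simp
  show "(\<integral>\<omega>. ?Y \<omega> \<partial>\<Omega>) = mean_Gy z"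
    by (simp add: expectation_coordinate(2)[OF partial_measurable(3)] mean_Gy_def)
  have "(\<integral>\<omega>. (norm (?Y \<omega> - mean_Gy z))\<^sup>2 \<partial>\<Omega>) = (\<integral>\<zeta>. (norm (grad_y (G \<zeta>) z - mean_Gy z))\<^sup>2 \<partial>Dzeta)"
    by (rule expectation_coordinate(2)[OF md])
  also have "\<dots> \<le> (\<integral>\<zeta>. (norm (gradient (G \<zeta>) z - gradient (mean_fun Dzeta G) z))\<^sup>2 \<partial>Dzeta)"
    by (intro integral_mono int variance_integrable le)
  also have "\<dots> \<le> \<sigma>\<^sup>2" by (rule variance_bound)
  finally show "(\<integral>\<omega>. (norm (?Y \<omega> - mean_Gy z))\<^sup>2 \<partial>\<Omega>) \<le> \<sigma>\<^sup>2" .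
qed (auto intro: grad_y_G_lipschitz constants_nonneg)

lemma mean_hypergrad_lipschitz: "norm (mean_hypergrad Q z - mean_hypergrad Q z') \<le> hypergrad_lip * norm (z - z')"
  by (rule sample_estimator.mY_lipschitz[OF hypergrad_estimator])

lemma mean_hypergrad_error:
  "norm (mean_hypergrad Q (x, y) - hypergrad x) \<le> hypergrad_lip * norm (y - ystar g x) + bias Q"
proof -
  have "mean_hypergrad Q (x, y) - hypergrad x = (mean_hypergrad Q (x, y) - mean_hypergrad Q (x, ystar g x))
      + (mean_hypergrad Q (x, ystar g x) - hypergrad x)" by simp
  also have "norm \<dots> \<le> hypergrad_lip * norm ((x, y) - (x, ystar g x)) + bias Q"
    by (intro norm_triangle_mono mean_hypergrad_lipschitz mean_hypergrad_bias)
  finally show ?thesis by simp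
qed

definition "Phi_lip = hypergrad_lip * (1 + L / \<mu>)"

lemma Phi_lip_nonneg: "0 \<le> Phi_lip"
  using hypergrad_constants_nonneg constants_nonneg mu_pos by (simp add: Phi_lip_def)

text \<open>The bound is inherited from \<open>mean_hypergrad Q\<close>, whose Lipschitz constant
  does not depend on \<open>Q\<close>, by letting the bias tend to 0. The variation of the adjoint
  solution in z is never estimated directly.\<close>

lemma hypergrad_lipschitz: "norm (hypergrad x - hypergrad x') \<le> Phi_lip * norm (x - x')"
proof -
  let ?z = "(x, ystar g x)" and ?z' = "(x', ystar g x')"
  have le: "norm (hypergrad x - hypergrad x') \<le> (bias Q + bias Q) + Phi_lip * norm (x - x')" for Q
  proof -
    have eq: "hypergrad x - hypergrad x' = (mean_hypergrad Q ?z' - hypergrad x') - (mean_hypergrad Q ?z - hypergrad x)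
        + (mean_hypergrad Q ?z - mean_hypergrad Q ?z')" by simp
    have "norm (?z - ?z') \<le> norm (x - x') + norm (ystar g x - ystar g x')"
      unfolding diff_Pair by (rule norm_Pair_le)
    then have z: "norm (?z - ?z') \<le> (1 + L / \<mu>) * norm (x - x')"
      using ystar_lipschitz[of x x'] by (simp add: distrib_right)
    have "norm (hypergrad x - hypergrad x') \<le> (bias Q + bias Q) + hypergrad_lip * norm (?z - ?z')"
      unfolding eq
      by (rule norm_triangle_mono[OF order_trans[OF norm_triangle_ineq4 add_mono[OF mean_hypergrad_bias mean_hypergrad_bias]]
            mean_hypergrad_lipschitz])
    with mult_left_mono[OF z hypergrad_constants_nonneg(1)] show ?thesis
      by (simp add: Phi_lip_def mult.assoc)
  qed
  have "(\<lambda>Q. (bias Q + bias Q) + Phi_lip * norm (x - x')) \<longlonglongrightarrow> (0 + 0) + Phi_lip * norm (x - x')"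
    by (intro tendsto_intros bias_tendsto_0)
  from LIMSEQ_le_const[OF this, of "norm (hypergrad x - hypergrad x')"] le show ?thesis by simp
qed

lemma Phi_descent: "Phi f g (x + a) \<le> Phi f g x + a \<bullet> hypergrad x + Phi_lip * (norm a)\<^sup>2"
proof -
  have "norm (Phi f g (x + a) - Phi f g x - a \<bullet> hypergrad x) \<le> Phi_lip * (norm a)\<^sup>2"
  proof (rule taylor_lipschitz[OF Phi_has_derivative _ Phi_lip_nonneg])
    fix z z' a :: 'a
    have "norm (a \<bullet> hypergrad z - a \<bullet> hypergrad z') \<le> norm a * norm (hypergrad z - hypergrad z')"
      using Cauchy_Schwarz_ineq2[of a "hypergrad z - hypergrad z'"] by (simp add: inner_diff_right)
    also have "\<dots> \<le> norm a * (Phi_lip * norm (z - z'))" by (intro mult_left_mono hypergrad_lipschitz) auto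
    finally show "norm (a \<bullet> hypergrad z - a \<bullet> hypergrad z') \<le> Phi_lip * norm (z - z') * norm a" by (simp add: mult_ac)
  qed
  then show ?thesis by simp
qed

end

section \<open>The iterates of VRBO\<close>

locale vrbo_run = vrbo_problem \<mu> M L \<tau> \<rho> \<sigma> Dxi Dzeta F G \<eta>
  for \<mu> M L \<tau> \<rho> \<sigma> :: real and Dxi :: "'xi measure" and Dzeta :: "'zeta measure"
    and F :: "'xi \<Rightarrow> 'a::euclidean_space \<times> 'b::euclidean_space \<Rightarrow> real"
    and G :: "'zeta \<Rightarrow> 'a \<times> 'b \<Rightarrow> real" and \<eta> :: real +
  fixes \<alpha> \<beta> :: real and Q S1 S2 q m :: nat and z0 :: "'a \<times> 'b"
  assumes alpha_pos: "0 < \<alpha>" and beta_pos: "0 < \<beta>" and beta_small: "\<beta> * L\<^sup>2 \<le> \<mu>"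
    and S1_pos: "0 < S1" and S2_pos: "0 < S2"
begin

definition "params = \<lparr> par_alpha = \<alpha>, par_beta = \<beta>, par_eta = \<eta>, par_Q = Q,
  par_S1 = S1, par_S2 = S2, par_q = q, par_m = m \<rparr>"

sublocale hg: sample_estimator Dxi Dzeta "sample_hypergrad Q" "mean_hypergrad Q" hypergrad_lip "hypergrad_max\<^sup>2"
  by (rule hypergrad_estimator)

sublocale gy: sample_estimator Dxi Dzeta "\<lambda>\<xi> \<zeta>s. grad_y (G (\<zeta>s 0))" mean_Gy L "\<sigma>\<^sup>2"
  by (rule grad_y_estimator)

lemma batch_eq:
  "batch_hypergrad params F G \<omega> k b s = hg.est k b s \<omega>"
  "batch_grad_y G \<omega> k b s = gy.est k b s \<omega>"
  by (auto simp: fun_eq_iff batch_hypergrad_def batch_grad_y_def params_def hypergrad_est_eq grad_y_est_def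
      hg.est_def hg.one_def gy.est_def gy.one_def)

definition "run k \<omega> = vrbo params F G z0 \<omega> k"
definition "Z k \<omega> = z_out (run k \<omega>)"
text \<open>The estimator in force in iteration k, after the large batch if there is one;
  \<open>run k\<close> holds only what the previous inner loop left over.\<close>

definition "U k \<omega> = (if k mod q = 0 then gy.est k 0 S1 \<omega> (Z k \<omega>) else u_out (run k \<omega>))"
definition "V k \<omega> = (if k mod q = 0 then hg.est k 0 S1 \<omega> (Z k \<omega>) else v_out (run k \<omega>))"
definition "loop k t \<omega> = inner_loop params F G \<omega> k
  \<lparr> z_prev = Z k \<omega>, z_cur = (fst (Z k \<omega>) - \<alpha> *\<^sub>R V k \<omega>, snd (Z k \<omega>)), u_in = U k \<omega>, v_in = V k \<omega> \<rparr> t"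
definition "zp k t \<omega> = z_prev (loop k t \<omega>)"
definition "zc k t \<omega> = z_cur (loop k t \<omega>)"
definition "ui k t \<omega> = u_in (loop k t \<omega>)"
definition "vi k t \<omega> = v_in (loop k t \<omega>)"

lemma inner_0:
  "zp k 0 \<omega> = Z k \<omega>" "zc k 0 \<omega> = (fst (Z k \<omega>) - \<alpha> *\<^sub>R V k \<omega>, snd (Z k \<omega>))" "ui k 0 \<omega> = U k \<omega>" "vi k 0 \<omega> = V k \<omega>"
  by (simp_all add: zp_def zc_def ui_def vi_def loop_def)

lemma inner_Suc:
  "zp k (Suc t) \<omega> = zc k t \<omega>"
  "ui k (Suc t) \<omega> = ui k t \<omega> + gy.est k (Suc t) S2 \<omega> (zc k t \<omega>) - gy.est k (Suc t) S2 \<omega> (zp k t \<omega>)"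
  "vi k (Suc t) \<omega> = vi k t \<omega> + hg.est k (Suc t) S2 \<omega> (zc k t \<omega>) - hg.est k (Suc t) S2 \<omega> (zp k t \<omega>)"
  "zc k (Suc t) \<omega> = (fst (zc k t \<omega>), snd (zc k t \<omega>) - \<beta> *\<^sub>R ui k (Suc t) \<omega>)"
  by (simp_all add: zp_def zc_def ui_def vi_def loop_def inner_step_def Let_def batch_eq) (simp_all add: params_def)

lemma run_0: "Z 0 \<omega> = z0"
  by (simp add: Z_def run_def)

text \<open>After t inner steps \<open>zp\<close> is the point with inner index t - 1. Hence
  \<open>m + 2\<close> steps leave it at index m + 1, the next outer iterate, and \<open>ui\<close>
  and \<open>vi\<close> are the estimators belonging to that point.\<close>

lemma run_Suc:
  "Z (Suc k) \<omega> = zp k (m + 2) \<omega>" "u_out (run (Suc k) \<omega>) = ui k (m + 2) \<omega>" "v_out (run (Suc k) \<omega>) = vi k (m + 2) \<omega>"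
proof -
  have "run (Suc k) \<omega> = \<lparr> z_out = zp k (m + 2) \<omega>, u_out = ui k (m + 2) \<omega>, v_out = vi k (m + 2) \<omega> \<rparr>"
    unfolding run_def vrbo.simps outer_step_def Let_def zp_def ui_def vi_def loop_def U_def V_def Z_def batch_eq
    by (simp add: params_def)
  then show "Z (Suc k) \<omega> = zp k (m + 2) \<omega>" "u_out (run (Suc k) \<omega>) = ui k (m + 2) \<omega>" "v_out (run (Suc k) \<omega>) = vi k (m + 2) \<omega>"
    by (simp_all add: Z_def)
qed

lemma fst_zp: "fst (zp k (Suc t) \<omega>) = fst (Z k \<omega>) - \<alpha> *\<^sub>R V k \<omega>"
  by (induction t) (simp_all add: inner_Suc inner_0)

lemma x_step: "fst (Z (Suc k) \<omega>) = fst (Z k \<omega>) - \<alpha> *\<^sub>R V k \<omega>"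
  using fst_zp[of k "Suc m"] by (simp add: run_Suc)

text \<open>Quantities that coincide on all agreeing sample points are determined by the batches in
  \<open>T\<close>. Combined with \<open>mix2\<close> this yields the freshness conditions of the
  batch error lemmas.\<close>

definition agree :: "(nat \<times> nat) set \<Rightarrow> ('xi, 'zeta) samples \<Rightarrow> ('xi, 'zeta) samples \<Rightarrow> bool" where
  "agree T \<omega> \<omega>' \<longleftrightarrow> (\<forall>(k, b)\<in>T. (\<forall>i. fst \<omega> (k, b, i) = fst \<omega>' (k, b, i)) \<and> (\<forall>i j. snd \<omega> (k, b, i, j) = snd \<omega>' (k, b, i, j)))"

lemma agree_mono: "agree T \<omega> \<omega>' \<Longrightarrow> T' \<subseteq> T \<Longrightarrow> agree T' \<omega> \<omega>'"
  unfolding agree_def by blast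

lemma agree_est: "agree T \<omega> \<omega>' \<Longrightarrow> (k, b) \<in> T \<Longrightarrow> hg.est k b s \<omega> = hg.est k b s \<omega>' \<and> gy.est k b s \<omega> = gy.est k b s \<omega>'"
  by (auto simp: agree_def fun_eq_iff hg.est_def hg.one_def gy.est_def gy.one_def)

lemma agree_mix: "(k, b) \<notin> T \<Longrightarrow> agree T (mix2 (fresh_xi k b) (fresh_zeta k b) \<omega> \<omega>') \<omega>"
  by (auto simp: agree_def mix2_def mix_def fresh_xi_def fresh_zeta_def)

definition "past k = {(k', b). k' < k}"

lemma agree_UV:
  assumes "agree (insert (k, 0) (past k)) \<omega> \<omega>'" and "run k \<omega> = run k \<omega>'"
  shows "U k \<omega> = U k \<omega>'" "V k \<omega> = V k \<omega>'"
  using agree_est[OF assms(1), of k 0] assms(2) by (simp_all add: U_def V_def Z_def)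

text \<open>Batch \<open>Suc t\<close> is drawn in inner step t, so the state before that step is
  determined by the batches 0 to t of iteration k and by all earlier iterations.\<close>

lemma agree_inner:
  assumes "agree ({k} \<times> {..t} \<union> past k) \<omega> \<omega>'" and run: "run k \<omega> = run k \<omega>'"
  shows "zp k t \<omega> = zp k t \<omega>' \<and> zc k t \<omega> = zc k t \<omega>' \<and> ui k t \<omega> = ui k t \<omega>' \<and> vi k t \<omega> = vi k t \<omega>'"
  using assms(1)
proof (induction t)
  case 0
  have "agree (insert (k, 0) (past k)) \<omega> \<omega>'" by (rule agree_mono[OF 0]) auto
  from agree_UV[OF this run] show ?case by (simp add: inner_0 Z_def run)
next
  case (Suc t)
  have "agree ({k} \<times> {..t} \<union> past k) \<omega> \<omega>'" by (rule agree_mono[OF Suc.prems]) auto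
  moreover have "hg.est k (Suc t) S2 \<omega> = hg.est k (Suc t) S2 \<omega>' \<and> gy.est k (Suc t) S2 \<omega> = gy.est k (Suc t) S2 \<omega>'"
    by (rule agree_est[OF Suc.prems]) auto
  ultimately show ?case using Suc.IH by (simp add: inner_Suc)
qed

lemma agree_run: "agree (past k) \<omega> \<omega>' \<Longrightarrow> run k \<omega> = run k \<omega>'"
proof (induction k)
  case (Suc k)
  have r: "run k \<omega> = run k \<omega>'" by (rule Suc.IH, rule agree_mono[OF Suc.prems]) (auto simp: past_def)
  have "agree ({k} \<times> {..m + 2} \<union> past k) \<omega> \<omega>'" by (rule agree_mono[OF Suc.prems]) (auto simp: past_def)
  from agree_inner[OF this r] show ?case
    using run_Suc[of k \<omega>] run_Suc[of k \<omega>'] by (intro outer_state.equality) (simp_all add: Z_def)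
qed (simp add: run_def)

lemma Z_fresh: "Z k (mix2 (fresh_xi k 0) (fresh_zeta k 0) \<omega> \<omega>') = Z k \<omega>"
  unfolding Z_def by (subst agree_run[OF agree_mix]) (auto simp: past_def)

lemma inner_fresh:
  fixes k t \<omega> \<omega>'
  defines "\<omega>'' \<equiv> mix2 (fresh_xi k (Suc t)) (fresh_zeta k (Suc t)) \<omega> \<omega>'"
  shows "zp k t \<omega>'' = zp k t \<omega>" "zc k t \<omega>'' = zc k t \<omega>" "ui k t \<omega>'' = ui k t \<omega>" "vi k t \<omega>'' = vi k t \<omega>"
proof -
  have a: "agree ({k} \<times> {..t} \<union> past k) \<omega>'' \<omega>" unfolding \<omega>''_def by (rule agree_mix) (auto simp: past_def)
  have "run k \<omega>'' = run k \<omega>" by (rule agree_run, rule agree_mono[OF a]) auto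
  from agree_inner[OF a this]
  show "zp k t \<omega>'' = zp k t \<omega>" "zc k t \<omega>'' = zc k t \<omega>" "ui k t \<omega>'' = ui k t \<omega>" "vi k t \<omega>'' = vi k t \<omega>" by auto
qed

lemma inner_L2:
  assumes "L2 (Z k)" "L2 (U k)" "L2 (V k)"
  shows "L2 (zp k t) \<and> L2 (zc k t) \<and> L2 (ui k t) \<and> L2 (vi k t)"
proof (induction t)
  case 0
  show ?case unfolding inner_0 using assms by (auto intro!: L2_Pair L2_diff L2_scaleR L2_fst_snd)
next
  case (Suc t)
  then have u: "L2 (ui k (Suc t))" "L2 (vi k (Suc t))"
    unfolding inner_Suc by (auto intro!: L2_diff L2_add gy.est_at_L2 hg.est_at_L2)
  then have "L2 (zc k (Suc t))"
    unfolding inner_Suc(4) using Suc by (auto intro!: L2_Pair L2_diff L2_scaleR L2_fst_snd)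
  then show ?case using u Suc unfolding inner_Suc(1) by auto
qed

lemma run_L2: "L2 (Z k) \<and> L2 (U k) \<and> L2 (V k)"
proof (induction k)
  case 0
  show ?case unfolding U_def V_def run_0 by (auto simp: run_0 intro!: L2_const gy.est_at_L2 hg.est_at_L2)
next
  case (Suc k)
  then have i: "L2 (zp k t) \<and> L2 (zc k t) \<and> L2 (ui k t) \<and> L2 (vi k t)" for t by (intro inner_L2) auto
  then have Z: "L2 (Z (Suc k))" unfolding run_Suc by simp
  show ?case
  proof (cases "Suc k mod q = 0")
    case True
    then have "U (Suc k) = (\<lambda>\<omega>. gy.est (Suc k) 0 S1 \<omega> (Z (Suc k) \<omega>))" "V (Suc k) = (\<lambda>\<omega>. hg.est (Suc k) 0 S1 \<omega> (Z (Suc k) \<omega>))"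
      by (simp_all add: U_def V_def fun_eq_iff)
    then show ?thesis using Z gy.est_at_L2[OF Z] hg.est_at_L2[OF Z] by simp
  next
    case False
    then have "U (Suc k) = ui k (m + 2)" "V (Suc k) = vi k (m + 2)"
      by (simp_all add: U_def V_def fun_eq_iff run_Suc)
    then show ?thesis using Z i by simp
  qed
qed

lemmas Z_L2 = run_L2[THEN conjunct1] and U_L2 = run_L2[THEN conjunct2, THEN conjunct1]
  and V_L2 = run_L2[THEN conjunct2, THEN conjunct2]

lemma inner_L2':
  "L2 (zp k t)" "L2 (zc k t)" "L2 (ui k t)" "L2 (vi k t)"
  using inner_L2[OF Z_L2 U_L2 V_L2] by auto

section \<open>Contraction of the inner loop\<close>

lemma zc_diff:
  "zc k 0 \<omega> - zp k 0 \<omega> = (- \<alpha> *\<^sub>R V k \<omega>, 0)" "zc k (Suc t) \<omega> - zp k (Suc t) \<omega> = (0, - \<beta> *\<^sub>R ui k (Suc t) \<omega>)"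
  by (simp add: inner_0 prod_eq_iff) (simp add: inner_Suc prod_eq_iff)

text \<open>The first inner step moves x by \<alpha>V at fixed y. It is no gradient step in y and
  may enlarge \<open>u\<close>; contraction starts only with the next step.\<close>

lemma u_first:
  assumes "\<omega> \<in> space \<Omega>"
  shows "norm (ui k 1 \<omega>) \<le> norm (U k \<omega>) + L * \<alpha> * norm (V k \<omega>)"
proof -
  have "ui k 1 \<omega> = U k \<omega> + (gy.est k 1 S2 \<omega> (zc k 0 \<omega>) - gy.est k 1 S2 \<omega> (zp k 0 \<omega>))"
    using inner_Suc(2)[of k 0 \<omega>] by (simp add: inner_0)
  also have "norm \<dots> \<le> norm (U k \<omega>) + L * norm (zc k 0 \<omega> - zp k 0 \<omega>)"
    by (intro order_trans[OF norm_triangle_ineq] add_left_mono gy.est_lipschitz assms)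
  finally show ?thesis using alpha_pos by (simp add: zc_diff)
qed

lemma est_monotone:
  assumes "\<omega> \<in> space \<Omega>" "0 < s"
  shows "\<mu> * (norm (y - y'))\<^sup>2 \<le> (gy.est k b s \<omega> (x, y) - gy.est k b s \<omega> (x, y')) \<bullet> (y - y')"
proof -
  have "(\<Sum>i=1..s. \<mu> * (norm (y - y'))\<^sup>2) \<le> (\<Sum>i=1..s. (gy.one k b i \<omega> (x, y) - gy.one k b i \<omega> (x, y')) \<bullet> (y - y'))"
    unfolding gy.one_def by (intro sum_mono grad_y_G_monotone coordinate_space assms)
  then have "\<mu> * (norm (y - y'))\<^sup>2 \<le> 1 / real s * (\<Sum>i=1..s. (gy.one k b i \<omega> (x, y) - gy.one k b i \<omega> (x, y')) \<bullet> (y - y'))"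
    using assms(2) by (simp add: field_simps)
  then show ?thesis
    by (simp add: gy.est_def inner_sum_left sum_subtractf scaleR_diff_right[symmetric] inner_diff_left)
qed

text \<open>The x-component no longer moves, and both evaluations share one batch, whose averaged
  gradient is strongly monotone in y. The difference of two consecutive points is -\<beta>u, and the
  difference of their images under one gradient step with that batch is -\<beta>u'.\<close>

lemma u_contraction:
  assumes w: "\<omega> \<in> space \<Omega>"
  shows "(norm (ui k (Suc (Suc t)) \<omega>))\<^sup>2 \<le> (1 - \<beta> * \<mu>) * (norm (ui k (Suc t) \<omega>))\<^sup>2"
proof -
  let ?u = "ui k (Suc t) \<omega>" and ?u' = "ui k (Suc (Suc t)) \<omega>"
  obtain x y where zp: "zp k (Suc t) \<omega> = (x, y)" by fastforce
  have zc: "zc k (Suc t) \<omega> = (x, y - \<beta> *\<^sub>R ?u)"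
    using zp zc_diff(2)[of k t \<omega>] by (simp add: prod_eq_iff algebra_simps)
  let ?a = "(y - \<beta> *\<^sub>R ?u) - y"
  let ?b = "gy.est k (Suc (Suc t)) S2 \<omega> (x, y - \<beta> *\<^sub>R ?u) - gy.est k (Suc (Suc t)) S2 \<omega> (x, y)"
  have u': "?u' = ?u + ?b" using inner_Suc(2)[of k "Suc t" \<omega>] by (simp add: zp zc)
  have eq: "?a - \<beta> *\<^sub>R ?b = - \<beta> *\<^sub>R ?u'" unfolding u' by (simp add: algebra_simps)
  have "(norm (?a - \<beta> *\<^sub>R ?b))\<^sup>2 \<le> (1 - \<beta> * \<mu>) * (norm ?a)\<^sup>2"
  proof (rule gradient_step_contraction)
    show "\<mu> * (norm ?a)\<^sup>2 \<le> ?b \<bullet> ?a" by (rule est_monotone[OF w S2_pos])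
    show "norm ?b \<le> L * norm ?a"
      using gy.est_lipschitz[OF w, of k "Suc (Suc t)" S2 "(x, y - \<beta> *\<^sub>R ?u)" "(x, y)"] by simp
  qed (use beta_pos beta_small in auto)
  then have "\<beta>\<^sup>2 * (norm ?u')\<^sup>2 \<le> \<beta>\<^sup>2 * ((1 - \<beta> * \<mu>) * (norm ?u)\<^sup>2)"
    unfolding eq by (simp add: power_mult_distrib mult_ac)
  then show ?thesis using beta_pos by simp
qed

lemma beta_mu: "0 < \<beta> * \<mu>" "\<beta> * \<mu> \<le> 1"
proof -
  show "0 < \<beta> * \<mu>" using beta_pos mu_pos by simp
  have "\<mu> * \<mu> \<le> L * L" using mu_pos mu_le_L by (intro mult_mono) auto
  then have "\<beta> * (\<mu> * \<mu>) \<le> \<beta> * (L * L)" using beta_pos by (intro mult_left_mono) auto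
  also have "\<dots> \<le> \<mu>" using beta_small by (simp add: power2_eq_square)
  finally have "(\<beta> * \<mu>) * \<mu> \<le> 1 * \<mu>" by (simp add: mult_ac)
  then show "\<beta> * \<mu> \<le> 1" using mu_pos by (simp only: mult_le_cancel_right_pos)
qed

lemma u_geometric:
  assumes w: "\<omega> \<in> space \<Omega>"
  shows "(norm (ui k (Suc t) \<omega>))\<^sup>2 \<le> (1 - \<beta> * \<mu>) ^ t * (norm (ui k 1 \<omega>))\<^sup>2"
proof (induction t)
  case (Suc t)
  have "(norm (ui k (Suc (Suc t)) \<omega>))\<^sup>2 \<le> (1 - \<beta> * \<mu>) * (norm (ui k (Suc t) \<omega>))\<^sup>2" by (rule u_contraction[OF w])
  also have "\<dots> \<le> (1 - \<beta> * \<mu>) * ((1 - \<beta> * \<mu>) ^ t * (norm (ui k 1 \<omega>))\<^sup>2)"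
    using beta_mu by (intro mult_left_mono Suc) auto
  finally show ?case by (simp add: mult_ac)
qed simp

end

section \<open>Accumulated errors\<close>

text \<open>After exchanging the sums, index j lies in the window of k only if j < k < j + q, which
  holds for at most q values of k.\<close>

lemma epoch_window_sum:
  fixes w :: "nat \<Rightarrow> real"
  assumes w: "\<And>j. 0 \<le> w j" and q: "0 < q"
  shows "(\<Sum>k<N. \<Sum>j\<in>{k - k mod q..<k}. w j) \<le> real q * (\<Sum>j<N. w j)"
proof -
  have sub: "{k - k mod q..<k} \<subseteq> {j \<in> {..<N}. j < k \<and> k < j + q}" if "k < N" for k
  proof
    fix j assume j: "j \<in> {k - k mod q..<k}"
    have "k mod q < q" using q by simp
    then show "j \<in> {j \<in> {..<N}. j < k \<and> k < j + q}" using j that by auto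
  qed
  have "(\<Sum>k<N. \<Sum>j\<in>{k - k mod q..<k}. w j) \<le> (\<Sum>k<N. \<Sum>j\<in>{j \<in> {..<N}. j < k \<and> k < j + q}. w j)"
    using sub w by (intro sum_mono sum_mono2) auto
  also have "\<dots> = (\<Sum>k<N. \<Sum>j<N. if j < k \<and> k < j + q then w j else 0)"
    by (simp only: sum.inter_filter[OF finite_lessThan])
  also have "\<dots> = (\<Sum>j<N. \<Sum>k<N. if j < k \<and> k < j + q then w j else 0)"
    by (rule sum.swap)
  also have "\<dots> \<le> (\<Sum>j<N. real q * w j)"
  proof (rule sum_mono)
    fix j
    have "(\<Sum>k<N. if j < k \<and> k < j + q then w j else 0) = real (card {k. k < N \<and> j < k \<and> k < j + q}) * w j"
      by (simp add: sum.If_cases Int_def)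
    also have "\<dots> \<le> real q * w j"
    proof (intro mult_right_mono w)
      have "card {k. k < N \<and> j < k \<and> k < j + q} \<le> card {j..<j + q}" by (intro card_mono) auto
      then show "real (card {k. k < N \<and> j < k \<and> k < j + q}) \<le> real q" by simp
    qed
    finally show "(\<Sum>k<N. if j < k \<and> k < j + q then w j else 0) \<le> real q * w j" .
  qed
  finally show ?thesis by (simp add: sum_distrib_left)
qed

text \<open>Unrolling the recursion from the last refresh, at k - k mod q, leaves the refresh error
  plus the movement within the current epoch.\<close>

lemma epoch_error_sum:
  fixes e d w :: "nat \<Rightarrow> real"
  assumes w: "\<And>j. 0 \<le> w j" and r: "0 \<le> r" and q: "0 < q"
    and refresh: "\<And>k. k mod q = 0 \<Longrightarrow> e k \<le> c" and step: "\<And>k. Suc k mod q \<noteq> 0 \<Longrightarrow> e (Suc k) \<le> e k + r * w k"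
  shows "(\<Sum>k<N. e k) \<le> real N * c + r * (real q * (\<Sum>j<N. w j))"
proof -
  have e: "e k \<le> c + r * (\<Sum>j\<in>{k - k mod q..<k}. w j)" for k
  proof (induction k)
    case 0
    show ?case using refresh[of 0] by simp
  next
    case (Suc k)
    show ?case
    proof (cases "Suc k mod q = 0")
      case True
      then show ?thesis using refresh[OF True] by simp
    next
      case False
      then have m: "Suc k mod q = Suc (k mod q)" by (metis mod_Suc)
      have le: "k mod q \<le> k" by simp
      have "e (Suc k) \<le> c + r * (\<Sum>j\<in>{k - k mod q..<k}. w j) + r * w k"
        using step[OF False] Suc by linarith
      also have "\<dots> = c + r * (\<Sum>j\<in>{Suc k - Suc k mod q..<Suc k}. w j)"
        unfolding m using le by (simp add: distrib_left)
      finally show ?thesis .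
    qed
  qed
  have "(\<Sum>k<N. e k) \<le> (\<Sum>k<N. c + r * (\<Sum>j\<in>{k - k mod q..<k}. w j))" by (intro sum_mono e)
  also have "\<dots> = real N * c + r * (\<Sum>k<N. \<Sum>j\<in>{k - k mod q..<k}. w j)"
    by (simp add: sum.distrib sum_distrib_left)
  also have "\<dots> \<le> real N * c + r * (real q * (\<Sum>j<N. w j))"
    by (intro add_left_mono mult_left_mono r epoch_window_sum w q)
  finally show ?thesis .
qed

lemma exp_neg_power: "exp (- x) ^ n = exp (- (x * real n))" for x :: real
  by (simp add: exp_of_nat_mult[symmetric] mult.commute)

lemma square_sum_le: "((x::real) + y)\<^sup>2 \<le> 2 * x\<^sup>2 + 2 * y\<^sup>2"
  using zero_le_power2[of "x - y"] by (simp add: power2_sum power2_diff)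

lemma square_sum3_le: "((x::real) + y + z)\<^sup>2 \<le> 3 * x\<^sup>2 + 3 * y\<^sup>2 + 3 * z\<^sup>2"
  using zero_le_power2[of "x - y"] zero_le_power2[of "x - z"] zero_le_power2[of "y - z"]
  by (simp add: power2_sum power2_diff algebra_simps)

section \<open>Second moments of the estimators, of their errors and of the movement\<close>

context vrbo_run
begin

definition "ms X = (\<integral>\<omega>. (norm (X \<omega>))\<^sup>2 \<partial>\<Omega>)"

lemma ms_nonneg: "0 \<le> ms X"
  unfolding ms_def by (rule integral_nonneg_AE) auto

lemma ms_mono:
  assumes "L2 X" "integrable \<Omega> Y" "\<And>\<omega>. \<omega> \<in> space \<Omega> \<Longrightarrow> (norm (X \<omega>))\<^sup>2 \<le> Y \<omega>"
  shows "ms X \<le> (\<integral>\<omega>. Y \<omega> \<partial>\<Omega>)"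
  unfolding ms_def by (intro integral_mono L2_D(2) assms)

definition "mU k = ms (U k)"
definition "mV k = ms (V k)"
text \<open>The m + 2 pairs are those at which the small batches of iteration k are evaluated; each
  squared distance adds to the errors of \<open>u\<close> and \<open>v\<close>.\<close>

definition "mD k = (\<Sum>t<m+2. ms (\<lambda>\<omega>. zc k t \<omega> - zp k t \<omega>))"
definition "errU k = ms (\<lambda>\<omega>. U k \<omega> - mean_Gy (Z k \<omega>))"
definition "errV k = ms (\<lambda>\<omega>. V k \<omega> - mean_hypergrad Q (Z k \<omega>))"
definition "contraction = (1 - \<beta> * \<mu>) ^ (m + 1)"

lemmas nonneg = ms_nonneg[of "U _", folded mU_def] ms_nonneg[of "V _", folded mV_def]

lemma mD_nonneg: "0 \<le> mD k"
  unfolding mD_def by (intro sum_nonneg ms_nonneg)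

lemma ms_u_first: "ms (ui k 1) \<le> 2 * mU k + 2 * L\<^sup>2 * \<alpha>\<^sup>2 * mV k"
proof -
  have "ms (ui k 1) \<le> (\<integral>\<omega>. 2 * (norm (U k \<omega>))\<^sup>2 + 2 * L\<^sup>2 * \<alpha>\<^sup>2 * (norm (V k \<omega>))\<^sup>2 \<partial>\<Omega>)"
  proof (rule ms_mono[OF inner_L2'(3)])
    fix \<omega> assume w: "\<omega> \<in> space \<Omega>"
    have "(norm (ui k 1 \<omega>))\<^sup>2 \<le> (norm (U k \<omega>) + L * \<alpha> * norm (V k \<omega>))\<^sup>2"
      by (rule power_mono[OF u_first[OF w]]) simp
    also have "\<dots> \<le> 2 * (norm (U k \<omega>))\<^sup>2 + 2 * (L * \<alpha> * norm (V k \<omega>))\<^sup>2" by (rule square_sum_le)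
    finally show "(norm (ui k 1 \<omega>))\<^sup>2 \<le> 2 * (norm (U k \<omega>))\<^sup>2 + 2 * L\<^sup>2 * \<alpha>\<^sup>2 * (norm (V k \<omega>))\<^sup>2"
      by (simp add: power_mult_distrib mult_ac)
  qed (use L2_D(2)[OF U_L2] L2_D(2)[OF V_L2] in auto)
  also have "\<dots> = 2 * mU k + 2 * L\<^sup>2 * \<alpha>\<^sup>2 * mV k"
    using L2_D(2)[OF U_L2] L2_D(2)[OF V_L2] by (simp add: mU_def mV_def ms_def)
  finally show ?thesis .
qed

lemma ms_u_geometric: "ms (ui k (Suc t)) \<le> (1 - \<beta> * \<mu>) ^ t * ms (ui k 1)"
proof -
  have "ms (ui k (Suc t)) \<le> (\<integral>\<omega>. (1 - \<beta> * \<mu>) ^ t * (norm (ui k 1 \<omega>))\<^sup>2 \<partial>\<Omega>)"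
    by (rule ms_mono[OF inner_L2'(3) _ u_geometric]) (use L2_D(2)[OF inner_L2'(3)[of k 1]] in auto)
  then show ?thesis by (simp add: ms_def)
qed

text \<open>The first displacement is \<alpha>V; the later ones are \<beta>u and form a geometric
  series with sum at most 1/(\<beta>\<mu>). One factor \<beta> survives, and it is what later lets
  the movement be absorbed.\<close>

lemma mD_bound: "mD k \<le> \<alpha>\<^sup>2 * (1 + 2 * L\<^sup>2 * \<beta> / \<mu>) * mV k + 2 * \<beta> / \<mu> * mU k"
proof -
  have "mD k = ms (\<lambda>\<omega>. zc k 0 \<omega> - zp k 0 \<omega>) + (\<Sum>t<m+1. ms (\<lambda>\<omega>. zc k (Suc t) \<omega> - zp k (Suc t) \<omega>))"
    unfolding mD_def by (simp add: sum.lessThan_Suc_shift del: sum.lessThan_Suc)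
  also have "\<dots> = \<alpha>\<^sup>2 * mV k + (\<Sum>t<m+1. \<beta>\<^sup>2 * ms (ui k (Suc t)))"
    by (simp add: zc_diff ms_def mV_def power_mult_distrib del: sum.lessThan_Suc)
  also have "\<dots> \<le> \<alpha>\<^sup>2 * mV k + (\<Sum>t<m+1. \<beta>\<^sup>2 * ((1 - \<beta> * \<mu>) ^ t * ms (ui k 1)))"
    by (intro add_left_mono sum_mono mult_left_mono ms_u_geometric) auto
  also have "(\<Sum>t<m+1. \<beta>\<^sup>2 * ((1 - \<beta> * \<mu>) ^ t * ms (ui k 1))) = \<beta>\<^sup>2 * ms (ui k 1) * (\<Sum>t=0..m. (1 - \<beta> * \<mu>) ^ t)"
    unfolding sum_distrib_left by (rule sum.cong) (auto simp: mult_ac)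
  also have "\<dots> \<le> \<beta>\<^sup>2 * ms (ui k 1) * (1 / (\<beta> * \<mu>))"
    using arith_geometric_sum_le(1)[of "1 - \<beta> * \<mu>" m] beta_mu by (intro mult_left_mono mult_nonneg_nonneg ms_nonneg) auto
  also have "\<beta>\<^sup>2 * ms (ui k 1) * (1 / (\<beta> * \<mu>)) = \<beta> / \<mu> * ms (ui k 1)"
    using beta_pos by (simp add: power2_eq_square)
  also have "\<beta> / \<mu> * ms (ui k 1) \<le> \<beta> / \<mu> * (2 * mU k + 2 * L\<^sup>2 * \<alpha>\<^sup>2 * mV k)"
    using beta_pos mu_pos by (intro mult_left_mono ms_u_first) auto
  finally show ?thesis by (simp add: algebra_simps)
qed

lemma err_inner:
  "ms (\<lambda>\<omega>. ui k t \<omega> - mean_Gy (zp k t \<omega>)) \<le> errU k + L\<^sup>2 / real S2 * (\<Sum>s<t. ms (\<lambda>\<omega>. zc k s \<omega> - zp k s \<omega>))"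
  "ms (\<lambda>\<omega>. vi k t \<omega> - mean_hypergrad Q (zp k t \<omega>)) \<le> errV k + hypergrad_lip\<^sup>2 / real S2 * (\<Sum>s<t. ms (\<lambda>\<omega>. zc k s \<omega> - zp k s \<omega>))"
proof (induction t)
  case 0
  {
    case 1 show ?case by (simp add: inner_0 errU_def)
  next
    case 2 show ?case by (simp add: inner_0 errV_def)
  }
next
  case (Suc t)
  {
    case 1
    have "ms (\<lambda>\<omega>. ui k (Suc t) \<omega> - mean_Gy (zp k (Suc t) \<omega>)) \<le> ms (\<lambda>\<omega>. ui k t \<omega> - mean_Gy (zp k t \<omega>))
        + L\<^sup>2 / real S2 * ms (\<lambda>\<omega>. zc k t \<omega> - zp k t \<omega>)"
      unfolding inner_Suc ms_def
      by (rule gy.recursive_batch_error[OF S2_pos]) (rule inner_L2' inner_fresh)+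
    then show ?case using Suc.IH(1) by (simp add: distrib_left)
  next
    case 2
    have "ms (\<lambda>\<omega>. vi k (Suc t) \<omega> - mean_hypergrad Q (zp k (Suc t) \<omega>)) \<le> ms (\<lambda>\<omega>. vi k t \<omega> - mean_hypergrad Q (zp k t \<omega>))
        + hypergrad_lip\<^sup>2 / real S2 * ms (\<lambda>\<omega>. zc k t \<omega> - zp k t \<omega>)"
      unfolding inner_Suc ms_def
      by (rule hg.recursive_batch_error[OF S2_pos]) (rule inner_L2' inner_fresh)+
    then show ?case using Suc.IH(2) by (simp add: distrib_left)
  }
qed

text \<open>The error of \<open>u\<close> at the end of the inner loop. Unlike
  \<open>errU (Suc k)\<close> it refers to the old \<open>u\<close> even when iteration
  \<open>Suc k\<close> draws a large batch.\<close>

definition "preU k = ms (\<lambda>\<omega>. ui k (m + 2) \<omega> - mean_Gy (Z (Suc k) \<omega>))"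

lemma preU_le: "preU k \<le> errU k + L\<^sup>2 / real S2 * mD k"
  using err_inner(1)[of k "m + 2"] by (simp only: preU_def run_Suc mD_def)

lemma err_refresh:
  assumes "k mod q = 0"
  shows "errU k \<le> \<sigma>\<^sup>2 / real S1" "errV k \<le> hypergrad_max\<^sup>2 / real S1"
  using gy.large_batch_error[OF S1_pos Z_L2 Z_fresh, of k] hg.large_batch_error[OF S1_pos Z_L2 Z_fresh, of k] assms
  by (simp_all add: errU_def errV_def U_def V_def ms_def)

lemma err_step:
  assumes "Suc k mod q \<noteq> 0"
  shows "errU (Suc k) \<le> errU k + L\<^sup>2 / real S2 * mD k"
    "errV (Suc k) \<le> errV k + hypergrad_lip\<^sup>2 / real S2 * mD k"
proof -
  have "errU (Suc k) = preU k" using assms by (simp add: errU_def preU_def U_def run_Suc)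
  then show "errU (Suc k) \<le> errU k + L\<^sup>2 / real S2 * mD k" using preU_le by simp
  have "errV (Suc k) = ms (\<lambda>\<omega>. vi k (m + 2) \<omega> - mean_hypergrad Q (zp k (m + 2) \<omega>))"
    using assms by (simp add: errV_def V_def run_Suc)
  then show "errV (Suc k) \<le> errV k + hypergrad_lip\<^sup>2 / real S2 * mD k"
    using err_inner(2)[of k "m + 2"] by (simp only: mD_def)
qed

text \<open>Without a refresh the new \<open>u\<close> is the one contracted by the inner loop. A
  refresh discards it, so the two are compared through their common mean gradient: fresh noise,
  minus the old error, plus the contracted \<open>u\<close>. These three terms cost the factor 3,
  and 6 includes the 2 of \<open>ms_u_first\<close>.\<close>

lemma mU_step: "mU (Suc k) \<le> 3 * (\<sigma>\<^sup>2 / real S1) + 3 * preU k + 6 * contraction * (mU k + L\<^sup>2 * \<alpha>\<^sup>2 * mV k)"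
proof -
  have c0: "0 \<le> contraction" using beta_mu by (simp add: contraction_def)
  have "ms (ui k (m + 2)) \<le> contraction * ms (ui k 1)"
    using ms_u_geometric[of k "m + 1"] by (simp add: contraction_def)
  also have "\<dots> \<le> contraction * (2 * mU k + 2 * L\<^sup>2 * \<alpha>\<^sup>2 * mV k)"
    by (intro mult_left_mono ms_u_first c0)
  finally have last: "3 * ms (ui k (m + 2)) \<le> 6 * contraction * (mU k + L\<^sup>2 * \<alpha>\<^sup>2 * mV k)"
    by (simp add: algebra_simps)
  show ?thesis
  proof (cases "Suc k mod q = 0")
    case False
    then have "U (Suc k) = ui k (m + 2)" by (simp add: U_def fun_eq_iff run_Suc)
    then have "mU (Suc k) = ms (ui k (m + 2))" by (simp add: mU_def)
    moreover have "0 \<le> preU k" "0 \<le> ms (ui k (m + 2))" by (auto simp: preU_def ms_nonneg)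
    moreover have "0 \<le> \<sigma>\<^sup>2 / real S1" by simp
    ultimately show ?thesis using last by linarith
  next
    case True
    let ?n = "\<lambda>\<omega>. U (Suc k) \<omega> - mean_Gy (Z (Suc k) \<omega>)" and ?d = "\<lambda>\<omega>. ui k (m + 2) \<omega> - mean_Gy (Z (Suc k) \<omega>)"
    have n: "L2 ?n" and d: "L2 ?d" by (intro L2_diff U_L2 inner_L2' gy.mY_at_L2 Z_L2)+
    have "mU (Suc k) \<le> (\<integral>\<omega>. 3 * (norm (?n \<omega>))\<^sup>2 + 3 * (norm (?d \<omega>))\<^sup>2 + 3 * (norm (ui k (m + 2) \<omega>))\<^sup>2 \<partial>\<Omega>)"
      unfolding mU_def
    proof (rule ms_mono[OF U_L2])
      fix \<omega>
      have eq: "U (Suc k) \<omega> = ?n \<omega> - ?d \<omega> + ui k (m + 2) \<omega>" by simp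
      have "norm (U (Suc k) \<omega>) \<le> norm (?n \<omega>) + norm (?d \<omega>) + norm (ui k (m + 2) \<omega>)"
        by (subst eq) (rule norm_triangle_mono[OF norm_triangle_ineq4 order_refl])
      then have "(norm (U (Suc k) \<omega>))\<^sup>2 \<le> (norm (?n \<omega>) + norm (?d \<omega>) + norm (ui k (m + 2) \<omega>))\<^sup>2"
        by (rule power_mono) simp
      also have "\<dots> \<le> 3 * (norm (?n \<omega>))\<^sup>2 + 3 * (norm (?d \<omega>))\<^sup>2 + 3 * (norm (ui k (m + 2) \<omega>))\<^sup>2"
        by (rule square_sum3_le)
      finally show "(norm (U (Suc k) \<omega>))\<^sup>2 \<le> 3 * (norm (?n \<omega>))\<^sup>2 + 3 * (norm (?d \<omega>))\<^sup>2 + 3 * (norm (ui k (m + 2) \<omega>))\<^sup>2" .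
    qed (use L2_D(2)[OF n] L2_D(2)[OF d] L2_D(2)[OF inner_L2'(3)] in auto)
    also have "\<dots> = 3 * errU (Suc k) + 3 * preU k + 3 * ms (ui k (m + 2))"
      using L2_D(2)[OF n] L2_D(2)[OF d] L2_D(2)[OF inner_L2'(3)[of k "m + 2"]]
      by (simp add: errU_def preU_def ms_def)
    finally show ?thesis using err_refresh(1)[OF True] last by linarith
  qed
qed

lemma mU_0: "mU 0 \<le> 2 * (\<sigma>\<^sup>2 / real S1) + 2 * (norm (mean_Gy z0))\<^sup>2"
proof -
  let ?n = "\<lambda>\<omega>. U 0 \<omega> - mean_Gy (Z 0 \<omega>)"
  have n: "L2 ?n" by (intro L2_diff U_L2 gy.mY_at_L2 Z_L2)
  have "mU 0 \<le> (\<integral>\<omega>. 2 * (norm (?n \<omega>))\<^sup>2 + 2 * (norm (mean_Gy z0))\<^sup>2 \<partial>\<Omega>)"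
    unfolding mU_def
  proof (rule ms_mono[OF U_L2])
    fix \<omega>
    have "norm (U 0 \<omega>) \<le> norm (?n \<omega>) + norm (mean_Gy z0)"
      using norm_triangle_ineq[of "?n \<omega>" "mean_Gy z0"] by (simp add: run_0)
    then have "(norm (U 0 \<omega>))\<^sup>2 \<le> (norm (?n \<omega>) + norm (mean_Gy z0))\<^sup>2" by (rule power_mono) simp
    also have "\<dots> \<le> 2 * (norm (?n \<omega>))\<^sup>2 + 2 * (norm (mean_Gy z0))\<^sup>2" by (rule square_sum_le)
    finally show "(norm (U 0 \<omega>))\<^sup>2 \<le> 2 * (norm (?n \<omega>))\<^sup>2 + 2 * (norm (mean_Gy z0))\<^sup>2" .
  qed (use L2_D(2)[OF n] in auto)
  also have "\<dots> = 2 * errU 0 + 2 * (norm (mean_Gy z0))\<^sup>2"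
    using L2_D(2)[OF n] by (simp add: errU_def ms_def P.prob_space)
  finally show ?thesis using err_refresh(1)[of 0] by simp
qed

section \<open>Distance of v to the gradient of Phi, and the descent inequality\<close>

definition "mH k = ms (\<lambda>\<omega>. hypergrad (fst (Z k \<omega>)))"
definition "gap k = ms (\<lambda>\<omega>. V k \<omega> - hypergrad (fst (Z k \<omega>)))"

lemma hypergrad_measurable: "hypergrad \<in> borel_measurable borel"
  by (rule borel_measurable_continuous_onI, rule lipschitz_on_continuous_on[of Phi_lip])
    (use hypergrad_lipschitz Phi_lip_nonneg in \<open>auto intro!: lipschitz_onI simp: dist_norm\<close>)

lemma hypergrad_L2: "L2 (\<lambda>\<omega>. hypergrad (fst (Z k \<omega>)))"
  by (rule L2_bounded[OF measurable_compose[OF L2_D(1)[OF L2_fst_snd(1)[OF Z_L2]] hypergrad_measurable] hypergrad_bound])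

text \<open>The gap splits into the error of \<open>v\<close>, the bias, and the effect of y
  differing from \<open>ystar\<close>. The distance to \<open>ystar\<close> is at most the true
  gradient over \<mu>, and the true gradient is at most \<open>u\<close> plus its error. The factor
  6 is 3 for the three terms times 2 for these two.\<close>

lemma gap_bound: "gap k \<le> 3 * errV k + 6 * hypergrad_lip\<^sup>2 / \<mu>\<^sup>2 * (mU k + errU k) + 3 * (bias Q)\<^sup>2"
proof -
  let ?v = "\<lambda>\<omega>. V k \<omega> - mean_hypergrad Q (Z k \<omega>)" and ?u = "\<lambda>\<omega>. U k \<omega> - mean_Gy (Z k \<omega>)"
  have v: "L2 ?v" and u: "L2 ?u" by (intro L2_diff U_L2 V_L2 gy.mY_at_L2 hg.mY_at_L2 Z_L2)+
  have "gap k \<le> (\<integral>\<omega>. 3 * (norm (?v \<omega>))\<^sup>2 + 6 * hypergrad_lip\<^sup>2 / \<mu>\<^sup>2 * ((norm (U k \<omega>))\<^sup>2 + (norm (?u \<omega>))\<^sup>2) + 3 * (bias Q)\<^sup>2 \<partial>\<Omega>)"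
    unfolding gap_def
  proof (rule ms_mono[OF L2_diff[OF V_L2 hypergrad_L2]])
    fix \<omega>
    obtain x y where z: "Z k \<omega> = (x, y)" by fastforce
    have "norm (mean_Gy (x, y)) \<le> norm (U k \<omega>) + norm (?u \<omega>)"
      using norm_triangle_ineq4[of "U k \<omega>" "?u \<omega>"] by (simp add: z)
    then have "\<mu> * norm (y - ystar g x) \<le> norm (U k \<omega>) + norm (?u \<omega>)" using ystar_dist[of y x] by linarith
    then have "(\<mu> * norm (y - ystar g x))\<^sup>2 \<le> (norm (U k \<omega>) + norm (?u \<omega>))\<^sup>2"
      by (rule power_mono) (use mu_pos in simp)
    also have "\<dots> \<le> 2 * (norm (U k \<omega>))\<^sup>2 + 2 * (norm (?u \<omega>))\<^sup>2" by (rule square_sum_le)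
    finally have y: "(norm (y - ystar g x))\<^sup>2 \<le> 2 / \<mu>\<^sup>2 * ((norm (U k \<omega>))\<^sup>2 + (norm (?u \<omega>))\<^sup>2)"
      using mu_pos by (simp add: power_mult_distrib field_simps)
    have c: "3 * (hypergrad_lip\<^sup>2 * (2 / \<mu>\<^sup>2 * s)) = 6 * hypergrad_lip\<^sup>2 / \<mu>\<^sup>2 * s" for s by simp
    have eq: "V k \<omega> - hypergrad (fst (Z k \<omega>)) = ?v \<omega> + (mean_hypergrad Q (x, y) - hypergrad x)" by (simp add: z)
    have "norm (V k \<omega> - hypergrad (fst (Z k \<omega>))) \<le> norm (?v \<omega>) + (hypergrad_lip * norm (y - ystar g x) + bias Q)"
      unfolding eq by (rule norm_triangle_mono[OF order_refl mean_hypergrad_error])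
    then have "(norm (V k \<omega> - hypergrad (fst (Z k \<omega>))))\<^sup>2 \<le> (norm (?v \<omega>) + hypergrad_lip * norm (y - ystar g x) + bias Q)\<^sup>2"
      by (intro power_mono) auto
    also have "\<dots> \<le> 3 * (norm (?v \<omega>))\<^sup>2 + 3 * (hypergrad_lip * norm (y - ystar g x))\<^sup>2 + 3 * (bias Q)\<^sup>2"
      by (rule square_sum3_le)
    also have "\<dots> \<le> 3 * (norm (?v \<omega>))\<^sup>2 + 3 * (hypergrad_lip\<^sup>2 * (2 / \<mu>\<^sup>2 * ((norm (U k \<omega>))\<^sup>2 + (norm (?u \<omega>))\<^sup>2))) + 3 * (bias Q)\<^sup>2"
      unfolding power_mult_distrib by (intro add_mono mult_left_mono y order_refl) auto
    finally show "(norm (V k \<omega> - hypergrad (fst (Z k \<omega>))))\<^sup>2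
      \<le> 3 * (norm (?v \<omega>))\<^sup>2 + 6 * hypergrad_lip\<^sup>2 / \<mu>\<^sup>2 * ((norm (U k \<omega>))\<^sup>2 + (norm (?u \<omega>))\<^sup>2) + 3 * (bias Q)\<^sup>2"
      by (simp only: c)
  qed (use L2_D(2)[OF v] L2_D(2)[OF u] L2_D(2)[OF U_L2[of k]] in auto)
  also have "\<dots> = 3 * errV k + 6 * hypergrad_lip\<^sup>2 / \<mu>\<^sup>2 * (mU k + errU k) + 3 * (bias Q)\<^sup>2"
    using L2_D(2)[OF v] L2_D(2)[OF u] L2_D(2)[OF U_L2[of k]]
    by (simp add: errV_def errU_def mU_def ms_def P.prob_space)
  finally show ?thesis .
qed

text \<open>Polarization turns the inner product of \<open>V\<close> and the gradient into half of
  each square minus half of the gap. The square of \<open>V\<close> is kept because it later pays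
  for the movement. Telescoping and the bound by the infimum happen along each path, so only square
  terms have to be integrable.\<close>

lemma descent_sum:
  assumes bdd: "bdd_below (range (Phi f g))"
  shows "\<alpha> / 2 * (\<Sum>k<N. mH k) + (\<alpha> / 2 - Phi_lip * \<alpha>\<^sup>2) * (\<Sum>k<N. mV k)
    \<le> (Phi f g (fst z0) - (INF x. Phi f g x)) + \<alpha> / 2 * (\<Sum>k<N. gap k)"
proof -
  let ?h = "\<lambda>k \<omega>. hypergrad (fst (Z k \<omega>))" and ?\<Phi> = "\<lambda>k \<omega>. Phi f g (fst (Z k \<omega>))"
  let ?r = "\<lambda>k \<omega>. \<alpha> / 2 * (norm (?h k \<omega>))\<^sup>2 + (\<alpha> / 2 - Phi_lip * \<alpha>\<^sup>2) * (norm (V k \<omega>))\<^sup>2 - \<alpha> / 2 * (norm (V k \<omega> - ?h k \<omega>))\<^sup>2"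
  have step: "?\<Phi> (Suc k) \<omega> \<le> ?\<Phi> k \<omega> - ?r k \<omega>" for k \<omega>
  proof -
    have "?\<Phi> (Suc k) \<omega> \<le> ?\<Phi> k \<omega> + (- \<alpha> *\<^sub>R V k \<omega>) \<bullet> ?h k \<omega> + Phi_lip * (norm (- \<alpha> *\<^sub>R V k \<omega>))\<^sup>2"
      using Phi_descent[of "fst (Z k \<omega>)" "- \<alpha> *\<^sub>R V k \<omega>"] by (simp add: x_step)
    moreover have "(norm (V k \<omega> - ?h k \<omega>))\<^sup>2 = (norm (V k \<omega>))\<^sup>2 - 2 * (V k \<omega> \<bullet> ?h k \<omega>) + (norm (?h k \<omega>))\<^sup>2"
      by (simp add: power2_norm_eq_inner inner_diff_left inner_diff_right inner_commute)
    then have "\<alpha> / 2 * (norm (V k \<omega> - ?h k \<omega>))\<^sup>2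
        = \<alpha> / 2 * ((norm (V k \<omega>))\<^sup>2 - 2 * (V k \<omega> \<bullet> ?h k \<omega>) + (norm (?h k \<omega>))\<^sup>2)"
      by (rule arg_cong)
    ultimately show ?thesis by (simp add: power_mult_distrib algebra_simps)
  qed
  have tele: "?\<Phi> N \<omega> \<le> ?\<Phi> 0 \<omega> - (\<Sum>k<N. ?r k \<omega>)" for \<omega>
  proof (induction N)
    case (Suc N)
    then show ?case using step[of N \<omega>] by simp
  qed simp
  have pw: "(\<Sum>k<N. ?r k \<omega>) \<le> Phi f g (fst z0) - (INF x. Phi f g x)" for \<omega>
    using tele[of \<omega>] cINF_lower[OF bdd, of "fst (Z N \<omega>)"] by (simp add: run_0)
  note [simp] = L2_D(2)[OF hypergrad_L2] L2_D(2)[OF V_L2] L2_D(2)[OF L2_diff[OF V_L2 hypergrad_L2]]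
  have int: "integrable \<Omega> (?r k)" for k by simp
  have "(\<integral>\<omega>. (\<Sum>k<N. ?r k \<omega>) \<partial>\<Omega>) \<le> (\<integral>\<omega>. Phi f g (fst z0) - (INF x. Phi f g x) \<partial>\<Omega>)"
    by (intro integral_mono Bochner_Integration.integrable_sum int pw) auto
  also have "\<dots> = Phi f g (fst z0) - (INF x. Phi f g x)" by (simp add: P.prob_space)
  also have "(\<integral>\<omega>. (\<Sum>k<N. ?r k \<omega>) \<partial>\<Omega>) = (\<Sum>k<N. \<integral>\<omega>. ?r k \<omega> \<partial>\<Omega>)"
    by (rule Bochner_Integration.integral_sum) (rule int)
  also have "\<dots> = (\<Sum>k<N. \<alpha> / 2 * mH k + (\<alpha> / 2 - Phi_lip * \<alpha>\<^sup>2) * mV k - \<alpha> / 2 * gap k)"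
    by (simp add: mH_def mV_def gap_def ms_def)
  finally show ?thesis by (simp add: sum.distrib sum_subtractf sum_distrib_left)
qed

text \<open>A linear system for the sums \<open>A\<close>, \<open>B\<close>, \<open>W\<close> of the
  squares of \<open>u\<close>, of \<open>v\<close> and of the movement. \<open>A\<close> is solved
  for in two rounds, each absorbing half of it; what remains besides noise, bias and start value is
  a multiple of \<open>B\<close>, which \<open>a1\<close> lets the descent inequality
  absorb.\<close>

lemma hypergrad_sum_bound:
  fixes N :: nat
  defines "E \<equiv> 6 * hypergrad_lip\<^sup>2 / \<mu>\<^sup>2"
  assumes bdd: "bdd_below (range (Phi f g))" and q: "0 < q" and contr: "12 * contraction \<le> 1"
    and qS2: "real q + 1 \<le> 2 * L * \<beta> * real S2"
    and b1: "2 * L\<^sup>2 * \<beta> \<le> \<mu>" and b2: "48 * L ^ 3 * \<beta>\<^sup>2 \<le> \<mu>" and b3: "24 * L * \<beta> \<le> 1" and b4: "2 * \<beta> \<le> \<mu>"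
    and b5: "6 * L * hypergrad_lip\<^sup>2 * \<beta> \<le> 1" and b6: "12 * hypergrad_lip\<^sup>2 * L ^ 3 * \<beta> \<le> \<mu>\<^sup>2"
    and a1: "(4 + 4 * L\<^sup>2 * (2 + E)) * \<alpha>\<^sup>2 + 2 * Phi_lip * \<alpha> \<le> 1"
  shows "(\<Sum>k<N. mH k) \<le> 2 * (Phi f g (fst z0) - (INF x. Phi f g x)) / \<alpha>
    + real N * (3 * (hypergrad_max\<^sup>2 / real S1) + 25 * (2 + E) * (\<sigma>\<^sup>2 / real S1) + 3 * (bias Q)\<^sup>2)
    + 4 * (2 + E) * mU 0"
proof -
  define A B W s c1 where "A = (\<Sum>k<N. mU k)" and "B = (\<Sum>k<N. mV k)" and "W = (\<Sum>k<N. mD k)"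
    and "s = \<sigma>\<^sup>2 / real S1" and "c1 = hypergrad_max\<^sup>2 / real S1"
  define eU eV T H where "eU = (\<Sum>k<N. errU k)" and "eV = (\<Sum>k<N. errV k)" and "T = (\<Sum>k<N. gap k)" and "H = (\<Sum>k<N. mH k)"
  have nn: "0 \<le> A" "0 \<le> B" "0 \<le> W" "0 \<le> E" "0 \<le> s"
    by (auto simp: A_def B_def W_def E_def s_def intro!: sum_nonneg nonneg mD_nonneg)
  \<comment> \<open>The hypothesis \<open>qS2\<close> turns (q + 1)/S2 into 2L\<beta>. The
    additional 1 covers the last inner loop before a refresh, which \<open>preU\<close> contains but
    the epoch sum does not.\<close>
  have qr: "C\<^sup>2 / real S2 * (real q * W) + C\<^sup>2 / real S2 * W \<le> 2 * L * C\<^sup>2 * \<beta> * W" for C :: real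
  proof -
    have "C\<^sup>2 / real S2 * (real q * W) + C\<^sup>2 / real S2 * W = C\<^sup>2 * W / real S2 * (real q + 1)" by (simp add: distrib_left distrib_right add_divide_distrib mult_ac)
    also have "\<dots> \<le> C\<^sup>2 * W / real S2 * (2 * L * \<beta> * real S2)" using nn by (intro mult_left_mono qS2) auto
    also have "\<dots> = 2 * L * C\<^sup>2 * \<beta> * W" using S2_pos by simp
    finally show ?thesis .
  qed
  have eU: "eU \<le> real N * s + L\<^sup>2 / real S2 * (real q * W)"
    unfolding eU_def s_def W_def by (rule epoch_error_sum[where w = mD and e = errU, OF mD_nonneg _ q err_refresh(1) err_step(1)]) simp_all
  have eV: "eV \<le> real N * c1 + hypergrad_lip\<^sup>2 / real S2 * (real q * W)"
    unfolding eV_def c1_def W_def by (rule epoch_error_sum[where w = mD and e = errV, OF mD_nonneg _ q err_refresh(2) err_step(2)]) simp_all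
  have L3: "2 * L * L\<^sup>2 * \<beta> * W = 2 * L ^ 3 * \<beta> * W" by (simp add: power2_eq_square power3_eq_cube)
  have r0: "0 \<le> C\<^sup>2 / real S2 * W" for C :: real using nn by simp
  have eU': "eU + L\<^sup>2 / real S2 * W \<le> real N * s + 2 * L ^ 3 * \<beta> * W"
    using eU qr[of L] unfolding L3 by linarith
  have eU2: "eU \<le> real N * s + 2 * L ^ 3 * \<beta> * W" using eU' r0[of L] by linarith
  have eV2: "eV \<le> real N * c1 + 2 * L * hypergrad_lip\<^sup>2 * \<beta> * W"
    using eV qr[of hypergrad_lip] r0[of hypergrad_lip] by linarith
  have pre: "(\<Sum>k<N. preU k) \<le> eU + L\<^sup>2 / real S2 * W"
    unfolding eU_def W_def sum_distrib_left sum.distrib[symmetric] by (rule sum_mono) (rule preU_le)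
  have "A \<le> (\<Sum>k<Suc N. mU k)" unfolding A_def using nonneg(1)[of N] by simp
  also have "\<dots> = mU 0 + (\<Sum>k<N. mU (Suc k))" by (rule sum.lessThan_Suc_shift)
  also have "\<dots> \<le> mU 0 + (\<Sum>k<N. 3 * s + 3 * preU k + 6 * contraction * (mU k + L\<^sup>2 * \<alpha>\<^sup>2 * mV k))"
    unfolding s_def by (intro add_left_mono sum_mono mU_step)
  also have "\<dots> = mU 0 + 3 * (real N * s) + 3 * (\<Sum>k<N. preU k) + 6 * contraction * (A + L\<^sup>2 * \<alpha>\<^sup>2 * B)"
    by (simp add: sum.distrib sum_distrib_left A_def B_def algebra_simps)
  finally have A1: "A \<le> mU 0 + 3 * (real N * s) + 3 * (\<Sum>k<N. preU k) + 6 * contraction * (A + L\<^sup>2 * \<alpha>\<^sup>2 * B)" .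
  have "6 * contraction * (A + L\<^sup>2 * \<alpha>\<^sup>2 * B) \<le> 1 / 2 * (A + L\<^sup>2 * \<alpha>\<^sup>2 * B)"
    using nn contr by (intro mult_right_mono) auto
  note A4 = this
  \<comment> \<open>Half of \<open>A\<close> moves from c to the left side. Doubling the rest gives
    2 (3 + 3) = 12 for the noise, and 12 for the movement from the product of 2, 3 and 2.\<close>
  have aux: "A \<le> 2 * u + 12 * n + 12 * w + x"
    if "A \<le> u + 3 * n + 3 * p + c" "p \<le> e" "e \<le> n + 2 * w" "c \<le> 1 / 2 * (A + x)" for u n w x p c e :: real
  proof -
    have "c \<le> A / 2 + x / 2" using that(4) by simp
    with that(1-3) show ?thesis by argo
  qed
  have A2: "A \<le> 2 * mU 0 + 12 * (real N * s) + 12 * L ^ 3 * \<beta> * W + L\<^sup>2 * \<alpha>\<^sup>2 * B"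
    using aux[OF A1 pre _ A4, of "L ^ 3 * \<beta> * W"] eU' by (simp add: mult.assoc)
  have "W \<le> (\<Sum>k<N. \<alpha>\<^sup>2 * (1 + 2 * L\<^sup>2 * \<beta> / \<mu>) * mV k + 2 * \<beta> / \<mu> * mU k)"
    unfolding W_def by (intro sum_mono mD_bound)
  also have "\<dots> = \<alpha>\<^sup>2 * (1 + 2 * L\<^sup>2 * \<beta> / \<mu>) * B + 2 * \<beta> / \<mu> * A"
    by (simp add: A_def B_def sum.distrib sum_distrib_left)
  also have "\<dots> \<le> \<alpha>\<^sup>2 * 2 * B + 2 * \<beta> / \<mu> * A"
    using nn b1 mu_pos by (intro add_right_mono mult_right_mono mult_left_mono) auto
  finally have W1: "W \<le> 2 * \<alpha>\<^sup>2 * B + 2 * \<beta> / \<mu> * A" by (simp add: mult_ac)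
  have "2 * \<beta> / \<mu> * A \<le> 1 * A" using nn b4 mu_pos by (intro mult_right_mono) auto
  with W1 have W2: "W \<le> 2 * \<alpha>\<^sup>2 * B + A" by linarith
  have L0: "0 \<le> 12 * L ^ 3 * \<beta>" using L_pos beta_pos by simp
  \<comment> \<open>Inserting the movement bound produces another half of \<open>A\<close>, which
    moves to the left for the second time; \<open>b2\<close> and \<open>b3\<close> are the smallness
    conditions for this.\<close>
  have "12 * L ^ 3 * \<beta> * W \<le> 12 * L ^ 3 * \<beta> * (2 * \<alpha>\<^sup>2 * B + 2 * \<beta> / \<mu> * A)"
    by (rule mult_left_mono[OF W1 L0])
  also have "\<dots> = (24 * L * \<beta>) * (L\<^sup>2 * \<alpha>\<^sup>2 * B) + (48 * L ^ 3 * \<beta>\<^sup>2 / \<mu>) * (A / 2)"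
    by (simp add: power2_eq_square power3_eq_cube algebra_simps)
  also have "\<dots> \<le> 1 * (L\<^sup>2 * \<alpha>\<^sup>2 * B) + 1 * (A / 2)"
    using nn b2 b3 mu_pos by (intro add_mono mult_right_mono) auto
  finally have A3: "A \<le> 4 * mU 0 + 24 * (real N * s) + 4 * L\<^sup>2 * \<alpha>\<^sup>2 * B" using A2 by linarith
  have "T \<le> (\<Sum>k<N. 3 * errV k + E * (mU k + errU k) + 3 * (bias Q)\<^sup>2)"
    unfolding T_def E_def by (intro sum_mono gap_bound)
  also have "\<dots> = 3 * eV + E * (A + eU) + 3 * (real N * (bias Q)\<^sup>2)"
    by (simp add: eV_def eU_def A_def sum.distrib sum_distrib_left algebra_simps)
  finally have T1: "T \<le> 3 * eV + E * (A + eU) + 3 * (real N * (bias Q)\<^sup>2)" .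
  have "3 * (2 * L * hypergrad_lip\<^sup>2 * \<beta> * W) = (6 * L * hypergrad_lip\<^sup>2 * \<beta>) * W" by simp
  also have "\<dots> \<le> 1 * W" by (rule mult_right_mono[OF b5 nn(3)])
  finally have T2: "3 * eV \<le> 3 * (real N * c1) + W" using eV2 by linarith
  have "E * (2 * L ^ 3 * \<beta> * W) = (12 * hypergrad_lip\<^sup>2 * L ^ 3 * \<beta> / \<mu>\<^sup>2) * W" by (simp add: E_def)
  also have "\<dots> \<le> 1 * W" using b6 mu_pos nn by (intro mult_right_mono) auto
  finally have "E * (A + eU) \<le> E * A + E * (real N * s) + W"
    using mult_left_mono[OF eU2 nn(4)] by (simp add: distrib_left)
  \<comment> \<open>The movement enters twice, through the errors of \<open>v\<close> and of
    \<open>u\<close>, hence the 2 with \<open>A\<close> and the 4 with \<open>B\<close>. With 24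
    from \<open>A3\<close> and 1 from the error of \<open>u\<close>, the noise below gets
    25.\<close>
  with T1 T2 W2 have "T \<le> 3 * (real N * c1) + 4 * \<alpha>\<^sup>2 * B + (2 * A + E * A) + E * (real N * s) + 3 * (real N * (bias Q)\<^sup>2)"
    by linarith
  moreover have "2 * A + E * A \<le> (2 + E) * (4 * mU 0 + 24 * (real N * s) + 4 * L\<^sup>2 * \<alpha>\<^sup>2 * B)"
    using mult_left_mono[OF A3, of "2 + E"] nn by (simp add: distrib_right)
  moreover have "0 \<le> real N * s" using nn by simp
  ultimately have T3: "T \<le> 3 * (real N * c1) + (4 + 4 * L\<^sup>2 * (2 + E)) * \<alpha>\<^sup>2 * B + 4 * (2 + E) * mU 0
      + 25 * (2 + E) * (real N * s) + 3 * (real N * (bias Q)\<^sup>2)"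
    by (simp add: algebra_simps)
  have "\<alpha> / 2 * H + (\<alpha> / 2 - Phi_lip * \<alpha>\<^sup>2) * B \<le> (Phi f g (fst z0) - (INF x. Phi f g x)) + \<alpha> / 2 * T"
    unfolding H_def B_def T_def by (rule descent_sum[OF bdd])
  then have "2 / \<alpha> * (\<alpha> / 2 * H + (\<alpha> / 2 - Phi_lip * \<alpha>\<^sup>2) * B) \<le> 2 / \<alpha> * ((Phi f g (fst z0) - (INF x. Phi f g x)) + \<alpha> / 2 * T)"
    using alpha_pos by (intro mult_left_mono) auto
  moreover have "2 / \<alpha> * (\<alpha> / 2 * H + (\<alpha> / 2 - Phi_lip * \<alpha>\<^sup>2) * B) = H + (1 - 2 * Phi_lip * \<alpha>) * B"
    using alpha_pos by (simp add: field_simps power2_eq_square)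
  moreover have "2 / \<alpha> * (d + \<alpha> / 2 * T) = 2 * d / \<alpha> + T" for d
    using alpha_pos by (simp add: field_simps)
  ultimately have "H + (1 - 2 * Phi_lip * \<alpha>) * B \<le> 2 * (Phi f g (fst z0) - (INF x. Phi f g x)) / \<alpha> + T"
    by (simp only:)
  moreover have "((4 + 4 * L\<^sup>2 * (2 + E)) * \<alpha>\<^sup>2) * B \<le> (1 - 2 * Phi_lip * \<alpha>) * B"
    using a1 nn by (intro mult_right_mono) auto
  ultimately have "H \<le> 2 * (Phi f g (fst z0) - (INF x. Phi f g x)) / \<alpha> + (3 * (real N * c1) + 4 * (2 + E) * mU 0
      + 25 * (2 + E) * (real N * s) + 3 * (real N * (bias Q)\<^sup>2))"
    using T3 by linarith
  then show ?thesis by (simp add: H_def s_def c1_def algebra_simps)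
qed

lemma contraction_bound:
  assumes "16 \<le> \<beta> * \<mu> * real (m + 1)"
  shows "12 * contraction \<le> 1"
proof -
  have "(1 - \<beta> * \<mu>) ^ (m + 1) \<le> exp (- (\<beta> * \<mu>)) ^ (m + 1)"
    using beta_mu exp_ge_add_one_self[of "- (\<beta> * \<mu>)"] by (intro power_mono) auto
  also have "\<dots> = exp (- (\<beta> * \<mu> * real (m + 1)))" by (rule exp_neg_power)
  also have "\<dots> \<le> exp (- 16)" using assms by simp
  \<comment> \<open>The crude bound exp 16 \<ge> 17 is already enough, as 1/17 is below
    1/12.\<close>
  also have "\<dots> \<le> 1 / 17" using exp_ge_add_one_self[of "16::real"] by (simp add: exp_minus field_simps)
  finally show ?thesis by (simp add: contraction_def)
qed

lemma mean_Gy_start: "norm (mean_Gy z0) \<le> L * norm (snd z0 - ystar g (fst z0))"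
  using mean_Gy_lipschitz[of z0 "(fst z0, ystar g (fst z0))"] by (cases z0) (simp add: mean_Gy_ystar)

lemma output_stationary:
  assumes "(\<Sum>k<Suc K. mH k) \<le> real (Suc K) * \<epsilon>"
  shows "eps_stationary_in_expectation \<epsilon> (Phi f g) (output_space Dxi Dzeta K) (vrbo_output params F G z0)"
proof -
  let ?C = "uniform_count_measure {0..K}"
  let ?X = "\<lambda>w. norm (hypergrad (fst (Z (snd w) (fst w))))"
  interpret C: prob_space ?C by (rule prob_space_uniform_count_measure) auto
  interpret OC: pair_prob_space \<Omega> ?C ..
  have m: "(\<lambda>\<omega>. hypergrad (fst (Z k \<omega>))) \<in> borel_measurable \<Omega>" for k by (rule L2_D(1)[OF hypergrad_L2])
  have mX: "(\<lambda>w. hypergrad (fst (Z (snd w) (fst w)))) \<in> borel_measurable (\<Omega> \<Otimes>\<^sub>M ?C)"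
  proof (rule measurable_compose_countable'[where f = "\<lambda>k w. hypergrad (fst (Z k (fst w)))" and I = "{0..K}"])
    have "snd \<in> \<Omega> \<Otimes>\<^sub>M ?C \<rightarrow>\<^sub>M ?C" by (rule measurable_snd)
    also have "(\<Omega> \<Otimes>\<^sub>M ?C \<rightarrow>\<^sub>M ?C) = (\<Omega> \<Otimes>\<^sub>M ?C \<rightarrow>\<^sub>M count_space {0..K})"
      by (rule measurable_cong_sets) (simp_all add: sets_uniform_count_measure)
    finally show "snd \<in> \<Omega> \<Otimes>\<^sub>M ?C \<rightarrow>\<^sub>M count_space {0..K}" .
  qed (auto intro: measurable_compose[OF measurable_fst m])
  have int: "integrable (\<Omega> \<Otimes>\<^sub>M ?C) (\<lambda>w. (?X w)\<^sup>2)"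
  proof (rule OC.integrable_const_bound[of _ "(M + L * M / \<mu>)\<^sup>2"])
    show "AE w in \<Omega> \<Otimes>\<^sub>M ?C. norm ((?X w)\<^sup>2) \<le> (M + L * M / \<mu>)\<^sup>2"
      using power_mono[OF hypergrad_bound norm_ge_zero, of _ 2] by (intro AE_I2) simp
  qed (use mX in measurable)
  have i: "integrable \<Omega> (\<lambda>\<omega>. (norm (hypergrad (fst (Z k \<omega>))))\<^sup>2)" for k by (rule L2_D(2)[OF hypergrad_L2])
  have "(\<integral>w. (?X w)\<^sup>2 \<partial>(\<Omega> \<Otimes>\<^sub>M ?C)) = (\<integral>\<omega>. \<integral>k. (norm (hypergrad (fst (Z k \<omega>))))\<^sup>2 \<partial>?C \<partial>\<Omega>)"
    using OC.integral_fst'[OF int] by simp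
  also have "\<dots> = (\<integral>\<omega>. (\<Sum>k=0..K. (norm (hypergrad (fst (Z k \<omega>))))\<^sup>2) / real (Suc K) \<partial>\<Omega>)"
    by (simp add: integral_uniform_count_measure)
  also have "\<dots> = (\<Sum>k<Suc K. mH k) / real (Suc K)"
    using i by (simp add: mH_def ms_def atLeast0AtMost lessThan_Suc_atMost)
  also have "\<dots> \<le> \<epsilon>" using assms by (simp add: field_simps)
  finally have le: "(\<integral>w. (?X w)\<^sup>2 \<partial>(\<Omega> \<Otimes>\<^sub>M ?C)) \<le> \<epsilon>" .
  have "Phi f g differentiable (at x)" for x using Phi_has_derivative by (rule differentiableI)
  moreover have "(norm (gradient (Phi f g) (vrbo_output params F G z0 w)))\<^sup>2 = (?X w)\<^sup>2" for w
    by (simp add: gradient_Phi vrbo_output_def Z_def run_def)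
  ultimately show ?thesis
    unfolding eps_stationary_in_expectation_def output_space_def using int le by simp
qed

end

section \<open>Choice of the parameters\<close>

text \<open>This is \<open>hypergrad_lip\<close>, stated outside the locales: the parameters have to
  be chosen from the constants alone, before a problem instance is given.\<close>

definition est_lip :: "real \<Rightarrow> real \<Rightarrow> real \<Rightarrow> real \<Rightarrow> real \<Rightarrow> real" where
  "est_lip \<mu> M L \<tau> \<rho> = L + \<tau> * M / \<mu> + L * (L / \<mu> + \<rho> * M / \<mu>\<^sup>2)"

definition gap_factor :: "real \<Rightarrow> real \<Rightarrow> real \<Rightarrow> real \<Rightarrow> real \<Rightarrow> real" where
  "gap_factor \<mu> M L \<tau> \<rho> = 2 + 6 * (est_lip \<mu> M L \<tau> \<rho>)\<^sup>2 / \<mu>\<^sup>2"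

text \<open>Each summand is the threshold on \<open>L_Q\<close> that one smallness condition on the stepsizes requires.\<close>
definition LQ_min :: "real \<Rightarrow> real \<Rightarrow> real \<Rightarrow> real \<Rightarrow> real \<Rightarrow> real" where
  "LQ_min \<mu> M L \<tau> \<rho> = (let \<Lambda> = est_lip \<mu> M L \<tau> \<rho> in
     1 + 2 * L\<^sup>2 / \<mu> + 48 * L ^ 3 / \<mu> + 24 * L + 2 / \<mu> + 6 * L * \<Lambda>\<^sup>2 + 12 * \<Lambda>\<^sup>2 * L ^ 3 / \<mu>\<^sup>2
     + (4 + 4 * L\<^sup>2 * gap_factor \<mu> M L \<tau> \<rho>) + 2 * \<bar>\<Lambda> * (1 + L / \<mu>)\<bar>)"

lemma LQ_min_bounds:
  fixes \<mu> M L \<tau> \<rho> :: real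
  assumes "0 < \<mu>" "0 < L"
  defines "\<Lambda> \<equiv> est_lip \<mu> M L \<tau> \<rho>" and "C \<equiv> LQ_min \<mu> M L \<tau> \<rho>"
  shows "1 \<le> C" "2 * L\<^sup>2 / \<mu> \<le> C" "48 * L ^ 3 / \<mu> \<le> C" "24 * L \<le> C" "2 / \<mu> \<le> C"
    "6 * L * \<Lambda>\<^sup>2 \<le> C" "12 * \<Lambda>\<^sup>2 * L ^ 3 / \<mu>\<^sup>2 \<le> C"
    "(4 + 4 * L\<^sup>2 * gap_factor \<mu> M L \<tau> \<rho>) + 2 * (\<Lambda> * (1 + L / \<mu>)) \<le> C"
proof -
  have nn: "0 \<le> 2 * L\<^sup>2 / \<mu>" "0 \<le> 48 * L ^ 3 / \<mu>" "0 \<le> 24 * L" "0 \<le> 2 / \<mu>" "0 \<le> 6 * L * \<Lambda>\<^sup>2"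
    "0 \<le> 12 * \<Lambda>\<^sup>2 * L ^ 3 / \<mu>\<^sup>2" "0 \<le> 2 * \<bar>\<Lambda> * (1 + L / \<mu>)\<bar>" using assms by simp_all
  have g: "0 \<le> 4 + 4 * L\<^sup>2 * gap_factor \<mu> M L \<tau> \<rho>" by (auto simp: gap_factor_def intro!: add_nonneg_nonneg mult_nonneg_nonneg)
  have C: "C = 1 + 2 * L\<^sup>2 / \<mu> + 48 * L ^ 3 / \<mu> + 24 * L + 2 / \<mu> + 6 * L * \<Lambda>\<^sup>2 + 12 * \<Lambda>\<^sup>2 * L ^ 3 / \<mu>\<^sup>2
     + (4 + 4 * L\<^sup>2 * gap_factor \<mu> M L \<tau> \<rho>) + 2 * \<bar>\<Lambda> * (1 + L / \<mu>)\<bar>"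
    by (simp only: C_def \<Lambda>_def LQ_min_def Let_def)
  have a: "2 * (\<Lambda> * (1 + L / \<mu>)) \<le> 2 * \<bar>\<Lambda> * (1 + L / \<mu>)\<bar>"
    by (rule mult_left_mono[OF abs_ge_self]) simp
  show "1 \<le> C" "2 * L\<^sup>2 / \<mu> \<le> C" "48 * L ^ 3 / \<mu> \<le> C" "24 * L \<le> C" "2 / \<mu> \<le> C"
    "6 * L * \<Lambda>\<^sup>2 \<le> C" "12 * \<Lambda>\<^sup>2 * L ^ 3 / \<mu>\<^sup>2 \<le> C"
    "(4 + 4 * L\<^sup>2 * gap_factor \<mu> M L \<tau> \<rho>) + 2 * (\<Lambda> * (1 + L / \<mu>)) \<le> C"
    using nn g a unfolding C by linarith+
qed

text \<open>The initial error, the noise and the bias each take a quarter of \<epsilon>. This 4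
  enters all constants: 160 = 4 * 40 with 40 from 2/\<alpha>; 33 = 25 + 8 and 32 = 4 * 8, both with
  the 8 from the start value \<open>mU 0\<close>; 12 = 4 * 3 from the squared bias.\<close>

lemma vrbo_stationary:
  fixes Dxi :: "'xi measure" and Dzeta :: "'zeta measure"
    and F :: "'xi \<Rightarrow> 'a::euclidean_space \<times> 'b::euclidean_space \<Rightarrow> real" and G :: "'zeta \<Rightarrow> 'a \<times> 'b \<Rightarrow> real"
    and \<mu> M L \<tau> \<rho> \<sigma> \<eta> \<Delta> R LQ Lm \<epsilon> :: real and Q S1 S2 q m K :: nat
  defines "\<alpha> \<equiv> 1 / (20 * Lm ^ 3)" and "\<beta> \<equiv> 2 / (13 * LQ)" and "D \<equiv> gap_factor \<mu> M L \<tau> \<rho>"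
    and "\<Phi> \<equiv> Phi (mean_fun Dxi F) (mean_fun Dzeta G)"
  assumes sb: "stochastic_bilevel \<mu> M L \<tau> \<rho> \<sigma> Dxi Dzeta F G"
    and mu: "0 < \<mu>" and eta: "0 < \<eta>" "\<eta> * L \<le> 1" and eps: "0 < \<epsilon>"
    and LQ: "LQ_min \<mu> M L \<tau> \<rho> \<le> LQ" and Lm: "LQ \<le> Lm"
    and m: "16 / (\<mu> * \<beta>) - 1 \<le> real m" and q: "0 < q" "real q + 1 \<le> 2 * L * \<beta> * real S2" and S2: "0 < S2"
    and S1: "4 * (3 * (M + L * M / \<mu>)\<^sup>2 + 33 * D * \<sigma>\<^sup>2) \<le> real S1 * \<epsilon>" "0 < S1"
    and K: "(160 * \<bar>\<Delta>\<bar> + 32 * D * L\<^sup>2 * R\<^sup>2) * Lm ^ 3 \<le> real (Suc K) * \<epsilon>"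
    and Q: "12 * (L * M / \<mu>)\<^sup>2 * exp (- (2 * \<eta> * \<mu> * real (Suc Q))) \<le> \<epsilon>"
    and bdd: "bdd_below (range \<Phi>)" and \<Delta>: "\<Phi> x0 - (INF x. \<Phi> x) \<le> \<Delta>"
    and R: "norm (y0 - ystar (mean_fun Dzeta G) x0) \<le> R"
  shows "eps_stationary_in_expectation \<epsilon> \<Phi> (output_space Dxi Dzeta K)
    (vrbo_output \<lparr> par_alpha = \<alpha>, par_beta = \<beta>, par_eta = \<eta>, par_Q = Q,
       par_S1 = S1, par_S2 = S2, par_q = q, par_m = m \<rparr> F G (x0, y0))"
proof -
  interpret sb: stochastic_bilevel \<mu> M L \<tau> \<rho> \<sigma> Dxi Dzeta F G by (rule sb)
  interpret vp: vrbo_problem \<mu> M L \<tau> \<rho> \<sigma> Dxi Dzeta F G \<eta> by unfold_locales (rule mu eta)+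
  have L: "0 < L" by (rule vp.L_pos)
  let ?C = "LQ_min \<mu> M L \<tau> \<rho>" and ?\<Lambda> = "est_lip \<mu> M L \<tau> \<rho>"
  note C = LQ_min_bounds[OF mu L, of M \<tau> \<rho>]
  have LQ1: "1 \<le> LQ" and Lm1: "1 \<le> Lm" using C(1) LQ Lm by auto
  have Lm3: "Lm \<le> Lm ^ 3" "1 \<le> Lm ^ 3" using Lm1 power_increasing[of 1 3 Lm] one_le_power[of Lm 3] by auto
  have pos: "0 < \<alpha>" "0 < \<beta>" using LQ1 Lm1 by (auto simp: \<alpha>_def \<beta>_def)
  have \<beta>C: "\<beta> * X \<le> 1" "\<alpha> * X \<le> 1" if "X \<le> ?C" for X
  proof -
    have X: "X \<le> LQ" using that LQ by simp
    then show "\<beta> * X \<le> 1" using LQ1 by (simp add: \<beta>_def field_simps)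
    have "X \<le> 20 * Lm ^ 3" using X Lm Lm3 LQ1 by linarith
    moreover have "0 < 20 * Lm ^ 3" using Lm3 by linarith
    ultimately show "\<alpha> * X \<le> 1" unfolding \<alpha>_def by (subst times_divide_eq_left, subst pos_divide_le_eq) simp_all
  qed
  have \<beta>1: "\<beta> \<le> 1" "\<alpha> \<le> 1" using \<beta>C[OF C(1)] by auto
  have b1: "2 * L\<^sup>2 * \<beta> \<le> \<mu>" using \<beta>C(1)[OF C(2)] mu by (simp add: field_simps)
  have bs: "\<beta> * L\<^sup>2 \<le> \<mu>"
  proof -
    have "0 \<le> \<beta> * L\<^sup>2" using pos by simp
    then show ?thesis using b1 by (simp add: mult_ac)
  qed
  interpret vr: vrbo_run \<mu> M L \<tau> \<rho> \<sigma> Dxi Dzeta F G \<eta> \<alpha> \<beta> Q S1 S2 q m "(x0, y0)"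
    by unfold_locales (rule pos bs S1(2) S2)+
  have \<Phi>: "\<Phi> = Phi vp.f vp.g" by (simp add: \<Phi>_def vp.f_def vp.g_def)
  have lip: "vp.hypergrad_lip = ?\<Lambda>" by (simp add: vp.hypergrad_lip_def est_lip_def)
  have D: "2 + 6 * ?\<Lambda>\<^sup>2 / \<mu>\<^sup>2 = D" by (simp add: D_def gap_factor_def)
  have D0: "0 \<le> D" unfolding D[symmetric] by simp
  have m16: "16 \<le> \<beta> * \<mu> * real (m + 1)" using m mu pos by (simp add: field_simps)
  have b2: "48 * L ^ 3 * \<beta>\<^sup>2 \<le> \<mu>"
  proof -
    have "48 * L ^ 3 * \<beta> \<le> \<mu>" using \<beta>C(1)[OF C(3)] mu by (simp add: field_simps)
    moreover have "48 * L ^ 3 * \<beta>\<^sup>2 \<le> 48 * L ^ 3 * \<beta>"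
      using \<beta>1 pos L by (intro mult_left_mono) (auto simp: power2_eq_square mult_left_le)
    ultimately show ?thesis by simp
  qed
  have b3: "24 * L * \<beta> \<le> 1" using \<beta>C(1)[OF C(4)] by (simp add: mult_ac)
  have b4: "2 * \<beta> \<le> \<mu>" using \<beta>C(1)[OF C(5)] mu by (simp add: field_simps)
  have b5: "6 * L * ?\<Lambda>\<^sup>2 * \<beta> \<le> 1" using \<beta>C(1)[OF C(6)] by (simp add: mult_ac)
  have b6: "12 * ?\<Lambda>\<^sup>2 * L ^ 3 * \<beta> \<le> \<mu>\<^sup>2" using \<beta>C(1)[OF C(7)] mu by (simp add: field_simps)
  have a1: "(4 + 4 * L\<^sup>2 * D) * \<alpha>\<^sup>2 + 2 * (?\<Lambda> * (1 + L / \<mu>)) * \<alpha> \<le> 1"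
  proof -
    have "(4 + 4 * L\<^sup>2 * D) * \<alpha>\<^sup>2 \<le> (4 + 4 * L\<^sup>2 * D) * \<alpha>"
      using \<beta>1 pos D0 by (intro mult_left_mono add_nonneg_nonneg mult_nonneg_nonneg) (auto simp: power2_eq_square mult_left_le)
    moreover have "\<alpha> * ((4 + 4 * L\<^sup>2 * D) + 2 * (?\<Lambda> * (1 + L / \<mu>))) \<le> 1"
      unfolding D_def by (rule \<beta>C(2)[OF C(8)])
    ultimately show ?thesis by (simp add: algebra_simps)
  qed
  let ?N = "real (Suc K)"
  let ?c = "3 * (M + L * M / \<mu>)\<^sup>2 + 33 * D * \<sigma>\<^sup>2"
  have N: "1 \<le> ?N" by simp
  have main: "(\<Sum>k<Suc K. vr.mH k) \<le> 2 * (\<Phi> x0 - (INF x. \<Phi> x)) / \<alpha>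
    + ?N * (3 * ((M + L * M / \<mu>)\<^sup>2 / real S1) + 25 * D * (\<sigma>\<^sup>2 / real S1) + 3 * (vp.bias Q)\<^sup>2) + 4 * D * vr.mU 0"
    using vr.hypergrad_sum_bound[OF _ q(1) vr.contraction_bound[OF m16] q(2), of "Suc K"] bdd b1 b2 b3 b4 b5 b6 a1
    by (simp only: \<Phi> lip vp.Phi_lip_def vp.hypergrad_max_def D fst_conv)
  have "2 * (\<Phi> x0 - (INF x. \<Phi> x)) / \<alpha> = 40 * (\<Phi> x0 - (INF x. \<Phi> x)) * Lm ^ 3" by (simp add: \<alpha>_def)
  also have "\<dots> \<le> 40 * \<bar>\<Delta>\<bar> * Lm ^ 3" using \<Delta> Lm1 by (intro mult_right_mono mult_left_mono) auto
  finally have t1: "2 * (\<Phi> x0 - (INF x. \<Phi> x)) / \<alpha> \<le> 40 * \<bar>\<Delta>\<bar> * Lm ^ 3" .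
  have "norm (vp.mean_Gy (x0, y0)) \<le> L * R"
    using order_trans[OF vr.mean_Gy_start mult_left_mono[of _ R L]] R L by (simp add: vp.g_def)
  then have "(norm (vp.mean_Gy (x0, y0)))\<^sup>2 \<le> L\<^sup>2 * R\<^sup>2"
    using power_mono[of _ "L * R" 2] by (simp add: power_mult_distrib)
  then have "4 * D * vr.mU 0 \<le> 4 * D * (2 * (\<sigma>\<^sup>2 / real S1) + 2 * (L\<^sup>2 * R\<^sup>2))"
    using vr.mU_0 D0 by (intro mult_left_mono) auto
  \<comment> \<open>The factors 1 are placeholders, enlarged in the next line to \<open>?N\<close>
    and \<open>Lm ^ 3\<close>.\<close>
  also have "\<dots> = 1 * (8 * D * (\<sigma>\<^sup>2 / real S1)) + 8 * D * L\<^sup>2 * R\<^sup>2 * 1" by (simp add: algebra_simps)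
  also have "\<dots> \<le> ?N * (8 * D * (\<sigma>\<^sup>2 / real S1)) + 8 * D * L\<^sup>2 * R\<^sup>2 * Lm ^ 3"
    using D0 N Lm3 by (intro add_mono mult_right_mono mult_left_mono) auto
  finally have t2: "4 * D * vr.mU 0 \<le> ?N * (8 * D * (\<sigma>\<^sup>2 / real S1)) + 8 * D * L\<^sup>2 * R\<^sup>2 * Lm ^ 3" .
  have t3: "40 * \<bar>\<Delta>\<bar> * Lm ^ 3 + 8 * D * L\<^sup>2 * R\<^sup>2 * Lm ^ 3 \<le> ?N * (\<epsilon> / 4)" using K by (simp add: algebra_simps)
  have "?c / real S1 \<le> \<epsilon> / 4" using S1 by (simp add: field_simps)
  then have t4: "?N * (?c / real S1) \<le> ?N * (\<epsilon> / 4)" by (intro mult_left_mono) auto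
  have "(1 - \<eta> * \<mu>) ^ Suc Q \<le> exp (- (\<eta> * \<mu>)) ^ Suc Q"
    using vp.eta_mu exp_ge_add_one_self[of "- (\<eta> * \<mu>)"] by (intro power_mono) auto
  also have "\<dots> = exp (- (\<eta> * \<mu> * real (Suc Q)))" by (rule exp_neg_power)
  finally have "((1 - \<eta> * \<mu>) ^ Suc Q)\<^sup>2 \<le> (exp (- (\<eta> * \<mu> * real (Suc Q))))\<^sup>2"
    using vp.eta_mu by (intro power_mono zero_le_power) auto
  also have "\<dots> = exp (- (2 * \<eta> * \<mu> * real (Suc Q)))" by (simp add: power2_eq_square exp_add[symmetric] algebra_simps)
  finally have e: "((1 - \<eta> * \<mu>) ^ Suc Q)\<^sup>2 \<le> exp (- (2 * \<eta> * \<mu> * real (Suc Q)))" .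
  have "12 * (vp.bias Q)\<^sup>2 = 12 * (L * M / \<mu>)\<^sup>2 * ((1 - \<eta> * \<mu>) ^ Suc Q)\<^sup>2"
    by (simp only: vp.bias_def power_mult_distrib mult.assoc)
  also have "\<dots> \<le> 12 * (L * M / \<mu>)\<^sup>2 * exp (- (2 * \<eta> * \<mu> * real (Suc Q)))" by (intro mult_left_mono e) auto
  also have "\<dots> \<le> \<epsilon>" by (rule Q)
  finally have t5: "?N * (3 * (vp.bias Q)\<^sup>2) \<le> ?N * (\<epsilon> / 4)" by (intro mult_left_mono) auto
  have split: "?N * (3 * ((M + L * M / \<mu>)\<^sup>2 / real S1) + 25 * D * (\<sigma>\<^sup>2 / real S1) + 3 * (vp.bias Q)\<^sup>2)
      + ?N * (8 * D * (\<sigma>\<^sup>2 / real S1)) = ?N * (?c / real S1) + ?N * (3 * (vp.bias Q)\<^sup>2)"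
    by (simp add: add_divide_distrib algebra_simps)
  have aux: "h \<le> e + e + e" if "h \<le> a + n + u" "a \<le> d" "u \<le> n' + r" "d + r \<le> e" "n + n' = p + t" "p \<le> e" "t \<le> e"
    for h a n u d n' r e p t :: real using that by argo
  have "(\<Sum>k<Suc K. vr.mH k) \<le> ?N * (\<epsilon> / 4) + ?N * (\<epsilon> / 4) + ?N * (\<epsilon> / 4)"
    by (rule aux[OF main t1 t2 t3 split t4 t5])
  also have "\<dots> \<le> ?N * \<epsilon>" using eps N by (simp add: field_simps)
  finally show ?thesis using vr.output_stationary[of K \<epsilon>] by (simp only: \<Phi> vr.params_def)
qed

section \<open>Asymptotics\<close>

text \<open>Both exponents add under products, so the complexity can be computed factor by factor;
  \<open>soft_O\<close> then forgets the exponent of the logarithm.\<close>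

definition eps_log :: "real \<Rightarrow> nat \<Rightarrow> (real \<Rightarrow> real) set" where
  "eps_log a n = O[at_right 0](\<lambda>\<epsilon>. \<epsilon> powr a * ln (1 / \<epsilon>) ^ n)"

lemma eventually_small: "eventually (\<lambda>\<epsilon>::real. 0 < \<epsilon> \<and> \<epsilon> < 1 \<and> 1 \<le> ln (1 / \<epsilon>)) (at_right 0)"
proof -
  have "\<forall>\<^sub>F \<epsilon> in at_right 0. \<epsilon> \<in> {0<..<exp (- 1 :: real)}" by (rule eventually_at_right_real) simp
  then show ?thesis
  proof (rule eventually_mono)
    fix \<epsilon> :: real assume e: "\<epsilon> \<in> {0<..<exp (- 1)}"
    then have "ln \<epsilon> \<le> ln (exp (- 1))" by (subst ln_le_cancel_iff) auto
    moreover have "\<epsilon> < 1"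
    proof -
      have "\<epsilon> < exp (- 1)" using e by simp
      also have "exp (- 1 :: real) < 1" by simp
      finally show ?thesis .
    qed
    ultimately show "0 < \<epsilon> \<and> \<epsilon> < 1 \<and> 1 \<le> ln (1 / \<epsilon>)" using e by (auto simp: ln_div)
  qed
qed

lemma eps_logI:
  assumes "\<And>\<epsilon>. 0 < \<epsilon> \<Longrightarrow> \<epsilon> < 1 \<Longrightarrow> 1 \<le> ln (1 / \<epsilon>) \<Longrightarrow> \<bar>h \<epsilon>\<bar> \<le> c * (\<epsilon> powr a * ln (1 / \<epsilon>) ^ n)"
  shows "h \<in> eps_log a n"
  unfolding eps_log_def
proof (rule bigoI[where c = c])
  show "\<forall>\<^sub>F \<epsilon> in at_right 0. norm (h \<epsilon>) \<le> c * norm (\<epsilon> powr a * ln (1 / \<epsilon>) ^ n)"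
    using eventually_small
  proof (rule eventually_mono)
    fix \<epsilon> :: real assume e: "0 < \<epsilon> \<and> \<epsilon> < 1 \<and> 1 \<le> ln (1 / \<epsilon>)"
    then have "0 \<le> \<epsilon> powr a * ln (1 / \<epsilon>) ^ n" by (intro mult_nonneg_nonneg zero_le_power) auto
    then show "norm (h \<epsilon>) \<le> c * norm (\<epsilon> powr a * ln (1 / \<epsilon>) ^ n)" using assms[of \<epsilon>] e by simp
  qed
qed

lemma eps_log_const: "(\<lambda>_. c) \<in> eps_log 0 0"
  by (rule eps_logI[of _ "\<bar>c\<bar>"]) simp

lemma eps_log_add: "f \<in> eps_log a n \<Longrightarrow> g \<in> eps_log a n \<Longrightarrow> (\<lambda>\<epsilon>. f \<epsilon> + g \<epsilon>) \<in> eps_log a n"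
  unfolding eps_log_def by (rule sum_in_bigo)

lemma eps_log_mult: "f \<in> eps_log a n \<Longrightarrow> g \<in> eps_log b m \<Longrightarrow> (\<lambda>\<epsilon>. f \<epsilon> * g \<epsilon>) \<in> eps_log (a + b) (n + m)"
  unfolding eps_log_def using landau_o.big.mult[of f "at_right 0" "\<lambda>\<epsilon>. \<epsilon> powr a * ln (1 / \<epsilon>) ^ n" g "\<lambda>\<epsilon>. \<epsilon> powr b * ln (1 / \<epsilon>) ^ m"]
  by (simp add: powr_add power_add mult_ac)

lemma eps_log_mono:
  assumes "f \<in> eps_log a n" "b \<le> a" "n \<le> m"
  shows "f \<in> eps_log b m"
proof -
  have "(\<lambda>\<epsilon>. \<epsilon> powr a * ln (1 / \<epsilon>) ^ n) \<in> eps_log b m"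
  proof (rule eps_logI[of _ 1])
    fix \<epsilon> :: real assume e: "0 < \<epsilon>" "\<epsilon> < 1" "1 \<le> ln (1 / \<epsilon>)"
    have "\<epsilon> powr a * ln (1 / \<epsilon>) ^ n \<le> \<epsilon> powr b * ln (1 / \<epsilon>) ^ m"
      using e assms by (intro mult_mono powr_mono' power_increasing) auto
    moreover have "0 \<le> \<epsilon> powr a * ln (1 / \<epsilon>) ^ n" using e by (intro mult_nonneg_nonneg zero_le_power) auto
    ultimately show "\<bar>\<epsilon> powr a * ln (1 / \<epsilon>) ^ n\<bar> \<le> 1 * (\<epsilon> powr b * ln (1 / \<epsilon>) ^ m)" by simp
  qed
  then show ?thesis using assms(1) unfolding eps_log_def by (rule landau_o.big_trans[rotated])
qed

lemma eps_log_bound: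
  assumes "g \<in> eps_log a n" "\<And>\<epsilon>. 0 < \<epsilon> \<Longrightarrow> \<epsilon> < 1 \<Longrightarrow> 1 \<le> ln (1 / \<epsilon>) \<Longrightarrow> \<bar>f \<epsilon>\<bar> \<le> \<bar>g \<epsilon>\<bar>"
  shows "f \<in> eps_log a n"
proof -
  have "f \<in> O[at_right 0](g)"
    by (rule bigoI[where c = 1], rule eventually_mono[OF eventually_small]) (use assms(2) in auto)
  then show ?thesis using assms(1) unfolding eps_log_def by (rule landau_o.big_trans)
qed

lemma eps_log_soft_O: "f \<in> eps_log a n \<Longrightarrow> f \<in> soft_O (\<lambda>\<epsilon>. \<epsilon> powr a)"
  by (auto simp: soft_O_def eps_log_def)

lemma ceiling_le: "0 \<le> x \<Longrightarrow> real (nat \<lceil>x\<rceil>) \<le> x + 1" for x :: real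
  by linarith

lemma refresh_count: "card {k \<in> {0..n}. k mod r = 0} \<le> n div r + 1" if "0 < r" for n r :: nat
proof -
  have "{k \<in> {0..n}. k mod r = 0} \<subseteq> (\<lambda>i. i * r) ` {0..n div r}"
  proof
    fix k assume k: "k \<in> {k \<in> {0..n}. k mod r = 0}"
    then have "k = k div r * r" "k div r \<le> n div r" by (auto simp: div_le_mono)
    then show "k \<in> (\<lambda>i. i * r) ` {0..n div r}" by auto
  qed
  then have "card {k \<in> {0..n}. k mod r = 0} \<le> card ((\<lambda>i. i * r) ` {0..n div r})" by (intro card_mono) auto
  also have "\<dots> \<le> n div r + 1" using card_image_le[of "{0..n div r}" "\<lambda>i. i * r"] by simp
  finally show ?thesis .
qed

text \<open>Large batches occur at most n / r + 1 times, the 1 accounting for iteration 0. The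
  quotient is written as a product with \<open>1 / real r\<close> to fit
  \<open>eps_log_mult\<close>.\<close>

lemma complexity_sum:
  fixes n r t x y :: nat
  assumes "0 < r"
  shows "real (\<Sum>k=0..n. (if k mod r = 0 then x else 0) + (\<Sum>i=0..t + 1. y))
    \<le> real x * ((real n + 1) * (1 / real r) + 1) + (real n + 1) * (real t + 2) * real y"
proof -
  have "(\<Sum>k=0..n. if k mod r = 0 then x else 0) = card {k \<in> {0..n}. k mod r = 0} * x"
    by (simp add: sum.inter_filter[symmetric])
  also have "\<dots> \<le> (n div r + 1) * x" by (intro mult_right_mono refresh_count assms) simp
  finally have "real (\<Sum>k=0..n. if k mod r = 0 then x else 0) \<le> real ((n div r + 1) * x)" by (rule of_nat_mono)
  also have "\<dots> = (real (n div r) + 1) * real x" by (simp add: distrib_right)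
  also have "\<dots> \<le> ((real n + 1) * (1 / real r) + 1) * real x"
  proof (intro mult_right_mono add_right_mono)
    have "real (n div r) \<le> real n / real r" 
      using assms by (simp add: pos_le_divide_eq flip: of_nat_mult)
    also have "\<dots> \<le> (real n + 1) * (1 / real r)" by (simp add: divide_right_mono)
    finally show "real (n div r) \<le> (real n + 1) * (1 / real r)" .
  qed simp
  finally have le: "real (\<Sum>k=0..n. if k mod r = 0 then x else 0) \<le> real x * ((real n + 1) * (1 / real r) + 1)"
    by (simp only: mult.commute)
  have "(\<Sum>k=0..n. (if k mod r = 0 then x else 0) + (\<Sum>i=0..t + 1. y))
      = (\<Sum>k=0..n. if k mod r = 0 then x else 0) + (n + 1) * (t + 2) * y"
    by (simp add: sum.distrib algebra_simps)
  then have "real (\<Sum>k=0..n. (if k mod r = 0 then x else 0) + (\<Sum>i=0..t + 1. y))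
      = real (\<Sum>k=0..n. if k mod r = 0 then x else 0) + (real n + 1) * (real t + 2) * real y"
    by (simp only: of_nat_add of_nat_mult of_nat_1 of_nat_numeral)
  with le show ?thesis by (simp only: add_right_mono)
qed

section \<open>Explicit parameter functions of epsilon\<close>

locale parameter_choice =
  fixes \<mu> M L \<tau> \<rho> \<sigma> \<eta> \<Delta> R :: real
  assumes mu: "0 < \<mu>" and eta: "0 < \<eta>" and L: "0 < L"
begin

definition "D = gap_factor \<mu> M L \<tau> \<rho>"
definition "C = LQ_min \<mu> M L \<tau> \<rho>"

text \<open>The constant part of the truncation depth is what makes \<open>L_Q\<close> exceed any given threshold, so
  that the stepsizes are as small as needed.\<close>
definition "Q_min = nat \<lceil>C / (L\<^sup>2 * \<eta>)\<rceil> + nat \<lceil>6 * (L * M / \<mu>)\<^sup>2 / (\<eta> * \<mu>)\<rceil>"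
definition "Q \<epsilon> = Q_min + nat \<lceil>ln (1 / \<epsilon>) / (2 * \<eta> * \<mu>)\<rceil>"
definition "LQ \<epsilon> = L_Q M L \<tau> \<rho> \<eta> (Q \<epsilon>)"
definition "Lm \<epsilon> = max (LQ \<epsilon>) (L_Phi \<mu> M L \<tau> \<rho>)"
definition "\<beta> \<epsilon> = 2 / (13 * LQ \<epsilon>)"
definition "S1_const = 4 * (3 * (M + L * M / \<mu>)\<^sup>2 + 33 * D * \<sigma>\<^sup>2) + 1"
text \<open>The first summand makes L\<beta>S2 at least 2, which pays for the rounding of
  \<open>q\<close>; the second gives the prescribed lower bound on the batch size.\<close>

definition "S2_const = 13 / L + 2 * (L / \<mu> + 1) * L"
definition "K_const = 160 * \<bar>\<Delta>\<bar> + 32 * D * L\<^sup>2 * R\<^sup>2"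
definition "S1 \<epsilon> = nat \<lceil>S1_const / \<epsilon>\<rceil>"
definition "S2 \<epsilon> = nat \<lceil>\<epsilon> powr (-0.5)\<rceil> + nat \<lceil>S2_const * LQ \<epsilon>\<rceil> + 1"
definition "K \<epsilon> = nat \<lceil>K_const * Lm \<epsilon> ^ 3 / \<epsilon>\<rceil>"
definition "m \<epsilon> = nat \<lceil>16 / (\<mu> * \<beta> \<epsilon>) - 1\<rceil>"
definition "q \<epsilon> = nat \<lceil>\<mu> * L * \<beta> \<epsilon> * real (S2 \<epsilon>) / (\<mu> + L)\<rceil>"

lemma D_nonneg: "0 \<le> D"
  by (simp add: D_def gap_factor_def)

text \<open>Of the four terms under the root, the one with L^4 \<eta>^2 (Q + 1)^2 suffices: as L and
  \<eta> are positive, it makes the root grow at least linearly in \<open>Q\<close> whatever the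
  other constants are.\<close>

lemma LQ_ge: "C \<le> LQ \<epsilon>"
proof -
  have le: "L\<^sup>2 * \<eta> * (real (Q \<epsilon>) + 1) \<le> LQ \<epsilon>"
    unfolding LQ_def L_Q_def
  proof (rule real_le_rsqrt)
    let ?n = "real (Q \<epsilon>)"
    have "(L\<^sup>2 * \<eta> * (?n + 1))\<^sup>2 = L ^ 4 * \<eta>\<^sup>2 * (?n + 1)\<^sup>2"
      by (simp add: power_mult_distrib flip: power_mult)
    moreover have "0 \<le> L ^ 4 * \<eta>\<^sup>2 * (?n + 1)\<^sup>2" "0 \<le> 2 * L\<^sup>2" "0 \<le> 4 * \<tau>\<^sup>2 * \<eta>\<^sup>2 * M\<^sup>2 * (?n + 1)\<^sup>2"
      "0 \<le> 2 * L\<^sup>2 * \<eta> ^ 4 * M\<^sup>2 * \<rho>\<^sup>2 * ?n\<^sup>2 * (?n + 1)\<^sup>2" by simp_all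
    ultimately show "(L\<^sup>2 * \<eta> * (?n + 1))\<^sup>2 \<le> 2 * L\<^sup>2 + 4 * \<tau>\<^sup>2 * \<eta>\<^sup>2 * M\<^sup>2 * (?n + 1)\<^sup>2
        + 8 * L ^ 4 * \<eta>\<^sup>2 * (?n + 1)\<^sup>2 + 2 * L\<^sup>2 * \<eta> ^ 4 * M\<^sup>2 * \<rho>\<^sup>2 * ?n\<^sup>2 * (?n + 1)\<^sup>2"
      by linarith
  qed
  have "C / (L\<^sup>2 * \<eta>) \<le> real (nat \<lceil>C / (L\<^sup>2 * \<eta>)\<rceil>)" by (rule real_nat_ceiling_ge)
  also have "\<dots> \<le> real (Q \<epsilon>) + 1" by (simp add: Q_def Q_min_def)
  finally have "C \<le> L\<^sup>2 * \<eta> * (real (Q \<epsilon>) + 1)" using L eta by (simp add: divide_le_eq mult_ac)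
  then show ?thesis using le by linarith
qed

lemma LQ_ge_1: "1 \<le> LQ \<epsilon>" and LQ_le_Lm: "LQ \<epsilon> \<le> Lm \<epsilon>" and Lm_ge_1: "1 \<le> Lm \<epsilon>"
  using LQ_ge[of \<epsilon>] LQ_min_bounds(1)[OF mu L, of M \<tau> \<rho>] by (auto simp: C_def Lm_def)

lemma beta_pos: "0 < \<beta> \<epsilon>" "\<beta> \<epsilon> \<le> 1"
  using LQ_ge_1[of \<epsilon>] by (auto simp: \<beta>_def)

lemma S2_real: "real (S2 \<epsilon>) = real (nat \<lceil>\<epsilon> powr (-0.5)\<rceil>) + real (nat \<lceil>S2_const * LQ \<epsilon>\<rceil>) + 1"
  by (simp only: S2_def of_nat_add of_nat_1)

lemma S2_pos: "0 < S2 \<epsilon>"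
  by (simp only: S2_def Suc_eq_plus1[symmetric] zero_less_Suc)

lemma S2_ge: "S2_const * LQ \<epsilon> + 1 \<le> real (S2 \<epsilon>)" "\<epsilon> powr (-0.5) \<le> real (S2 \<epsilon>)"
proof -
  have x: "x \<le> real (nat \<lceil>x\<rceil>)" for x :: real by (rule real_nat_ceiling_ge)
  have nn: "0 \<le> real (nat i)" for i by simp
  show "S2_const * LQ \<epsilon> + 1 \<le> real (S2 \<epsilon>)"
    unfolding S2_real using x[of "S2_const * LQ \<epsilon>"] nn[of "\<lceil>\<epsilon> powr (-0.5)\<rceil>"] by argo
  show "\<epsilon> powr (-0.5) \<le> real (S2 \<epsilon>)"
    unfolding S2_real using x[of "\<epsilon> powr (-0.5)"] nn[of "\<lceil>S2_const * LQ \<epsilon>\<rceil>"] by argo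
qed

lemma S2_cond: "2 * (L / \<mu> + 1) * L * \<beta> \<epsilon> \<le> real (S2 \<epsilon>)"
proof -
  have "2 * (L / \<mu> + 1) * L * \<beta> \<epsilon> \<le> 2 * (L / \<mu> + 1) * L * LQ \<epsilon>"
    using beta_pos[of \<epsilon>] LQ_ge_1[of \<epsilon>] mu L by (intro mult_left_mono) auto
  also have "\<dots> \<le> S2_const * LQ \<epsilon>"
    using LQ_ge_1[of \<epsilon>] L by (intro mult_right_mono) (auto simp: S2_const_def)
  finally show ?thesis using S2_ge(1)[of \<epsilon>] by linarith
qed

lemma q_bounds: "0 < q \<epsilon>" "real (q \<epsilon>) + 1 \<le> 2 * L * \<beta> \<epsilon> * real (S2 \<epsilon>)"
  "\<mu> * L * \<beta> \<epsilon> * real (S2 \<epsilon>) / (\<mu> + L) \<le> real (q \<epsilon>)"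
proof -
  let ?x = "L * \<beta> \<epsilon> * real (S2 \<epsilon>)"
  let ?y = "\<mu> * L * \<beta> \<epsilon> * real (S2 \<epsilon>) / (\<mu> + L)"
  have S2: "0 < real (S2 \<epsilon>)" using S2_pos[of \<epsilon>] by simp
  have y: "0 < ?y" using S2 beta_pos[of \<epsilon>] mu L by simp
  then show "0 < q \<epsilon>" by (simp add: q_def)
  show "?y \<le> real (q \<epsilon>)" unfolding q_def by (rule real_nat_ceiling_ge)
  have "?y = \<mu> / (\<mu> + L) * ?x" by (simp add: mult_ac)
  also have "\<dots> \<le> 1 * ?x" using mu L S2 beta_pos[of \<epsilon>] by (intro mult_right_mono) auto
  finally have "?y \<le> ?x" by simp
  moreover have "real (q \<epsilon>) \<le> ?y + 1" using y unfolding q_def by linarith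
  \<comment> \<open>The left side of the goal is at most \<open>?y + 2\<close>, with one unit for
    the rounding and one for the last inner loop of an epoch. With \<open>?y\<close> at most
    \<open>?x\<close> this yields the bound by twice \<open>?x\<close>.\<close>
  moreover have "2 \<le> ?x"
  proof -
    have "13 / L * LQ \<epsilon> \<le> S2_const * LQ \<epsilon>"
      using LQ_ge_1[of \<epsilon>] mu L by (intro mult_right_mono) (auto simp: S2_const_def)
    then have "13 / L * LQ \<epsilon> \<le> real (S2 \<epsilon>)" using S2_ge(1)[of \<epsilon>] by linarith
    then have "L * \<beta> \<epsilon> * (13 / L * LQ \<epsilon>) \<le> ?x" using L beta_pos[of \<epsilon>] by (intro mult_left_mono) auto
    moreover have "L * \<beta> \<epsilon> * (13 / L * LQ \<epsilon>) = 2" using L LQ_ge_1[of \<epsilon>] by (simp add: \<beta>_def)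
    ultimately show ?thesis by simp
  qed
  ultimately show "real (q \<epsilon>) + 1 \<le> 2 * L * \<beta> \<epsilon> * real (S2 \<epsilon>)" by simp
qed

lemma S1_bounds:
  assumes "0 < \<epsilon>"
  shows "0 < S1 \<epsilon>" "4 * (3 * (M + L * M / \<mu>)\<^sup>2 + 33 * D * \<sigma>\<^sup>2) \<le> real (S1 \<epsilon>) * \<epsilon>"
proof -
  have pos: "0 < S1_const" unfolding S1_const_def using D_nonneg by (intro add_nonneg_pos mult_nonneg_nonneg add_nonneg_nonneg) auto
  then show "0 < S1 \<epsilon>" using assms by (simp add: S1_def)
  have "S1_const / \<epsilon> \<le> real (S1 \<epsilon>)" unfolding S1_def by (rule real_nat_ceiling_ge)
  then have "S1_const \<le> real (S1 \<epsilon>) * \<epsilon>" using assms by (simp add: divide_le_eq)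
  then show "4 * (3 * (M + L * M / \<mu>)\<^sup>2 + 33 * D * \<sigma>\<^sup>2) \<le> real (S1 \<epsilon>) * \<epsilon>" by (simp add: S1_const_def)
qed

lemma K_bound:
  assumes "0 < \<epsilon>"
  shows "K_const * Lm \<epsilon> ^ 3 \<le> real (Suc (K \<epsilon>)) * \<epsilon>"
proof -
  have "K_const * Lm \<epsilon> ^ 3 / \<epsilon> \<le> real (K \<epsilon>)" unfolding K_def by (rule real_nat_ceiling_ge)
  then have "K_const * Lm \<epsilon> ^ 3 / \<epsilon> \<le> real (Suc (K \<epsilon>))" by simp
  then show ?thesis using assms by (simp only: pos_divide_le_eq)
qed

text \<open>The logarithmic part of the depth brings a factor \<epsilon> into the squared bias. The
  constant in front is removed by the second summand of \<open>Q_min\<close>, which makes 12 (L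
  M/\<mu>)^2 at most t = 2\<eta>\<mu> Q_min, together with t \<le> exp t.\<close>

lemma Q_bound:
  assumes "0 < \<epsilon>"
  shows "12 * (L * M / \<mu>)\<^sup>2 * exp (- (2 * \<eta> * \<mu> * real (Suc (Q \<epsilon>)))) \<le> \<epsilon>"
proof -
  let ?B = "12 * (L * M / \<mu>)\<^sup>2" and ?x = "2 * \<eta> * \<mu> * real Q_min" and ?n = "nat \<lceil>ln (1 / \<epsilon>) / (2 * \<eta> * \<mu>)\<rceil>"
  have em: "0 < 2 * \<eta> * \<mu>" using eta mu by simp
  have "ln (1 / \<epsilon>) / (2 * \<eta> * \<mu>) \<le> real ?n" by (rule real_nat_ceiling_ge)
  then have n: "ln (1 / \<epsilon>) \<le> 2 * \<eta> * \<mu> * real ?n" using em by (simp add: pos_divide_le_eq mult.commute)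
  have "6 * (L * M / \<mu>)\<^sup>2 / (\<eta> * \<mu>) \<le> real Q_min"
    using real_nat_ceiling_ge[of "6 * (L * M / \<mu>)\<^sup>2 / (\<eta> * \<mu>)"] by (simp add: Q_min_def)
  then have B: "?B \<le> ?x" using eta mu by (simp add: pos_divide_le_eq mult_ac)
  also have "?x \<le> exp ?x" using exp_ge_add_one_self[of ?x] by linarith
  finally have "?B * exp (- ?x) \<le> exp ?x * exp (- ?x)" by (rule mult_right_mono) simp
  then have B1: "?B * exp (- ?x) \<le> 1" unfolding exp_minus_inverse .
  have "2 * \<eta> * \<mu> * real (Suc (Q \<epsilon>)) = ?x + 2 * \<eta> * \<mu> * real ?n + 2 * \<eta> * \<mu>" by (simp add: Q_def algebra_simps)
  then have "- (2 * \<eta> * \<mu> * real (Suc (Q \<epsilon>))) \<le> - ?x + ln \<epsilon>" using n em assms by (simp add: ln_div)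
  then have "exp (- (2 * \<eta> * \<mu> * real (Suc (Q \<epsilon>)))) \<le> exp (- ?x + ln \<epsilon>)" by simp
  also have "\<dots> = exp (- ?x) * \<epsilon>" using assms by (simp only: exp_add exp_ln)
  finally have "?B * exp (- (2 * \<eta> * \<mu> * real (Suc (Q \<epsilon>)))) \<le> ?B * (exp (- ?x) * \<epsilon>)" by (intro mult_left_mono) auto
  also have "\<dots> \<le> 1 * \<epsilon>" unfolding mult.assoc[symmetric] using B1 assms by (intro mult_right_mono) auto
  finally show ?thesis by simp
qed

lemma Q_le: "1 \<le> ln (1 / \<epsilon>) \<Longrightarrow> real (Q \<epsilon>) \<le> (real Q_min + 1 + 1 / (2 * \<eta> * \<mu>)) * ln (1 / \<epsilon>)"
proof -
  let ?l = "ln (1 / \<epsilon>)"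
  assume l: "1 \<le> ?l"
  have "real (Q \<epsilon>) \<le> real Q_min + (?l / (2 * \<eta> * \<mu>) + 1)"
    using ceiling_le[of "?l / (2 * \<eta> * \<mu>)"] l eta mu by (simp add: Q_def)
  also have "\<dots> \<le> (real Q_min + 1) * ?l + ?l / (2 * \<eta> * \<mu>)"
    using mult_left_mono[OF l, of "real Q_min + 1"] by simp
  finally show ?thesis by (simp add: algebra_simps)
qed

lemma Q_eps_log: "(\<lambda>\<epsilon>. real (Q \<epsilon>)) \<in> eps_log 0 1"
  by (rule eps_logI) (use Q_le in simp)

text \<open>Under the root stands a polynomial of degree at most 4 in \<open>Q\<close>, and
  \<open>Q\<close> is of logarithmic order; hence the square of the logarithm.\<close>

lemma LQ_eps_log: "LQ \<in> eps_log 0 2"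
proof -
  define k where "k = 2 * L\<^sup>2 + 4 * \<tau>\<^sup>2 * \<eta>\<^sup>2 * M\<^sup>2 + 8 * L ^ 4 * \<eta>\<^sup>2 + 2 * L\<^sup>2 * \<eta> ^ 4 * M\<^sup>2 * \<rho>\<^sup>2"
  have Q1: "(\<lambda>\<epsilon>. real (Q \<epsilon>) + 1) \<in> eps_log 0 1"
    using eps_log_add[OF Q_eps_log eps_log_mono[OF eps_log_const[of 1], of 0 1]] by simp
  have "(\<lambda>\<epsilon>. sqrt k * ((real (Q \<epsilon>) + 1) * (real (Q \<epsilon>) + 1))) \<in> eps_log (0 + (0 + 0)) (0 + (1 + 1))"
    by (intro eps_log_mult eps_log_const Q1)
  then have bound: "(\<lambda>\<epsilon>. sqrt k * ((real (Q \<epsilon>) + 1) * (real (Q \<epsilon>) + 1))) \<in> eps_log 0 2"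
    by (rule eps_log_mono) simp_all
  have le: "\<bar>LQ \<epsilon>\<bar> \<le> \<bar>sqrt k * ((real (Q \<epsilon>) + 1) * (real (Q \<epsilon>) + 1))\<bar>" for \<epsilon>
  proof -
    let ?n = "real (Q \<epsilon>) + 1"
    have k0: "0 \<le> k" by (simp add: k_def)
    have n1: "1 \<le> ?n" by simp
    have e1: "?n\<^sup>2 \<le> ?n ^ 4" by (rule power_increasing) (use n1 in auto)
    have e0: "1 \<le> ?n ^ 4" by (rule one_le_power) (use n1 in auto)
    have e2: "(real (Q \<epsilon>))\<^sup>2 * ?n\<^sup>2 \<le> ?n ^ 4"
      using mult_right_mono[of "(real (Q \<epsilon>))\<^sup>2" "?n\<^sup>2" "?n\<^sup>2"] power_mono[of "real (Q \<epsilon>)" ?n 2] by (simp flip: power_add)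
    have "2 * L\<^sup>2 * 1 + 4 * \<tau>\<^sup>2 * \<eta>\<^sup>2 * M\<^sup>2 * ?n\<^sup>2 + 8 * L ^ 4 * \<eta>\<^sup>2 * ?n\<^sup>2
        + 2 * L\<^sup>2 * \<eta> ^ 4 * M\<^sup>2 * \<rho>\<^sup>2 * ((real (Q \<epsilon>))\<^sup>2 * ?n\<^sup>2)
      \<le> 2 * L\<^sup>2 * ?n ^ 4 + 4 * \<tau>\<^sup>2 * \<eta>\<^sup>2 * M\<^sup>2 * ?n ^ 4 + 8 * L ^ 4 * \<eta>\<^sup>2 * ?n ^ 4
        + 2 * L\<^sup>2 * \<eta> ^ 4 * M\<^sup>2 * \<rho>\<^sup>2 * ?n ^ 4"
      using e0 e1 e2 by (intro add_mono mult_left_mono) auto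
    also have "\<dots> = k * (?n\<^sup>2)\<^sup>2" by (simp add: k_def algebra_simps flip: power_mult)
    finally have "LQ \<epsilon> \<le> sqrt (k * (?n\<^sup>2)\<^sup>2)"
      unfolding LQ_def L_Q_def by (intro real_sqrt_le_mono) (simp add: mult.assoc)
    also have "\<dots> = sqrt k * (?n * ?n)" by (simp add: real_sqrt_mult power2_eq_square)
    finally show ?thesis using LQ_ge_1[of \<epsilon>] by simp
  qed
  show ?thesis by (rule eps_log_bound[OF bound le])
qed

lemma Lm_eps_log: "Lm \<in> eps_log 0 2"
proof -
  have "(\<lambda>\<epsilon>. LQ \<epsilon> + \<bar>L_Phi \<mu> M L \<tau> \<rho>\<bar>) \<in> eps_log 0 2"
    by (intro eps_log_add LQ_eps_log eps_log_mono[OF eps_log_const]) auto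
  then show ?thesis
  proof (rule eps_log_bound)
    fix \<epsilon> :: real
    have "Lm \<epsilon> \<le> LQ \<epsilon> + \<bar>L_Phi \<mu> M L \<tau> \<rho>\<bar>" unfolding Lm_def using LQ_ge_1[of \<epsilon>] by (auto intro: add_increasing)
    then show "\<bar>Lm \<epsilon>\<bar> \<le> \<bar>LQ \<epsilon> + \<bar>L_Phi \<mu> M L \<tau> \<rho>\<bar>\<bar>" using Lm_ge_1[of \<epsilon>] by linarith
  qed
qed

lemma inverse_eps_log: "(\<lambda>\<epsilon>. 1 / \<epsilon>) \<in> eps_log (-1) 0"
  by (rule eps_logI[of _ 1]) (simp add: powr_minus divide_inverse)

lemma S1_eps_log: "(\<lambda>\<epsilon>. real (S1 \<epsilon>)) \<in> eps_log (-1) 0"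
proof (rule eps_logI)
  fix \<epsilon> :: real assume e: "0 < \<epsilon>" "\<epsilon> < 1"
  have c: "0 \<le> S1_const" unfolding S1_const_def using D_nonneg by (intro add_nonneg_nonneg mult_nonneg_nonneg) auto
  have "real (S1 \<epsilon>) \<le> S1_const / \<epsilon> + 1" unfolding S1_def using c e by (intro ceiling_le) auto
  also have "\<dots> \<le> (S1_const + 1) / \<epsilon>" using e by (simp add: field_simps)
  finally show "\<bar>real (S1 \<epsilon>)\<bar> \<le> (S1_const + 1) * (\<epsilon> powr (-1) * ln (1 / \<epsilon>) ^ 0)"
    using e by (simp add: powr_minus divide_inverse)
qed

text \<open>The multiple of \<open>LQ\<close> contained in the batch size is polylogarithmic and
  therefore dominated by \<epsilon> to the power -1/2.\<close>

lemma S2_eps_log: "(\<lambda>\<epsilon>. real (S2 \<epsilon>)) \<in> eps_log (-0.5) 0"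
proof -
  have "LQ \<in> eps_log (-0.5) 0"
  proof -
    have "(\<lambda>\<epsilon>::real. \<epsilon> powr 0 * ln (1 / \<epsilon>) ^ 2) \<in> O[at_right 0](\<lambda>\<epsilon>. \<epsilon> powr (-0.5) * ln (1 / \<epsilon>) ^ 0)"
      by real_asymp
    then show ?thesis using LQ_eps_log unfolding eps_log_def by (rule landau_o.big_trans[rotated])
  qed
  then have "(\<lambda>\<epsilon>. S2_const * LQ \<epsilon>) \<in> eps_log (0 + -0.5) (0 + 0)" by (intro eps_log_mult eps_log_const)
  moreover have "(\<lambda>\<epsilon>. \<epsilon> powr (-0.5)) \<in> eps_log (-0.5) 0" by (rule eps_logI[of _ 1]) simp
  moreover have "(\<lambda>\<epsilon>. 3) \<in> eps_log (-0.5) 0" by (rule eps_log_mono[OF eps_log_const]) auto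
  ultimately have "(\<lambda>\<epsilon>. \<epsilon> powr (-0.5) + S2_const * LQ \<epsilon> + 3) \<in> eps_log (-0.5) 0" by (intro eps_log_add) auto
  then show ?thesis
  proof (rule eps_log_bound)
    fix \<epsilon> :: real assume "0 < \<epsilon>"
    have c: "0 \<le> S2_const * LQ \<epsilon>" using mu L LQ_ge_1[of \<epsilon>] by (simp add: S2_const_def)
    have h: "real (S2 \<epsilon>) \<le> \<epsilon> powr (-0.5) + S2_const * LQ \<epsilon> + 3"
      unfolding S2_real using ceiling_le[OF c] ceiling_le[OF powr_ge_zero, of \<epsilon> "-0.5"] by argo
    show "\<bar>real (S2 \<epsilon>)\<bar> \<le> \<bar>\<epsilon> powr (-0.5) + S2_const * LQ \<epsilon> + 3\<bar>"
      unfolding abs_of_nat by (rule order_trans[OF h abs_ge_self])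
  qed
qed

lemma K_bigo: "(\<lambda>\<epsilon>. real (K \<epsilon>)) \<in> O[at_right 0](\<lambda>\<epsilon>. Lm \<epsilon> ^ 3 * (1 / \<epsilon>))"
proof (rule bigoI[where c = "K_const + 1"], rule eventually_mono[OF eventually_small])
  fix \<epsilon> :: real assume e: "0 < \<epsilon> \<and> \<epsilon> < 1 \<and> 1 \<le> ln (1 / \<epsilon>)"
  have c: "0 \<le> K_const" using D_nonneg by (simp add: K_const_def)
  have l3: "1 \<le> Lm \<epsilon> ^ 3" by (rule one_le_power) (rule Lm_ge_1)
  have "1 * 1 \<le> Lm \<epsilon> ^ 3 * (1 / \<epsilon>)" using l3 e Lm_ge_1[of \<epsilon>] by (intro mult_mono) auto
  moreover have "0 \<le> K_const * Lm \<epsilon> ^ 3 / \<epsilon>" using c l3 e by (intro divide_nonneg_pos mult_nonneg_nonneg) linarith+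
  then have "real (K \<epsilon>) \<le> K_const * Lm \<epsilon> ^ 3 / \<epsilon> + 1" unfolding K_def by (rule ceiling_le)
  moreover have "(K_const + 1) * (Lm \<epsilon> ^ 3 * (1 / \<epsilon>)) = K_const * Lm \<epsilon> ^ 3 / \<epsilon> + Lm \<epsilon> ^ 3 * (1 / \<epsilon>)"
    by (simp add: distrib_right add_divide_distrib)
  ultimately have "real (K \<epsilon>) \<le> (K_const + 1) * (Lm \<epsilon> ^ 3 * (1 / \<epsilon>))" by argo
  then show "norm (real (K \<epsilon>)) \<le> (K_const + 1) * norm (Lm \<epsilon> ^ 3 * (1 / \<epsilon>))" using l3 e by simp
qed

lemma K_eps_log: "(\<lambda>\<epsilon>. real (K \<epsilon>) + 1) \<in> eps_log (-1) 6"
proof -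
  have "(\<lambda>\<epsilon>. Lm \<epsilon> * (Lm \<epsilon> * Lm \<epsilon>) * (1 / \<epsilon>)) \<in> eps_log (0 + (0 + 0) + -1) (2 + (2 + 2) + 0)"
    by (intro eps_log_mult Lm_eps_log inverse_eps_log)
  then have "(\<lambda>\<epsilon>. Lm \<epsilon> ^ 3 * (1 / \<epsilon>)) \<in> eps_log (-1) 6" by (simp add: power3_eq_cube mult.assoc)
  with K_bigo have "(\<lambda>\<epsilon>. real (K \<epsilon>)) \<in> eps_log (-1) 6" unfolding eps_log_def by (rule landau_o.big_trans)
  then show ?thesis by (intro eps_log_add eps_log_mono[OF eps_log_const]) auto
qed

lemma m_eps_log: "(\<lambda>\<epsilon>. real (m \<epsilon>) + 2) \<in> eps_log 0 2"
proof -
  have "(\<lambda>\<epsilon>. 104 / \<mu> * LQ \<epsilon>) \<in> eps_log (0 + 0) (0 + 2)" by (intro eps_log_mult eps_log_const LQ_eps_log)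
  then have "(\<lambda>\<epsilon>. 104 / \<mu> * LQ \<epsilon>) \<in> eps_log 0 2" by (rule eps_log_mono) simp_all
  then have "(\<lambda>\<epsilon>. 104 / \<mu> * LQ \<epsilon> + 2) \<in> eps_log 0 2"
    by (rule eps_log_add) (rule eps_log_mono[OF eps_log_const]; simp)
  then show ?thesis
  proof (rule eps_log_bound)
    fix \<epsilon> :: real
    have e: "16 / (\<mu> * \<beta> \<epsilon>) = 104 / \<mu> * LQ \<epsilon>" by (simp add: \<beta>_def)
    have "0 \<le> 104 / \<mu> * LQ \<epsilon>" using mu LQ_ge_1[of \<epsilon>] by simp
    moreover have "real (nat \<lceil>x - 1\<rceil>) \<le> x" if "0 \<le> x" for x :: real using that by linarith
    ultimately have "real (m \<epsilon>) \<le> 104 / \<mu> * LQ \<epsilon>" unfolding m_def e by blast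
    then show "\<bar>real (m \<epsilon>) + 2\<bar> \<le> \<bar>104 / \<mu> * LQ \<epsilon> + 2\<bar>" by simp
  qed
qed

text \<open>\<open>q\<close> is at least a multiple of \<beta>S2, and 1/\<beta> is a multiple of
  \<open>LQ\<close>, which accounts for the two logarithms.\<close>

lemma inverse_q_eps_log: "(\<lambda>\<epsilon>. 1 / real (q \<epsilon>)) \<in> eps_log 0.5 2"
proof -
  have "(\<lambda>\<epsilon>. 13 * (\<mu> + L) / (2 * \<mu> * L) * (LQ \<epsilon> * \<epsilon> powr 0.5)) \<in> eps_log (0 + (0 + 0.5)) (0 + (2 + 0))"
    by (intro eps_log_mult eps_log_const LQ_eps_log eps_logI[of _ 1]) simp
  then have "(\<lambda>\<epsilon>. 13 * (\<mu> + L) / (2 * \<mu> * L) * (LQ \<epsilon> * \<epsilon> powr 0.5)) \<in> eps_log 0.5 2"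
    by (rule eps_log_mono) simp_all
  then show ?thesis
  proof (rule eps_log_bound)
    fix \<epsilon> :: real assume e: "0 < \<epsilon>"
    have b: "0 < \<mu> * L * \<beta> \<epsilon> / (\<mu> + L)" using mu L beta_pos[of \<epsilon>] by simp
    have pp: "0 < \<epsilon> powr (-0.5)" using e by simp
    have "\<mu> * L * \<beta> \<epsilon> / (\<mu> + L) * \<epsilon> powr (-0.5) \<le> \<mu> * L * \<beta> \<epsilon> / (\<mu> + L) * real (S2 \<epsilon>)"
      using b by (intro mult_left_mono S2_ge) auto
    also have "\<dots> \<le> real (q \<epsilon>)" using q_bounds(3)[of \<epsilon>] by simp
    finally have "1 / real (q \<epsilon>) \<le> 1 / (\<mu> * L * \<beta> \<epsilon> / (\<mu> + L) * \<epsilon> powr (-0.5))"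
      by (rule frac_le[OF zero_le_one order_refl mult_pos_pos[OF b pp]])
    also have "\<dots> = 13 * (\<mu> + L) / (2 * \<mu> * L) * (LQ \<epsilon> * \<epsilon> powr 0.5)"
      unfolding \<beta>_def powr_minus_divide by (simp add: field_simps)
    finally have h: "1 / real (q \<epsilon>) \<le> 13 * (\<mu> + L) / (2 * \<mu> * L) * (LQ \<epsilon> * \<epsilon> powr 0.5)" .
    show "\<bar>1 / real (q \<epsilon>)\<bar> \<le> \<bar>13 * (\<mu> + L) / (2 * \<mu> * L) * (LQ \<epsilon> * \<epsilon> powr 0.5)\<bar>"
      by (rule order_trans[OF eq_refl order_trans[OF h abs_ge_self]]) simp
  qed
qed

text \<open>Up to logarithms, the large batches cost 1/\<epsilon> samples in each of
  \<epsilon>^(-1/2) epochs, the small ones \<epsilon>^(-1/2) samples in each of 1/\<epsilon>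
  iterations. The 8 is 6 logarithms from \<open>K\<close> plus 2 from either 1/q or m.\<close>

lemma complexity_eps_log:
  assumes x: "(\<lambda>\<epsilon>. real (x \<epsilon>)) \<in> eps_log (-1) n" and y: "(\<lambda>\<epsilon>. real (y \<epsilon>)) \<in> eps_log (-0.5) n"
  shows "(\<lambda>\<epsilon>. real (\<Sum>k=0..K \<epsilon>. (if k mod q \<epsilon> = 0 then x \<epsilon> else 0) + (\<Sum>i=0..m \<epsilon> + 1. y \<epsilon>))) \<in> eps_log (-1.5) (n + 8)"
proof -
  have "(\<lambda>\<epsilon>. (real (K \<epsilon>) + 1) * (1 / real (q \<epsilon>))) \<in> eps_log (-1 + 0.5) (6 + 2)"
    by (intro eps_log_mult K_eps_log inverse_q_eps_log)
  then have "(\<lambda>\<epsilon>. (real (K \<epsilon>) + 1) * (1 / real (q \<epsilon>)) + 1) \<in> eps_log (-0.5) 8"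
    by (intro eps_log_add eps_log_mono[OF eps_log_const]) auto
  then have "(\<lambda>\<epsilon>. real (x \<epsilon>) * ((real (K \<epsilon>) + 1) * (1 / real (q \<epsilon>)) + 1)) \<in> eps_log (-1 + -0.5) (n + 8)"
    by (intro eps_log_mult x)
  moreover have "(\<lambda>\<epsilon>. (real (K \<epsilon>) + 1) * (real (m \<epsilon>) + 2) * real (y \<epsilon>)) \<in> eps_log (-1 + 0 + -0.5) (6 + 2 + n)"
    by (intro eps_log_mult K_eps_log m_eps_log y)
  ultimately have "(\<lambda>\<epsilon>. real (x \<epsilon>) * ((real (K \<epsilon>) + 1) * (1 / real (q \<epsilon>)) + 1)
      + (real (K \<epsilon>) + 1) * (real (m \<epsilon>) + 2) * real (y \<epsilon>)) \<in> eps_log (-1.5) (n + 8)"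
    by (intro eps_log_add) (simp_all add: add.commute)
  then show ?thesis
  proof (rule eps_log_bound)
    fix \<epsilon> :: real
    show "\<bar>real (\<Sum>k=0..K \<epsilon>. (if k mod q \<epsilon> = 0 then x \<epsilon> else 0) + (\<Sum>i=0..m \<epsilon> + 1. y \<epsilon>))\<bar>
      \<le> \<bar>real (x \<epsilon>) * ((real (K \<epsilon>) + 1) * (1 / real (q \<epsilon>)) + 1) + (real (K \<epsilon>) + 1) * (real (m \<epsilon>) + 2) * real (y \<epsilon>)\<bar>"
      by (intro order_trans[OF _ abs_ge_self]) (simp only: abs_of_nat complexity_sum[OF q_bounds(1)])
  qed
qed

definition "params \<epsilon> = \<lparr> par_alpha = 1 / (20 * Lm \<epsilon> ^ 3), par_beta = \<beta> \<epsilon>, par_eta = \<eta>, par_Q = Q \<epsilon>,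
  par_S1 = S1 \<epsilon>, par_S2 = S2 \<epsilon>, par_q = q \<epsilon>, par_m = m \<epsilon> \<rparr>"

lemma gradient_complexity_soft_O: "(\<lambda>\<epsilon>. real (gradient_complexity (params \<epsilon>) (K \<epsilon>))) \<in> soft_O (\<lambda>\<epsilon>. \<epsilon> powr (-1.5))"
proof -
  have "(\<lambda>\<epsilon>. 3 * real (S1 \<epsilon>)) \<in> eps_log (0 + -1) (0 + 0)" "(\<lambda>\<epsilon>. 6 * real (S2 \<epsilon>)) \<in> eps_log (0 + -0.5) (0 + 0)"
    by (intro eps_log_mult eps_log_const S1_eps_log S2_eps_log)+
  then have "(\<lambda>\<epsilon>. real (2 * S1 \<epsilon> + S1 \<epsilon>)) \<in> eps_log (-1) 0" "(\<lambda>\<epsilon>. real (2 * (2 * S2 \<epsilon> + S2 \<epsilon>))) \<in> eps_log (-0.5) 0"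
    by simp_all
  from eps_log_soft_O[OF complexity_eps_log[OF this]] show ?thesis
    by (simp only: gradient_complexity_def params_def vrbo_params.simps)
qed

lemma hessian_vector_complexity_soft_O: "(\<lambda>\<epsilon>. real (hessian_vector_complexity (params \<epsilon>) (K \<epsilon>))) \<in> soft_O (\<lambda>\<epsilon>. \<epsilon> powr (-1.5))"
proof -
  have "(\<lambda>\<epsilon>. real (Q \<epsilon>) * real (S1 \<epsilon>)) \<in> eps_log (0 + -1) (1 + 0)" "(\<lambda>\<epsilon>. 2 * (real (Q \<epsilon>) * real (S2 \<epsilon>))) \<in> eps_log (0 + (0 + -0.5)) (0 + (1 + 0))"
    by (intro eps_log_mult eps_log_const Q_eps_log S1_eps_log S2_eps_log)+
  then have "(\<lambda>\<epsilon>. real (Q \<epsilon> * S1 \<epsilon>)) \<in> eps_log (-1) 1" "(\<lambda>\<epsilon>. real (2 * (Q \<epsilon> * S2 \<epsilon>))) \<in> eps_log (-0.5) 1"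
    by simp_all
  from eps_log_soft_O[OF complexity_eps_log[OF this]] show ?thesis
    by (simp only: hessian_vector_complexity_def params_def vrbo_params.simps)
qed

lemma S1_bigo: "(\<lambda>\<epsilon>. real (S1 \<epsilon>)) \<in> O[at_right 0](\<lambda>\<epsilon>. 1 / \<epsilon>)"
proof -
  have "(\<lambda>\<epsilon>::real. \<epsilon> powr (-1) * ln (1 / \<epsilon>) ^ 0) \<in> O[at_right 0](\<lambda>\<epsilon>. 1 / \<epsilon>)" by real_asymp
  with S1_eps_log show ?thesis unfolding eps_log_def by (rule landau_o.big_trans)
qed

lemma S2_bigo: "(\<lambda>\<epsilon>. real (S2 \<epsilon>)) \<in> O[at_right 0](\<lambda>\<epsilon>. \<epsilon> powr (-0.5))"
  using S2_eps_log by (simp add: eps_log_def)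

lemma Q_bigo: "(\<lambda>\<epsilon>. real (Q \<epsilon>)) \<in> O[at_right 0](\<lambda>\<epsilon>. ln (1 / \<epsilon> powr 0.5))"
proof -
  have "(\<lambda>\<epsilon>::real. \<epsilon> powr 0 * ln (1 / \<epsilon>) ^ 1) \<in> O[at_right 0](\<lambda>\<epsilon>. ln (1 / \<epsilon> powr 0.5))" by real_asymp
  with Q_eps_log show ?thesis unfolding eps_log_def by (rule landau_o.big_trans)
qed

end

text \<open>The parameter functions are fixed before the problem instance, so the initial gap and
  the initial distance enter through the bounds \<Delta> and R. Since the descent inequality leaves
  an error of order 1/(\<alpha>K), the prescribed \<alpha> makes K proportional to
  Lm^3/\<epsilon>.\<close>

theorem corollary2:
  fixes \<mu> M L \<tau> \<rho> \<sigma> \<eta> \<Delta> R :: real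
  assumes "0 < \<mu>" and "0 < \<eta>" and "\<eta> < 1 / L"
  shows "\<exists>S1 S2 Q K :: real \<Rightarrow> nat.
    let LQ = (\<lambda>\<epsilon>. L_Q M L \<tau> \<rho> \<eta> (Q \<epsilon>));
        Lm = (\<lambda>\<epsilon>. max (LQ \<epsilon>) (L_Phi \<mu> M L \<tau> \<rho>));
        \<alpha> = (\<lambda>\<epsilon>. 1 / (20 * Lm \<epsilon> ^ 3));
        \<beta> = (\<lambda>\<epsilon>. 2 / (13 * LQ \<epsilon>));
        m = (\<lambda>\<epsilon>. nat \<lceil>16 / (\<mu> * \<beta> \<epsilon>) - 1\<rceil>);
        q = (\<lambda>\<epsilon>. nat \<lceil>\<mu> * L * \<beta> \<epsilon> * real (S2 \<epsilon>) / (\<mu> + L)\<rceil>);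
        p = (\<lambda>\<epsilon>. \<lparr> par_alpha = \<alpha> \<epsilon>, par_beta = \<beta> \<epsilon>, par_eta = \<eta>, par_Q = Q \<epsilon>,
                     par_S1 = S1 \<epsilon>, par_S2 = S2 \<epsilon>, par_q = q \<epsilon>, par_m = m \<epsilon> \<rparr>)
    in
      (\<lambda>\<epsilon>. real (S1 \<epsilon>)) \<in> O[at_right 0](\<lambda>\<epsilon>. 1 / \<epsilon>) \<and>
      (\<lambda>\<epsilon>. real (S2 \<epsilon>)) \<in> O[at_right 0](\<lambda>\<epsilon>. \<epsilon> powr (-0.5)) \<and>
      (\<lambda>\<epsilon>. real (Q \<epsilon>)) \<in> O[at_right 0](\<lambda>\<epsilon>. ln (1 / \<epsilon> powr 0.5)) \<and>
      (\<lambda>\<epsilon>. real (K \<epsilon>)) \<in> O[at_right 0](\<lambda>\<epsilon>. Lm \<epsilon> ^ 3 * (1 / \<epsilon>)) \<and>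
      (\<forall>\<epsilon>>0. 0 < S1 \<epsilon> \<and> 0 < S2 \<epsilon> \<and> real (S2 \<epsilon>) \<ge> 2 * (L / \<mu> + 1) * L * \<beta> \<epsilon>) \<and>
      (\<forall>(Dxi :: 'xi measure) (Dzeta :: 'zeta measure)
         (F :: 'xi \<Rightarrow> 'a::euclidean_space \<times> 'b::euclidean_space \<Rightarrow> real) G x0 y0.
         let f = mean_fun Dxi F; g = mean_fun Dzeta G; \<Phi> = Phi f g
         in stochastic_bilevel \<mu> M L \<tau> \<rho> \<sigma> Dxi Dzeta F G \<longrightarrow>
            bdd_below (range \<Phi>) \<longrightarrow> \<Phi> x0 - (INF x. \<Phi> x) \<le> \<Delta> \<longrightarrow> norm (y0 - ystar g x0) \<le> R \<longrightarrow>
            (\<forall>\<epsilon>>0. eps_stationary_in_expectation \<epsilon> \<Phi>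
                      (output_space Dxi Dzeta (K \<epsilon>)) (vrbo_output (p \<epsilon>) F G (x0, y0)))) \<and>
      (\<lambda>\<epsilon>. real (gradient_complexity (p \<epsilon>) (K \<epsilon>))) \<in> soft_O (\<lambda>\<epsilon>. \<epsilon> powr (-1.5)) \<and>
      (\<lambda>\<epsilon>. real (hessian_vector_complexity (p \<epsilon>) (K \<epsilon>))) \<in> soft_O (\<lambda>\<epsilon>. \<epsilon> powr (-1.5))"
proof -
  have L: "0 < L"
  proof (rule ccontr)
    assume "\<not> 0 < L"
    \<comment> \<open>This includes L = 0, where the quotient is 0 by convention.\<close>
    then have "1 / L \<le> 0" by simp
    then show False using assms(2,3) by linarith
  qed
  have eta_L: "\<eta> * L \<le> 1" using assms(3) L by (simp add: field_simps)
  interpret pc: parameter_choice \<mu> M L \<tau> \<rho> \<sigma> \<eta> \<Delta> R by unfold_locales (rule assms L)+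
  have stationary: "\<forall>(Dxi :: 'xi measure) (Dzeta :: 'zeta measure)
         (F :: 'xi \<Rightarrow> 'a \<times> 'b \<Rightarrow> real) G x0 y0.
         stochastic_bilevel \<mu> M L \<tau> \<rho> \<sigma> Dxi Dzeta F G \<longrightarrow>
            bdd_below (range (Phi (mean_fun Dxi F) (mean_fun Dzeta G))) \<longrightarrow>
            Phi (mean_fun Dxi F) (mean_fun Dzeta G) x0 - (INF x. Phi (mean_fun Dxi F) (mean_fun Dzeta G) x) \<le> \<Delta> \<longrightarrow>
            norm (y0 - ystar (mean_fun Dzeta G) x0) \<le> R \<longrightarrow>
            (\<forall>\<epsilon>>0. eps_stationary_in_expectation \<epsilon> (Phi (mean_fun Dxi F) (mean_fun Dzeta G))
                      (output_space Dxi Dzeta (pc.K \<epsilon>)) (vrbo_output (pc.params \<epsilon>) F G (x0, y0)))"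
  proof (intro allI impI)
    fix Dxi :: "'xi measure" and Dzeta :: "'zeta measure" and F :: "'xi \<Rightarrow> 'a \<times> 'b \<Rightarrow> real" and G x0 y0 and \<epsilon> :: real
    let ?\<Phi> = "Phi (mean_fun Dxi F) (mean_fun Dzeta G)"
    assume a: "stochastic_bilevel \<mu> M L \<tau> \<rho> \<sigma> Dxi Dzeta F G" "bdd_below (range ?\<Phi>)"
      "?\<Phi> x0 - (INF x. ?\<Phi> x) \<le> \<Delta>" "norm (y0 - ystar (mean_fun Dzeta G) x0) \<le> R" and e: "0 < \<epsilon>"
    have m: "16 / (\<mu> * (2 / (13 * pc.LQ \<epsilon>))) - 1 \<le> real (pc.m \<epsilon>)"
      unfolding pc.m_def pc.\<beta>_def by (rule real_nat_ceiling_ge)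
    have S2: "0 < pc.S2 \<epsilon>" by (rule pc.S2_pos)
    show "eps_stationary_in_expectation \<epsilon> ?\<Phi> (output_space Dxi Dzeta (pc.K \<epsilon>)) (vrbo_output (pc.params \<epsilon>) F G (x0, y0))"
      unfolding pc.params_def pc.\<beta>_def
      by (rule vrbo_stationary[OF a(1) assms(1,2) eta_L e pc.LQ_ge[unfolded pc.C_def] pc.LQ_le_Lm m pc.q_bounds(1)
            pc.q_bounds(2)[unfolded pc.\<beta>_def] S2 pc.S1_bounds(2)[OF e, unfolded pc.D_def] pc.S1_bounds(1)[OF e]
            pc.K_bound[OF e, unfolded pc.K_const_def pc.D_def] pc.Q_bound[OF e] a(2-4)])
  qed
  show ?thesis
    \<comment> \<open>Folding in dependency order turns the expanded \<open>let\<close> bindings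
      back into the constants of \<open>parameter_choice\<close>, for which all parts are already
      proved.\<close>
    by (rule exI[of _ pc.S1], rule exI[of _ pc.S2], rule exI[of _ pc.Q], rule exI[of _ pc.K],
        unfold Let_def, fold pc.LQ_def, fold pc.Lm_def pc.\<beta>_def, fold pc.m_def pc.q_def, fold pc.params_def)
      (intro conjI pc.S1_bigo pc.S2_bigo pc.Q_bigo pc.K_bigo pc.gradient_complexity_soft_O
        pc.hessian_vector_complexity_soft_O stationary, use pc.S1_bounds(1) pc.S2_cond pc.S2_pos in auto)
qed

end
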